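(* Let a hyperelliptic curve of genus $g$ (in the canonical form described in the context) have all finite branch points real. Then on the affine subspace $$\sum_{k=1}^{g}\tfrac12\omega'_k+\mathbb{R}^g\subset\mathbb{C}^g$$ the function $\wp_{1,1}$ is bounded and real-valued.
   Context: The curve is non-degenerate, $y^2=\Lambda(x)=x^{2g+1}+\sum_{i=0}^{2g}\lambda_{2i+2}x^{2g-i}$, with real branch points (roots of $\Lambda$) $e_1<e_2<\dots<e_{2g+1}$. Cuts are made between $e_{2k-1}$ and $e_{2k}$, $k=1,\dots,g$, and from $e_{2g+1}$ to $\infty$; $\mathfrak{a}_k$ encircles the cut $(e_{2k-1},e_{2k})$, and $\mathfrak{b}_k$ emerges from the cut $(e_{2k-1},e_{2k})$ and enters the cut $(e_{2g+1},\infty)$. Differentials (with $\lambda_0=1$): $$\mathrm{d}u_{2n-1}=\frac{x^{g-n}\mathrm{d}x}{-2y},\qquad \mathrm{d}r_{2n-1}=\frac{\mathrm{d}x}{-2y}\sum_{j=0}^{2n-2}(2n-1-j)\lambda_{2j}x^{g+n-1-j},\qquad n=1,\dots,g,$$ $\mathrm{d}u=(\mathrm{d}u_1,\mathrm{d}u_3,\dots,\mathrm{d}u_{2g-1})^t$, $\mathrm{d}r=(\mathrm{d}r_1,\mathrm{d}r_3,\dots,\mathrm{d}r_{2g-1})^t$. The matrices $\omega,\omega',\eta$ have columns $$\omega_k=\oint_{\mathfrak{a}_k}\mathrm{d}u=2\int_{e_{2k-1}}^{e_{2k}}\mathrm{d}u,\quad \omega'_k=\oint_{\mathfrak{b}_k}\mathrm{d}u=2\sum_{i=k}^{g}\int_{e_{2i}}^{e_{2i+1}}\mathrm{d}u,\quad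 \eta_k=\oint_{\mathfrak{a}_k}\mathrm{d}r=2\int_{e_{2k-1}}^{e_{2k}}\mathrm{d}r,$$ the integrals being along the real axis, with $y$ the boundary values from the upper half-plane of one fixed analytic branch of $\sqrt{\Lambda}$. Here $\omega$ is real and $\omega'$ purely imaginary; $\tau=\omega^{-1}\omega'$ is symmetric with $\operatorname{Im}\tau>0$; $\varkappa=\eta\omega^{-1}$ is symmetric. Theta function: $\theta(v;\tau)=\sum_{n\in\mathbb{Z}^g}\exp(\imath\pi n^t\tau n+2\imath\pi n^tv)$; with characteristic $[\varepsilon]=(\varepsilon',\varepsilon)^t$: $$\theta[\varepsilon](v;\tau)=\exp\big(\imath\pi(\varepsilon'^t/2)\tau(\varepsilon'/2)+2\imath\pi(v+\varepsilon/2)^t\varepsilon'/2\big)\,\theta(v+\varepsilon/2+\tau\varepsilon'/2;\tau).$$ The characteristic $[K]$ of the vector of Riemann constants (with these cycles and base-point infinity) has $\varepsilon'_k=1$ and $\varepsilon_k\equiv g-k+1\pmod 2$, $k=1,\dots,g$. The sigma function is $\sigma(u)=C\exp(-\tfrac12u^t\varkappa u)\,\theta[K](\omega^{-1}u;\omega^{-1}\omega')$ with a nonzero constant $C$, $u=(u_1,u_3,\dots,u_{2g-1})^t\in\mathbb{C}^g$, and $\wp_{1,1}(u)=-\partial^2\log\sigma(u)/\partial u_1^2$. *)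

theory Defs
  imports "HOL-Analysis.Analysis"
begin

text \<open>
  The genus is \<open>g = CARD('n)\<close>; vectors and matrices of size \<open>g\<close> are indexed by a finite linearly
  ordered type \<open>'n\<close>. The order fixes the numbering of the coordinates:
  \<open>pos\<close> is the order isomorphism of \<open>'n\<close> onto \<open>{1..g}\<close>.
  In particular, row \<open>i\<close> carries the differentials with subscript \<open>2 * pos i - 1\<close>, column \<open>k\<close>
  belongs to the cycles numbered \<open>pos k\<close>, and the coordinate \<open>u\<^sub>1\<close> of \<open>u\<close> is the component at \<open>Min UNIV\<close>.
\<close>

type_synonym 'n cvec = "complex^'n"
type_synonym 'n ivec = "int^'n"
type_synonym 'n cmat = "complex^'n^'n"

definition pos :: "'n::{finite,linorder} \<Rightarrow> nat" where
  "pos k = card {..k}"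

text \<open>The coefficient \<open>\<lambda>\<^sub>m\<close> is \<open>lam m\<close>; only even subscripts occur.\<close>

definition Lambda :: "nat \<Rightarrow> (nat \<Rightarrow> complex) \<Rightarrow> complex \<Rightarrow> complex" where
  "Lambda g lam x = x ^ (2*g+1) + (\<Sum>i=0..2*g. lam (2*i+2) * x ^ (2*g-i))"

definition sqrt_branch :: "(complex \<Rightarrow> complex) \<Rightarrow> (complex \<Rightarrow> complex) \<Rightarrow> bool" where
  "sqrt_branch L Y \<longleftrightarrow>
     Y holomorphic_on {z. Im z > 0} \<and> (\<forall>z. Im z > 0 \<longrightarrow> (Y z)\<^sup>2 = L z)"

definition boundary_value :: "(complex \<Rightarrow> complex) \<Rightarrow> real \<Rightarrow> complex" where
  "boundary_value Y x = Lim (at (complex_of_real x) within {z. Im z > 0}) Y"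

text \<open>
  The densities, along the real axis, of the differentials with subscript \<open>2*n-1\<close>, \<open>1 \<le> n \<le> g\<close>;
  the second argument is \<open>y\<close> as a function of \<open>x\<close>.
  The natural number subtractions do not truncate for these \<open>n\<close>.
\<close>

definition du :: "nat \<Rightarrow> (real \<Rightarrow> complex) \<Rightarrow> nat \<Rightarrow> real \<Rightarrow> complex" where
  "du g y n x = of_real x ^ (g-n) / (- 2 * y x)"

definition dr :: "nat \<Rightarrow> (nat \<Rightarrow> complex) \<Rightarrow> (real \<Rightarrow> complex) \<Rightarrow> nat \<Rightarrow> real \<Rightarrow> complex" where
  "dr g lam y n x =
     (\<Sum>j=0..2*n-2. of_nat (2*n-1-j) * lam (2*j) * of_real x ^ (g+n-1-j)) / (- 2 * y x)"

definition omega :: "(nat \<Rightarrow> real) \<Rightarrow> (real \<Rightarrow> complex) \<Rightarrow> ('n::{finite,linorder}) cmat" where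
  "omega e y =
     (\<chi> i k. 2 * integral {e (2 * pos k - 1) .. e (2 * pos k)} (du CARD('n) y (pos i)))"

definition omega' :: "(nat \<Rightarrow> real) \<Rightarrow> (real \<Rightarrow> complex) \<Rightarrow> ('n::{finite,linorder}) cmat" where
  "omega' e y =
     (\<chi> i k. 2 * (\<Sum>l=pos k..CARD('n). integral {e (2*l) .. e (2*l+1)} (du CARD('n) y (pos i))))"

definition eta ::
    "(nat \<Rightarrow> complex) \<Rightarrow> (nat \<Rightarrow> real) \<Rightarrow> (real \<Rightarrow> complex) \<Rightarrow> ('n::{finite,linorder}) cmat" where
  "eta lam e y =
     (\<chi> i k. 2 * integral {e (2 * pos k - 1) .. e (2 * pos k)} (dr CARD('n) lam y (pos i)))"

definition varkappa ::
    "(nat \<Rightarrow> complex) \<Rightarrow> (nat \<Rightarrow> real) \<Rightarrow> (real \<Rightarrow> complex) \<Rightarrow> ('n::{finite,linorder}) cmat" where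
  "varkappa lam e y = eta lam e y ** matrix_inv (omega e y)"

text \<open>The bilinear (not Hermitian) product \<open>a\<^sup>t b\<close>.\<close>

definition dotp :: "complex^'n \<Rightarrow> complex^'n \<Rightarrow> complex" where
  "dotp a b = (\<Sum>i\<in>UNIV. a $ i * b $ i)"

definition vec_of_int :: "int^'n \<Rightarrow> complex^'n" where
  "vec_of_int m = (\<chi> i. of_int (m $ i))"

definition theta :: "complex^'n \<Rightarrow> complex^'n^'n \<Rightarrow> complex" where
  "theta v \<tau> = (\<Sum>\<^sub>\<infinity>m\<in>(UNIV :: (int^'n) set).
     exp (\<i> * pi * dotp (vec_of_int m) (\<tau> *v vec_of_int m) + 2 * \<i> * pi * dotp (vec_of_int m) v))"

definition theta_char :: "int^'n \<Rightarrow> int^'n \<Rightarrow> complex^'n \<Rightarrow> complex^'n^'n \<Rightarrow> complex" where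
  "theta_char \<epsilon>' \<epsilon> v \<tau> =
     (let a = (1/2) *s vec_of_int \<epsilon>'; b = (1/2) *s vec_of_int \<epsilon>
      in exp (\<i> * pi * dotp a (\<tau> *v a) + 2 * \<i> * pi * dotp (v + b) a) * theta (v + b + \<tau> *v a) \<tau>)"

definition is_riemann_char :: "('n::{finite,linorder}) ivec \<Rightarrow> 'n ivec \<Rightarrow> bool" where
  "is_riemann_char \<epsilon>' \<epsilon> \<longleftrightarrow>
     (\<forall>k. \<epsilon>' $ k = 1 \<and> \<epsilon> $ k mod 2 = (int CARD('n) - int (pos k) + 1) mod 2)"

definition sigma ::
    "complex \<Rightarrow> ('n::{finite,linorder}) ivec \<Rightarrow> 'n ivec \<Rightarrow> (nat \<Rightarrow> complex) \<Rightarrow> (nat \<Rightarrow> real) \<Rightarrow> (real \<Rightarrow> complex)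
       \<Rightarrow> 'n cvec \<Rightarrow> complex" where
  "sigma C \<epsilon>' \<epsilon> lam e y u =
     C * exp (- (1/2) * dotp u (varkappa lam e y *v u))
       * theta_char \<epsilon>' \<epsilon> (matrix_inv (omega e y) *v u) (matrix_inv (omega e y) ** omega' e y)"

text \<open>
  \<open>- \<partial>\<^sup>2 log \<sigma> / \<partial>u\<^sub>1\<^sup>2\<close> at a point \<open>u\<close> with \<open>\<sigma>(u) \<noteq> 0\<close>. Near such a point any analytic branch of
  \<open>log \<sigma>\<close> differs by a constant from \<open>Ln (\<sigma> / \<sigma>(u))\<close>, which is analytic because its argument is close
  to 1; so the principal branch causes no spurious discontinuity. Where \<open>\<sigma>(u) = 0\<close> the value is
  meaningless.
\<close>

definition wp11 :: "(('n::{finite,linorder}) cvec \<Rightarrow> complex) \<Rightarrow> 'n cvec \<Rightarrow> complex" where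
  "wp11 \<sigma> u = - (deriv ^^ 2) (\<lambda>t. Ln (\<sigma> (u + t *s axis (Min UNIV) 1) / \<sigma> u)) 0"

text \<open>The affine subspace \<open>\<Sum>\<^sub>k \<omega>'\<^sub>k / 2 + \<real>\<^sup>g\<close>.\<close>

definition half_period_subspace ::
    "(nat \<Rightarrow> real) \<Rightarrow> (real \<Rightarrow> complex) \<Rightarrow> ('n::{finite,linorder}) cvec set" where
  "half_period_subspace e y =
     {(\<Sum>k\<in>UNIV. (1/2) *s column k (omega' e y)) + (\<chi> i. of_real (s $ i)) | s. True}"

end

theory Submission
  imports Defs "HOL-Complex_Analysis.Complex_Analysis" "HOL-Probability.Probability" "HOL-Real_Asymp.Real_Asymp"
begin

text \<open>
  Since \<open>\<tau> = \<omega>\<^sup>-\<^sup>1 \<omega>'\<close> is symmetric, the quasi-periodicity of the theta function turns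
  \<open>\<sigma>\<close> on the half-period subspace into the exponential of a quadratic polynomial times
  \<open>\<theta>(x; \<tau>)\<close> with real \<open>x\<close>. With \<open>\<tau> = \<i>B\<close> this is a cosine series with Gaussian coefficients, and it is bounded
  below by a positive constant: the quadratic form of \<open>B\<close> is a diagonal form plus squares of
  linear forms. For a diagonal form the series is a product of one-dimensional theta functions, which
  are positive by Landen's identity, and adding the square of a linear form amounts to
  averaging over Gaussian translations. Cauchy estimates then bound the second logarithmic derivative.

  The properties of \<open>B\<close> come from the boundary values \<open>p / y\<close> of the holomorphic differentials.
  By Cauchy's theorem in the upper half plane they satisfy \<open>\<integral> p / y = 0\<close> over the real line and
  \<open>\<integral>\<integral> p(t) q(x) / (y(t) y(x)) = 0\<close> over \<open>t < x\<close>; the imaginary part of the latter is Riemann's bilinear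
  relation, i.e. the symmetry of \<open>\<tau>\<close>. If all but two of the real periods vanish, then the zeros of
  \<open>p\<close> interlace with the cuts, so the signs of all imaginary periods are known; this
  exhibits the quadratic form of \<open>B\<close> as \<open>\<Sum> c\<^sub>i\<^sub>l (U\<^sub>i - U\<^sub>l)\<^sup>2\<close> with positive coefficients, where
  \<open>U\<^sub>i = n\<^sub>1 + \<dots> + n\<^sub>i\<close>.
\<close>

section \<open>One-dimensional theta functions\<close>

text \<open>The formal statement assumes neither the invertibility of \<omega> nor the symmetry of
  \<tau> nor the positivity of its imaginary part; all three have to be extracted from the branch
  points. The subspace is special because the half period \<tau>(1,...,1)/2 that it contributes adds
  to the one already present in [K] and gives a full period, so that only real arguments of theta
  remain. There the theta series has terms of both signs, so positive coefficients alone do not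
  exclude zeros. What is carried along is a lower bound uniform in the argument, because averaging
  over translations preserves exactly such bounds. Every positive definite form is a small diagonal
  form plus squares, but here the periods themselves provide the splitting: the form is the energy
  of an electrical network whose nodes are the g+1 gaps, the unbounded one included, with voltages
  U_i. Its conductances are positive because a polynomial of degree less than g that vanishes once
  in each of g-1 cuts has no room for a further zero. The edges between neighbouring gaps supply the
  diagonal part.\<close>

lemma has_sum_int_geometric:
  fixes q :: real
  assumes "0 < q" "q < 1"
  shows "((\<lambda>n::int. q ^ nat \<bar>n\<bar>) has_sum (2 * q / (1 - q))) (- {0})"
proof -
  have g: "((\<lambda>n. q ^ n) has_sum q / (1 - q)) {1..}"
    using has_sum_geometric_from_1[of q] assms by simp
  have p: "((\<lambda>n::int. q ^ nat \<bar>n\<bar>) has_sum q / (1 - q)) {1..}"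
    using g by (subst has_sum_reindex_bij_witness[of _ int nat "{1..}"]) auto
  have m: "((\<lambda>n::int. q ^ nat \<bar>n\<bar>) has_sum q / (1 - q)) {..-1}"
    using g by (subst has_sum_reindex_bij_witness[of _ "\<lambda>n. - int n" "\<lambda>n. nat (- n)" "{1..}"]) auto
  have "{1..} \<union> {..-1} = - {0::int}" by auto
  moreover have "((\<lambda>n::int. q ^ nat \<bar>n\<bar>) has_sum (q / (1 - q) + q / (1 - q))) ({1..} \<union> {..-1})"
    by (rule has_sum_Un_disjoint[OF p m]) auto
  ultimately show ?thesis by simp
qed

lemma summable_on_int_geometric:
  fixes q :: real
  assumes "0 < q" "q < 1"
  shows "(\<lambda>n::int. q ^ nat \<bar>n\<bar>) summable_on UNIV"
proof -
  have "(\<lambda>n::int. q ^ nat \<bar>n\<bar>) summable_on insert 0 (- {0})"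
    using has_sum_int_geometric[OF assms] by (subst summable_on_insert_iff) (auto dest: has_sum_imp_summable)
  moreover have "insert 0 (- {0}) = (UNIV :: int set)" by auto
  ultimately show ?thesis by metis
qed

text \<open>The linear term is there for complex translations: off the real line the terms of a
  theta series grow by a factor exp(C|n|), which the Gaussian absorbs.\<close>

lemma summable_on_int_gaussian:
  fixes c C :: real
  assumes "0 < c"
  shows "(\<lambda>n::int. exp (- c * (of_int n)\<^sup>2 + C * \<bar>of_int n\<bar>)) summable_on UNIV"
proof (rule summable_on_comparison_test)
  \<comment> \<open>\<open>?K\<close> is the maximum of -c t^2 + (C+1) t, so the exponent stays
    below \<open>?K - t\<close> and a geometric series of ratio exp(-1) dominates.\<close>
  let ?K = "(C + 1)\<^sup>2 / (4 * c)"
  show "(\<lambda>n::int. exp ?K * exp (-1) ^ nat \<bar>n\<bar>) summable_on UNIV"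
    by (intro summable_on_cmult_right summable_on_int_geometric) auto
  fix n :: int
  define t where "t = real_of_int \<bar>n\<bar>"
  have "?K - (- c * t\<^sup>2 + (C + 1) * t) = c * (t - (C + 1) / (2 * c))\<^sup>2"
    using assms by (simp add: field_simps power2_eq_square)
  also have "\<dots> \<ge> 0" using assms by simp
  finally have "- c * t\<^sup>2 + C * t \<le> ?K - t" by (simp add: algebra_simps)
  moreover have "exp (-1::real) ^ nat \<bar>n\<bar> = exp (- t)"
    unfolding exp_of_nat_mult[symmetric] t_def by (simp add: of_nat_nat)
  ultimately show "exp (- c * (of_int n)\<^sup>2 + C * \<bar>of_int n\<bar>) \<le> exp ?K * exp (-1) ^ nat \<bar>n\<bar>"
    by (simp add: t_def exp_add[symmetric])
qed auto

lemma infsum_times: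
  fixes a :: "'a \<Rightarrow> complex" and b :: "'b \<Rightarrow> complex"
  assumes a: "(\<lambda>n. norm (a n)) summable_on A" and b: "(\<lambda>n. norm (b n)) summable_on B"
  shows "(\<lambda>(n,m). a n * b m) summable_on A \<times> B"
    and "infsum a A * infsum b B = (\<Sum>\<^sub>\<infinity>(n,m)\<in>A \<times> B. a n * b m)"
proof -
  have "(\<lambda>p. norm (a (fst p) * b (snd p))) summable_on A \<times> B"
  proof (rule summable_on_SigmaI)
    fix n
    show "((\<lambda>m. norm (a (fst (n, m)) * b (snd (n, m)))) has_sum norm (a n) * (\<Sum>\<^sub>\<infinity>m\<in>B. norm (b m))) B"
      unfolding norm_mult fst_conv snd_conv by (intro has_sum_cmult_right has_sum_infsum b)
    show "(\<lambda>n. norm (a n) * (\<Sum>\<^sub>\<infinity>m\<in>B. norm (b m))) summable_on A"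
      by (intro summable_on_cmult_left a)
  qed auto
  then show s: "(\<lambda>(n,m). a n * b m) summable_on A \<times> B"
    unfolding case_prod_unfold by (rule abs_summable_summable)
  show "infsum a A * infsum b B = (\<Sum>\<^sub>\<infinity>(n,m)\<in>A \<times> B. a n * b m)"
    by (simp add: infsum_Sigma'_banach[OF s, symmetric] infsum_cmult_left' infsum_cmult_right')
qed

text \<open>Jacobi's theta_3 with nome exp(-c), that is, c is pi times the imaginary part of the
  modulus \<tau>.\<close>

definition theta1 :: "real \<Rightarrow> real \<Rightarrow> complex" where
  "theta1 c x = (\<Sum>\<^sub>\<infinity>n\<in>(UNIV::int set). of_real (exp (- c * (of_int n)\<^sup>2)) * cis (2 * pi * of_int n * x))"

lemma theta1_abs_summable:
  assumes "0 < c"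
  shows "(\<lambda>n::int. norm (of_real (exp (- c * (of_int n)\<^sup>2)) * cis (2 * pi * of_int n * x))) summable_on UNIV"
  using summable_on_int_gaussian[OF assms, of 0] by (simp add: norm_mult)

lemma theta1_real:
  assumes "0 < c"
  shows "theta1 c x = of_real (Re (theta1 c x))"
proof -
  have "cnj (theta1 c x) = (\<Sum>\<^sub>\<infinity>n\<in>(UNIV::int set). of_real (exp (- c * (of_int n)\<^sup>2)) * cis (- (2 * pi * of_int n * x)))"
    unfolding theta1_def infsum_cnj[symmetric] by (simp add: cis_cnj[symmetric])
  also have "\<dots> = theta1 c x"
    unfolding theta1_def
    by (rule infsum_reindex_bij_witness[of _ uminus uminus]) auto
  finally show ?thesis by (metis Reals_cnj_iff of_real_Re)
qed

text \<open>In the double series over (n, m) the shift by 1/2 contributes the sign (-1)^m. Terms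
  with n + m odd cancel under exchanging n and m. For n + m even, n = a + b and m = a - b turn n^2 +
  m^2 into 2 a^2 + 2 b^2, which separates the variables again, at twice the parameter.\<close>

lemma theta1_Landen:
  assumes c: "0 < c"
  shows "theta1 c x * theta1 c (x + 1/2) = theta1 (2 * c) (2 * x + 1/2) * theta1 (2 * c) (1/2)"
proof -
  let ?t = "\<lambda>c x n. of_real (exp (- c * (real_of_int n)\<^sup>2)) * cis (2 * pi * of_int n * x)"
  define f where "f = (\<lambda>(n::int,m::int). ?t c x n * ?t c (x + 1/2) m)"
  have prodsum: "theta1 c x * theta1 c y = (\<Sum>\<^sub>\<infinity>(n,m)\<in>UNIV. ?t c x n * ?t c y m)
      \<and> (\<lambda>(n,m). ?t c x n * ?t c y m) summable_on UNIV" if "0 < c" for c x y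
    using infsum_times[OF theta1_abs_summable[OF that, of x] theta1_abs_summable[OF that, of y]]
    unfolding theta1_def UNIV_Times_UNIV by simp
  have fs: "f summable_on A" for A
    using prodsum[OF c, of x "x+1/2"] unfolding f_def
    by (meson summable_on_subset_banach subset_UNIV)
  define E where "E = {(n,m). even (n + m :: int)}"
  have f_eq: "f (n, m) = of_real (exp (- c * ((real_of_int n)\<^sup>2 + (real_of_int m)\<^sup>2)))
      * cis (2 * pi * of_int (n + m) * x) * cis (pi * of_int m)" for n m
  proof -
    have "exp (- c * (real_of_int n)\<^sup>2) * exp (- c * (real_of_int m)\<^sup>2) = exp (- c * ((real_of_int n)\<^sup>2 + (real_of_int m)\<^sup>2))"
      by (simp add: exp_add[symmetric] algebra_simps)
    moreover have "cis (2 * pi * of_int n * x) * cis (2 * pi * of_int m * (x + 1/2)) = cis (2 * pi * of_int (n + m) * x) * cis (pi * of_int m)"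
      by (simp add: cis_mult algebra_simps)
    moreover have "f (n, m) = of_real (exp (- c * (real_of_int n)\<^sup>2) * exp (- c * (real_of_int m)\<^sup>2))
        * (cis (2 * pi * of_int n * x) * cis (2 * pi * of_int m * (x + 1/2)))"
      unfolding f_def of_real_mult prod.case by (simp only: mult_ac)
    ultimately show ?thesis by (simp only: mult_ac)
  qed
  have cis_flip: "cis (pi * of_int n) = - cis (pi * of_int m)" if od: "odd (n + m)" for n m
  proof -
    obtain k where k: "n + m = 2 * k + 1" using od by (elim oddE)
    have "pi * of_int n = pi + 2 * pi * of_int (k - m) + pi * of_int m"
    proof -
      have "real_of_int n = 2 * of_int k + 1 - of_int m" using arg_cong[OF k, of real_of_int] by simp
      then have "pi * of_int n = pi * (2 * of_int k + 1 - of_int m)" by (simp only:)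
      then show ?thesis by (simp add: algebra_simps)
    qed
    then have "cis (pi * of_int n) = cis pi * cis (2 * pi * of_int (k - m)) * cis (pi * of_int m)"
      by (simp only: cis_mult)
    then show ?thesis by (simp add: cis_multiple_2pi)
  qed
  have "infsum f (- E) = infsum (\<lambda>p. - f p) (- E)"
  proof (rule infsum_reindex_bij_witness[of _ prod.swap prod.swap])
    fix p assume "p \<in> - E"
    then show "- f (prod.swap p) = f p"
      unfolding E_def using cis_flip by (cases p) (auto simp: f_eq algebra_simps)
  qed (auto simp: E_def add.commute)
  then have odd0: "infsum f (- E) = 0" by (simp add: infsum_uminus)
  have "infsum f E = (\<Sum>\<^sub>\<infinity>(a,b)\<in>UNIV. ?t (2*c) (2 * x + 1/2) a * ?t (2*c) (1/2) b)"
  proof (rule infsum_reindex_bij_witness[symmetric, of _ "\<lambda>(n,m). ((n+m) div 2, (n-m) div 2)" "\<lambda>(a,b). (a+b,a-b)"])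
    fix p :: "int \<times> int"
    obtain a b where p: "p = (a,b)" by (cases p)
    have "cis (pi * of_int (a - b)) = cis (pi * of_int (a + b) - 2 * pi * of_int b)"
      by (simp add: algebra_simps)
    also have "\<dots> = cis (pi * of_int (a + b)) * cis (2 * pi * of_int (- b))"
      by (simp add: cis_mult)
    finally have "cis (pi * of_int (a - b)) = cis (pi * of_int (a + b))"
      by (subst (asm) cis_multiple_2pi) auto
    then have "f (a + b, a - b) = of_real (exp (- c * ((real_of_int (a+b))\<^sup>2 + (real_of_int (a-b))\<^sup>2)))
      * cis (2 * pi * of_int (2 * a) * x) * cis (pi * of_int (a + b))"
      unfolding f_eq by simp
    also have "\<dots> = ?t (2*c) (2 * x + 1/2) a * ?t (2*c) (1/2) b"
    proof -
      have "exp (- c * ((real_of_int (a+b))\<^sup>2 + (real_of_int (a-b))\<^sup>2)) =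
          exp (- (2*c) * (real_of_int a)\<^sup>2) * exp (- (2*c) * (real_of_int b)\<^sup>2)"
        by (simp add: exp_add[symmetric] algebra_simps power2_eq_square)
      moreover have "cis (2 * pi * of_int (2 * a) * x) * cis (pi * of_int (a + b)) =
          cis (2 * pi * of_int a * (2 * x + 1/2)) * cis (2 * pi * of_int b * (1/2))"
        by (simp add: cis_mult algebra_simps)
      ultimately show ?thesis unfolding mult.assoc of_real_mult by (simp only: mult_ac of_real_mult)
    qed
    finally show "f ((\<lambda>(a,b). (a+b,a-b)) p) = (case p of (a,b) \<Rightarrow> ?t (2*c) (2 * x + 1/2) a * ?t (2*c) (1/2) b)"
      by (simp add: p)
  next
    fix p assume "p \<in> E"
    then obtain n m where p: "p = (n, m)" and "even (n + m)"
      unfolding E_def by blast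
    then obtain s where "n + m = 2 * s" by blast
    then have "n = 2 * s - m" by simp
    then show "(\<lambda>(a,b). (a+b,a-b)) ((\<lambda>(n,m). ((n+m) div 2, (n-m) div 2)) p) = p"
      by (simp add: p)
  qed (auto simp: E_def)
  also have "\<dots> = theta1 (2 * c) (2 * x + 1/2) * theta1 (2 * c) (1/2)"
    using prodsum[of "2*c" "2*x+1/2" "1/2"] c by simp
  finally have ev: "infsum f E = theta1 (2 * c) (2 * x + 1/2) * theta1 (2 * c) (1/2)" .
  have "theta1 c x * theta1 c (x + 1/2) = infsum f UNIV"
    using prodsum[OF c, of x "x + 1/2"] unfolding f_def by simp
  also have "\<dots> = infsum f E + infsum f (- E)"
    using infsum_Un_disjoint[OF fs fs, of E "- E"] by simp
  finally show ?thesis using odd0 ev by simp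
qed

text \<open>The constant term 1 outweighs the others once q = exp(-c) is below 1/3, where 2 q / (1 -
  q) reaches 1; c \<ge> 3 gives q \<le> 1/4 through exp c \<ge> 1 + c.\<close>

lemma theta1_large_pos:
  assumes "3 \<le> c"
  shows "0 < Re (theta1 c x)"
proof -
  let ?t = "\<lambda>n::int. of_real (exp (- c * (real_of_int n)\<^sup>2)) * cis (2 * pi * of_int n * x)"
  define q where "q = exp (- c)"
  have "4 \<le> exp c" using exp_ge_add_one_self[of c] assms by linarith
  then have "4 * q \<le> exp c * q" unfolding q_def by (intro mult_right_mono) auto
  also have "\<dots> = 1" unfolding q_def by (simp flip: exp_add)
  finally have q4: "4 * q \<le> 1" .
  moreover have q0: "0 < q" by (simp add: q_def)
  ultimately have q1: "q < 1" by linarith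
  have sm: "?t summable_on A" for A
    using assms
    by (intro summable_on_subset_banach[OF abs_summable_summable[OF theta1_abs_summable] subset_UNIV]) simp
  have "infsum ?t ({0} \<union> - {0}) = infsum ?t {0} + infsum ?t (- {0})"
    by (rule infsum_Un_disjoint[OF sm sm]) auto
  moreover have "{0} \<union> - {0} = (UNIV :: int set)" by auto
  moreover have "infsum ?t {0} = 1" by simp
  ultimately have eq: "theta1 c x = 1 + infsum ?t (- {0})"
    unfolding theta1_def by metis
  have "norm (infsum ?t (- {0})) \<le> 2 * q / (1 - q)"
  proof (rule norm_infsum_le)
    show "(?t has_sum infsum ?t (- {0})) (- {0})" using sm by simp
    show "((\<lambda>n::int. q ^ nat \<bar>n\<bar>) has_sum (2 * q / (1 - q))) (- {0})"
      by (rule has_sum_int_geometric[OF q0 q1])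
    fix n :: int
    assume "n \<in> - {0}"
    then have "1 \<le> \<bar>n\<bar>" by auto
    then have "1 \<le> \<bar>real_of_int n\<bar>" by linarith
    then have "\<bar>real_of_int n\<bar> ^ 1 \<le> \<bar>real_of_int n\<bar> ^ 2" by (intro power_increasing) auto
    then have "real_of_int \<bar>n\<bar> \<le> (of_int n)\<^sup>2" by simp
    then have "exp (- c * (real_of_int n)\<^sup>2) \<le> exp (- c * real_of_int \<bar>n\<bar>)"
      using assms by simp
    also have "\<dots> = q ^ nat \<bar>n\<bar>"
      unfolding q_def exp_of_nat_mult[symmetric] by simp
    finally show "norm (?t n) \<le> q ^ nat \<bar>n\<bar>" by (simp add: norm_mult)
  qed
  also have "\<dots> < 1" using q4 q1 by (simp add: field_simps)
  finally have "\<bar>Re (infsum ?t (- {0}))\<bar> < 1"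
    using abs_Re_le_cmod order_le_less_trans by blast
  then show ?thesis unfolding eq by simp
qed

lemma theta1_continuous:
  assumes "0 < c"
  shows "continuous_on UNIV (theta1 c)"
proof -
  let ?t = "\<lambda>(n::int) x. of_real (exp (- c * (real_of_int n)\<^sup>2)) * cis (2 * pi * of_int n * x)"
  have "uniform_limit UNIV (\<lambda>X x. \<Sum>n\<in>X. ?t n x) (\<lambda>x. \<Sum>\<^sub>\<infinity>n. ?t n x) (finite_subsets_at_top UNIV)"
    by (rule Weierstrass_m_test_general[OF _ summable_on_int_gaussian[OF assms, of 0]]) (simp add: norm_mult)
  then have "uniform_limit UNIV (\<lambda>X x. \<Sum>n\<in>X. ?t n x) (theta1 c) (finite_subsets_at_top UNIV)"
    unfolding theta1_def .
  then show ?thesis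
    by (rule uniform_limit_theorem[rotated]) (auto intro!: always_eventually continuous_intros)
qed

text \<open>By Landen's identity a zero at parameter c forces a zero at 2 c; doubling until the
  parameter reaches 3 excludes zeros. The sign on the connected real line is then the sign at 0,
  where all terms are positive.\<close>

lemma theta1_pos:
  assumes "0 < c"
  shows "0 < Re (theta1 c x)"
proof -
  obtain k where "3 / c < 2 ^ k" using real_arch_pow[of 2 "3/c"] by auto
  then have "3 \<le> 2 ^ k * c" using assms by (simp add: field_simps)
  then show ?thesis using assms
  proof (induction k arbitrary: c x)
    case 0
    then show ?case using theta1_large_pos by simp
  next
    case (Suc k)
    have pos: "0 < Re (theta1 (2 * c) y)" for y
      using Suc.IH[of "2 * c" y] Suc.prems by (simp add: mult.assoc mult.left_commute)
    have nz: "Re (theta1 c y) \<noteq> 0" for y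
    proof
      assume "Re (theta1 c y) = 0"
      then have "theta1 c y = 0" using theta1_real[OF \<open>0 < c\<close>, of y] by simp
      then have "theta1 (2 * c) (2 * y + 1/2) = 0 \<or> theta1 (2 * c) (1/2) = 0"
        using theta1_Landen[OF \<open>0 < c\<close>, of y] by simp
      then show False using pos[of "2*y+1/2"] pos[of "1/2"] by auto
    qed
    have p0: "0 < Re (theta1 c 0)"
    proof -
      have "1 \<le> (\<Sum>\<^sub>\<infinity>n\<in>(UNIV::int set). exp (- c * (of_int n)\<^sup>2))"
        using finite_sum_le_infsum[of "\<lambda>n::int. exp (- c * (of_int n)\<^sup>2)" UNIV "{0}"]
          summable_on_int_gaussian[OF \<open>0 < c\<close>, of 0] by simp
      also have "\<dots> = Re (theta1 c 0)"
        unfolding theta1_def using abs_summable_summable[OF theta1_abs_summable[OF \<open>0 < c\<close>, of 0]]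
        by (subst infsum_Re[symmetric]) auto
      finally show ?thesis by simp
    qed
    have cont: "continuous_on S (\<lambda>x. Re (theta1 c x))" for S
      using continuous_on_subset[OF theta1_continuous[OF \<open>0 < c\<close>]] by (intro continuous_intros) auto
    show "0 < Re (theta1 c x)"
    proof (rule ccontr)
      assume "\<not> 0 < Re (theta1 c x)"
      moreover have "connected (range (\<lambda>x. Re (theta1 c x)))"
        by (intro connected_continuous_image cont) auto
      ultimately have "0 \<in> range (\<lambda>x. Re (theta1 c x))"
        using p0 unfolding connected_iff_interval by (metis linorder_not_less order_less_imp_le rangeI)
      then show False using nz by auto
    qed
  qed
qed

text \<open>Periodicity in x turns pointwise positivity into a minimum over a compact
  interval.\<close>

lemma theta1_lower_bound:
  assumes "0 < c"
  obtains m where "0 < m" "\<And>x. m \<le> Re (theta1 c x)"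
proof -
  have cont: "continuous_on {0..1} (\<lambda>x. Re (theta1 c x))"
    using continuous_on_subset[OF theta1_continuous[OF assms]] by (intro continuous_intros) auto
  obtain x0 where x0: "\<And>x. x \<in> {0..1} \<Longrightarrow> Re (theta1 c x0) \<le> Re (theta1 c x)"
    using continuous_attains_inf[OF _ _ cont] by fastforce
  have "theta1 c x = theta1 c (frac x)" for x
  proof -
    have "cis (2 * pi * of_int n * x) = cis (2 * pi * of_int n * frac x)" for n
    proof -
      have "2 * pi * of_int n * x = 2 * pi * of_int n * frac x + 2 * pi * of_int (n * \<lfloor>x\<rfloor>)"
        by (simp add: frac_def algebra_simps)
      then have "cis (2 * pi * of_int n * x) = cis (2 * pi * of_int n * frac x) * cis (2 * pi * of_int (n * \<lfloor>x\<rfloor>))"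
        by (simp only: cis_mult)
      then show ?thesis by (subst (asm) cis_multiple_2pi) auto
    qed
    then show ?thesis unfolding theta1_def by simp
  qed
  then have "Re (theta1 c x0) \<le> Re (theta1 c x)" for x
    using x0[of "frac x"] by (simp add: frac_lt_1 less_imp_le)
  then show ?thesis using that[of "Re (theta1 c x0)"] theta1_pos[OF assms] by blast
qed

section \<open>Lower bounds for cosine series with Gaussian coefficients\<close>

definition int_inner :: "int^'n \<Rightarrow> real^'n \<Rightarrow> real" where
  "int_inner m x = (\<Sum>k\<in>UNIV. of_int (m $ k) * x $ k)"

lemma int_inner_add: "int_inner m (x + y) = int_inner m x + int_inner m y"
  by (simp add: int_inner_def algebra_simps sum.distrib)

lemma int_inner_scaleR: "int_inner m (c *\<^sub>R x) = c * int_inner m x"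
  by (simp add: int_inner_def sum_distrib_left algebra_simps)

lemma bij_vec_lambda_PiE:
  "bij_betw (\<lambda>(m::'a^'n) k. m $ k) UNIV (PiE UNIV (\<lambda>_. UNIV))"
  by (rule bij_betwI[where g = "\<lambda>f. \<chi> k. f k"]) auto

lemma summable_on_vec_prod:
  fixes f :: "'n::finite \<Rightarrow> int \<Rightarrow> complex"
  assumes "\<And>k. (\<lambda>n. norm (f k n)) summable_on UNIV"
  shows "(\<lambda>m::int^'n. norm (\<Prod>k\<in>UNIV. f k (m $ k))) summable_on UNIV"
proof -
  have "(\<lambda>h. norm (\<Prod>k\<in>UNIV. f k (h k))) summable_on (PiE (UNIV::'n set) (\<lambda>_. UNIV))"
    unfolding abs_summable_equivalent
    by (intro abs_summable_on_prod_PiE) (auto simp: abs_summable_equivalent[symmetric] assms)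
  then show ?thesis
    using summable_on_reindex_bij_betw[OF bij_vec_lambda_PiE, of "\<lambda>h. norm (\<Prod>k\<in>UNIV. f k (h k))"] by simp
qed

lemma infsum_vec_prod:
  fixes f :: "'n::finite \<Rightarrow> int \<Rightarrow> complex"
  assumes "\<And>k. (\<lambda>n. norm (f k n)) summable_on UNIV"
  shows "(\<Sum>\<^sub>\<infinity>m::int^'n. \<Prod>k\<in>UNIV. f k (m $ k)) = (\<Prod>k\<in>UNIV. infsum (f k) UNIV)"
  using infsum_prod_PiE_abs[of "UNIV::'n set" f "\<lambda>_. UNIV"] assms
    infsum_reindex_bij_betw[OF bij_vec_lambda_PiE, of "\<lambda>h. \<Prod>k\<in>UNIV. f k (h k)"] by simp

lemma cis_sum: "finite A \<Longrightarrow> cis (\<Sum>k\<in>A. f k) = (\<Prod>k\<in>A. cis (f k))"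
  by (induction A rule: finite_induct) (auto simp: cis_mult[symmetric])

lemma summable_on_vec_gaussian:
  fixes d C :: "'n::finite \<Rightarrow> real"
  assumes "\<And>k. 0 < d k"
  shows "(\<lambda>m::int^'n. exp (\<Sum>k\<in>UNIV. - d k * (of_int (m $ k))\<^sup>2 + C k * \<bar>of_int (m $ k)\<bar>)) summable_on UNIV"
proof -
  have "(\<lambda>m::int^'n. norm (\<Prod>k\<in>UNIV. complex_of_real (exp (- d k * (of_int (m $ k))\<^sup>2 + C k * \<bar>of_int (m $ k)\<bar>)))) summable_on UNIV"
    by (rule summable_on_vec_prod) (use summable_on_int_gaussian assms in auto)
  then show ?thesis by (simp add: exp_sum prod_norm[symmetric])
qed

lemma diagonal_theta_lower_bound:
  fixes d :: "'n::finite \<Rightarrow> real"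
  assumes d: "\<And>k. 0 < d k"
  obtains r where "0 < r"
    "\<And>x::real^'n. r \<le> (\<Sum>\<^sub>\<infinity>m. exp (- (\<Sum>k\<in>UNIV. d k * (of_int (m $ k))\<^sup>2)) * cos (2 * pi * int_inner m x))"
proof -
  have "\<forall>k. \<exists>r>0. \<forall>x. r \<le> Re (theta1 (d k) x)" using theta1_lower_bound[OF d] by metis
  then obtain r where r: "\<And>k. 0 < r k" "\<And>k x. r k \<le> Re (theta1 (d k) x)" by metis
  show thesis
  proof (rule that)
    show "0 < (\<Prod>k\<in>UNIV. r k)" using r by (simp add: prod_pos)
    fix x :: "real^'n"
    let ?f = "\<lambda>k n. of_real (exp (- d k * (real_of_int n)\<^sup>2)) * cis (2 * pi * of_int n * (x $ k))"
    have f: "(\<Prod>k\<in>UNIV. ?f k (m $ k)) =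
        of_real (exp (- (\<Sum>k\<in>UNIV. d k * (of_int (m $ k))\<^sup>2))) * cis (2 * pi * int_inner m x)" for m :: "int^'n"
    proof -
      have "(\<Prod>k\<in>UNIV. of_real (exp (- d k * (real_of_int (m $ k))\<^sup>2))) =
          complex_of_real (exp (- (\<Sum>k\<in>UNIV. d k * (of_int (m $ k))\<^sup>2)))"
        by (simp add: exp_sum[symmetric] sum_negf del: of_real_prod flip: of_real_prod)
      moreover have "(\<Prod>k\<in>UNIV. cis (2 * pi * of_int (m $ k) * (x $ k))) = cis (2 * pi * int_inner m x)"
        by (simp add: cis_sum[symmetric] int_inner_def sum_distrib_left mult.assoc)
      ultimately show ?thesis unfolding prod.distrib by simp
    qed
    have s: "(\<lambda>n. norm (?f k n)) summable_on UNIV" for k using theta1_abs_summable[OF d] .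
    have "(\<Sum>\<^sub>\<infinity>m::int^'n. exp (- (\<Sum>k\<in>UNIV. d k * (of_int (m $ k))\<^sup>2)) * cos (2 * pi * int_inner m x))
        = (\<Sum>\<^sub>\<infinity>m::int^'n. Re (\<Prod>k\<in>UNIV. ?f k (m $ k)))"
      unfolding f by simp
    also have "\<dots> = Re (\<Sum>\<^sub>\<infinity>m::int^'n. \<Prod>k\<in>UNIV. ?f k (m $ k))"
      by (rule infsum_Re[OF abs_summable_summable[OF summable_on_vec_prod[OF s]]])
    also have "\<dots> = Re (\<Prod>k\<in>UNIV. theta1 (d k) (x $ k))"
      unfolding infsum_vec_prod[OF s] theta1_def by simp
    \<comment> \<open>The factors are real, so taking real parts commutes with the product.\<close>
    also have "\<dots> = Re (\<Prod>k\<in>UNIV. of_real (Re (theta1 (d k) (x $ k))))"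
      using theta1_real[OF d] by metis
    also have "\<dots> = (\<Prod>k\<in>UNIV. Re (theta1 (d k) (x $ k)))"
      by (simp flip: of_real_prod)
    also have "\<dots> \<ge> (\<Prod>k\<in>UNIV. r k)"
      using r by (intro prod_mono) (auto simp: less_imp_le)
    finally show "(\<Prod>k\<in>UNIV. r k) \<le> (\<Sum>\<^sub>\<infinity>m. exp (- (\<Sum>k\<in>UNIV. d k * (of_int (m $ k))\<^sup>2)) * cos (2 * pi * int_inner m x))" .
  qed
qed

text \<open>Real part of the characteristic function of the normal law, rotated by the phase
  a.\<close>

lemma integral_cos_std_normal:
  "(\<integral>v. cos (a + v * t) \<partial>std_normal_distribution) = cos a * exp (- (t\<^sup>2) / 2)"
  "integrable std_normal_distribution (\<lambda>v. cos (a + v * t))"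
proof -
  interpret real_distribution std_normal_distribution by (rule real_dist_normal_dist)
  show i: "integrable std_normal_distribution (\<lambda>v. cos (a + v * t))" for a
    by (rule integrable_const_bound[of _ 1]) auto
  have ie: "integrable std_normal_distribution (\<lambda>x. iexp (t * x))"
    using integrable_iexp[of "\<lambda>x. complex_of_real (t * x)"] by simp
  have ch: "(CLINT x|std_normal_distribution. iexp (t * x)) = of_real (exp (- (t^2) / 2))"
    using fun_cong[OF char_std_normal_distribution, of t] unfolding char_def .
  have "(\<integral>v. cos (a + v * t) \<partial>std_normal_distribution) =
      (\<integral>v. Re (cis a * iexp (t * v)) \<partial>std_normal_distribution)"
    by (rule Bochner_Integration.integral_cong) (auto simp: cis_conv_exp[symmetric] cis_mult mult.commute simp flip: of_real_mult)
  also have "\<dots> = Re (cis a * of_real (exp (- (t^2) / 2)))"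
    using ie ch by (subst integral_Re) auto
  finally show "(\<integral>v. cos (a + v * t) \<partial>std_normal_distribution) = cos a * exp (- (t\<^sup>2) / 2)" by simp
qed

text \<open>Multiplying the coefficients by a Gaussian of a linear form averages the series over Gaussian
  translations, which preserves lower bounds.\<close>

lemma cos_series_gaussian_factor_lower_bound:
  fixes a :: "int^'n::finite \<Rightarrow> real" and b x :: "real^'n"
  assumes a0: "\<And>m. 0 \<le> a m" and a: "a summable_on UNIV"
    and lb: "\<And>x. r \<le> (\<Sum>\<^sub>\<infinity>m. a m * cos (2 * pi * int_inner m x))"
  shows "r \<le> (\<Sum>\<^sub>\<infinity>m. a m * exp (- ((int_inner m b)\<^sup>2) / 2) * cos (2 * pi * int_inner m x))"
proof (rule field_le_epsilon)
  fix \<epsilon> :: real assume "0 < \<epsilon>"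
  interpret real_distribution std_normal_distribution by (rule real_dist_normal_dist)
  let ?g = "\<lambda>m x. a m * cos (2 * pi * int_inner m x)"
  let ?h = "\<lambda>m x. a m * exp (- ((int_inner m b)\<^sup>2) / 2) * cos (2 * pi * int_inner m x)"
  have ac: "a m * \<bar>cos t\<bar> \<le> a m" for m t using mult_left_mono[OF abs_cos_le_one a0, of m] by simp
  have ae: "a m * exp (- ((int_inner m b)\<^sup>2) / 2) * \<bar>cos t\<bar> \<le> a m" for m t
  proof -
    have "a m * exp (- ((int_inner m b)\<^sup>2) / 2) \<le> a m * 1" using a0 by (intro mult_left_mono) auto
    then have "a m * exp (- ((int_inner m b)\<^sup>2) / 2) * \<bar>cos t\<bar> \<le> a m * 1 * 1"
      using a0 by (intro mult_mono) auto
    then show ?thesis by simp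
  qed
  \<comment> \<open>Expectation and summation are exchanged only for one finite set F whose partial
    sums are close to both series, uniformly in the argument and hence for all translations at
    once.\<close>
  have "uniform_limit UNIV (\<lambda>F x. \<Sum>m\<in>F. ?g m x) (\<lambda>x. \<Sum>\<^sub>\<infinity>m. ?g m x) (finite_subsets_at_top UNIV)"
    using ac a0 by (intro Weierstrass_m_test_general[OF _ a]) (simp add: abs_mult)
  then have 1: "\<forall>\<^sub>F F in finite_subsets_at_top UNIV. \<forall>x\<in>UNIV. dist (\<Sum>m\<in>F. ?g m x) (\<Sum>\<^sub>\<infinity>m. ?g m x) < \<epsilon> / 2"
    by (rule uniform_limitD) (use \<open>0 < \<epsilon>\<close> in simp)
  have "uniform_limit UNIV (\<lambda>F x. \<Sum>m\<in>F. ?h m x) (\<lambda>x. \<Sum>\<^sub>\<infinity>m. ?h m x) (finite_subsets_at_top UNIV)"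
    using ae a0 by (intro Weierstrass_m_test_general[OF _ a]) (simp add: abs_mult)
  then have 2: "\<forall>\<^sub>F F in finite_subsets_at_top UNIV. \<forall>x\<in>UNIV. dist (\<Sum>m\<in>F. ?h m x) (\<Sum>\<^sub>\<infinity>m. ?h m x) < \<epsilon> / 2"
    by (rule uniform_limitD) (use \<open>0 < \<epsilon>\<close> in simp)
  have "\<forall>\<^sub>F F in finite_subsets_at_top (UNIV :: (int^'n) set). finite F"
    by (simp add: eventually_finite_subsets_at_top_weakI)
  with 1 2 have "\<forall>\<^sub>F F in finite_subsets_at_top UNIV. finite F \<and>
      (\<forall>x. dist (\<Sum>m\<in>F. ?g m x) (\<Sum>\<^sub>\<infinity>m. ?g m x) < \<epsilon> / 2) \<and>
      (\<forall>x. dist (\<Sum>m\<in>F. ?h m x) (\<Sum>\<^sub>\<infinity>m. ?h m x) < \<epsilon> / 2)"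
    by eventually_elim auto
  then obtain F where F: "finite F"
      "\<And>x. dist (\<Sum>m\<in>F. ?g m x) (\<Sum>\<^sub>\<infinity>m. ?g m x) < \<epsilon> / 2"
      "\<And>x. dist (\<Sum>m\<in>F. ?h m x) (\<Sum>\<^sub>\<infinity>m. ?h m x) < \<epsilon> / 2"
    using eventually_happens'[OF finite_subsets_at_top_neq_bot] by blast
  \<comment> \<open>The scaling v / (2 pi) cancels the factor 2 pi of the frequency, so that a
    standard normal v produces exactly the required Gaussian factor.\<close>
  have shift: "?g m (x + (v / (2 * pi)) *\<^sub>R b) = a m * cos (2 * pi * int_inner m x + v * int_inner m b)" for m v
    by (simp add: int_inner_add int_inner_scaleR algebra_simps)
  have int: "integrable std_normal_distribution (\<lambda>v. \<Sum>m\<in>F. ?g m (x + (v / (2 * pi)) *\<^sub>R b))"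
    unfolding shift by (intro Bochner_Integration.integrable_sum integrable_mult_right integral_cos_std_normal)
  have "r - \<epsilon> / 2 = (\<integral>v. r - \<epsilon> / 2 \<partial>std_normal_distribution)"
    using prob_space by simp
  also have "\<dots> \<le> (\<integral>v. (\<Sum>m\<in>F. ?g m (x + (v / (2 * pi)) *\<^sub>R b)) \<partial>std_normal_distribution)"
  proof (rule integral_mono[OF _ int])
    fix v :: real
    show "r - \<epsilon> / 2 \<le> (\<Sum>m\<in>F. ?g m (x + (v / (2 * pi)) *\<^sub>R b))"
      using lb[of "x + (v / (2 * pi)) *\<^sub>R b"] F(2)[of "x + (v / (2 * pi)) *\<^sub>R b"]
      unfolding dist_real_def by linarith
  qed simp
  also have "\<dots> = (\<Sum>m\<in>F. ?h m x)"
    unfolding shift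
    by (subst Bochner_Integration.integral_sum)
       (auto intro!: integrable_mult_right integral_cos_std_normal simp: integral_cos_std_normal mult_ac)
  also have "\<dots> \<le> (\<Sum>\<^sub>\<infinity>m. ?h m x) + \<epsilon> / 2"
    using F(3)[of x] unfolding dist_real_def by linarith
  finally show "r \<le> (\<Sum>\<^sub>\<infinity>m. ?h m x) + \<epsilon>" by simp
qed

text \<open>Induction on the squares: the constant r of the diagonal form survives every averaging
  unchanged.\<close>

lemma theta_lower_bound_sum_of_squares:
  fixes d :: "'n::finite \<Rightarrow> real" and b :: "'h \<Rightarrow> real^'n"
  assumes d: "\<And>k. 0 < d k" and "finite H"
  obtains r where "0 < r"
    "\<And>x. r \<le> (\<Sum>\<^sub>\<infinity>m. exp (- (\<Sum>k\<in>UNIV. d k * (of_int (m $ k))\<^sup>2) - (\<Sum>h\<in>H. (int_inner m (b h))\<^sup>2 / 2)) * cos (2 * pi * int_inner m x))"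
proof -
  have "\<exists>r>0. \<forall>x. r \<le> (\<Sum>\<^sub>\<infinity>m. exp (- (\<Sum>k\<in>UNIV. d k * (of_int (m $ k))\<^sup>2) - (\<Sum>h\<in>H. (int_inner m (b h))\<^sup>2 / 2)) * cos (2 * pi * int_inner m x))"
    using \<open>finite H\<close>
  proof (induction H)
    case empty
    obtain r where "0 < r"
      "\<And>x::real^'n. r \<le> (\<Sum>\<^sub>\<infinity>m. exp (- (\<Sum>k\<in>UNIV. d k * (of_int (m $ k))\<^sup>2)) * cos (2 * pi * int_inner m x))"
      using diagonal_theta_lower_bound[of d, OF d] by blast
    then show ?case by (intro exI[of _ r]) simp
  next
    case (insert h H)
    then obtain r where r: "0 < r"
      "\<And>x. r \<le> (\<Sum>\<^sub>\<infinity>m. exp (- (\<Sum>k\<in>UNIV. d k * (of_int (m $ k))\<^sup>2) - (\<Sum>h\<in>H. (int_inner m (b h))\<^sup>2 / 2)) * cos (2 * pi * int_inner m x))"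
      by blast
    let ?a = "\<lambda>m. exp (- (\<Sum>k\<in>UNIV. d k * (of_int (m $ k))\<^sup>2) - (\<Sum>h\<in>H. (int_inner m (b h))\<^sup>2 / 2))"
    have s: "?a summable_on UNIV"
    proof (rule summable_on_comparison_test)
      show "(\<lambda>m::int^'n. exp (\<Sum>k\<in>UNIV. - d k * (of_int (m $ k))\<^sup>2 + 0 * \<bar>of_int (m $ k)\<bar>)) summable_on UNIV"
        by (rule summable_on_vec_gaussian[OF d])
      show "?a m \<le> exp (\<Sum>k\<in>UNIV. - d k * (of_int (m $ k))\<^sup>2 + 0 * \<bar>of_int (m $ k)\<bar>)" for m
        by (simp add: sum_negf sum_nonneg)
    qed auto
    have e: "?a m * exp (- ((int_inner m (b h))\<^sup>2) / 2) =
        exp (- (\<Sum>k\<in>UNIV. d k * (of_int (m $ k))\<^sup>2) - (\<Sum>h\<in>insert h H. (int_inner m (b h))\<^sup>2 / 2))" for m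
      using insert.hyps by (simp flip: exp_add)
    have "r \<le> (\<Sum>\<^sub>\<infinity>m. ?a m * exp (- ((int_inner m (b h))\<^sup>2) / 2) * cos (2 * pi * int_inner m x))" for x
      by (rule cos_series_gaussian_factor_lower_bound[OF _ s r(2)]) simp
    then show ?case unfolding e using r(1) by blast
  qed
  then show thesis using that by blast
qed

section \<open>Theta functions on real lines\<close>

type_synonym 'n rvec = "real^'n"
type_synonym 'n rmat = "real^'n^'n"

abbreviation cvec :: "real^'n \<Rightarrow> complex^'n" where
  "cvec x \<equiv> (\<chi> i. of_real (x $ i))"

abbreviation cmat :: "real^'n^'m \<Rightarrow> complex^'n^'m" where
  "cmat A \<equiv> (\<chi> i j. of_real (A $ i $ j))"

abbreviation imat :: "real^'n^'m \<Rightarrow> complex^'n^'m" where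
  "imat A \<equiv> (\<chi> i j. \<i> * of_real (A $ i $ j))"

lemma dotp_add_left: "dotp (a + b) c = dotp a c + dotp b c"
  by (simp add: dotp_def algebra_simps sum.distrib)

lemma dotp_add_right: "dotp a (b + c) = dotp a b + dotp a c"
  by (simp add: dotp_def algebra_simps sum.distrib)

lemma dotp_smult_left: "dotp (t *s a) b = t * dotp a b"
  by (simp add: dotp_def sum_distrib_left algebra_simps)

lemma dotp_smult_right: "dotp a (t *s b) = t * dotp a b"
  by (simp add: dotp_def sum_distrib_left algebra_simps)

lemma dotp_symmetric_matrix:
  assumes "transpose \<tau> = \<tau>"
  shows "dotp a (\<tau> *v b) = dotp b (\<tau> *v a)"
proof -
  have t: "\<tau> $ i $ j = \<tau> $ j $ i" for i j
    using assms by (metis transpose_def vec_lambda_beta)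
  have "dotp a (\<tau> *v b) = (\<Sum>i\<in>UNIV. \<Sum>j\<in>UNIV. a $ i * (\<tau> $ i $ j * b $ j))"
    by (simp add: dotp_def matrix_vector_mult_def sum_distrib_left)
  also have "\<dots> = (\<Sum>j\<in>UNIV. \<Sum>i\<in>UNIV. a $ i * (\<tau> $ i $ j * b $ j))"
    by (rule sum.swap)
  finally have sw: "dotp a (\<tau> *v b) = (\<Sum>j\<in>UNIV. \<Sum>i\<in>UNIV. a $ i * (\<tau> $ i $ j * b $ j))" .
  have "a $ i * (\<tau> $ i $ j * b $ j) = b $ j * (\<tau> $ j $ i * a $ i)" for i j
    by (simp add: t[of i j] mult_ac)
  then have "(\<Sum>j\<in>UNIV. \<Sum>i\<in>UNIV. a $ i * (\<tau> $ i $ j * b $ j)) = dotp b (\<tau> *v a)"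
    unfolding dotp_def matrix_vector_mult_def vec_lambda_beta sum_distrib_left by (simp only:)
  with sw show ?thesis by simp
qed

lemma vec_of_int_add: "vec_of_int (m + n) = vec_of_int m + vec_of_int n"
  by (simp add: vec_of_int_def vec_eq_iff)

lemma dotp_vec_of_int_cvec: "dotp (vec_of_int m) (cvec x) = of_real (int_inner m x)"
  by (simp add: dotp_def vec_of_int_def int_inner_def)

text \<open>Shift of the summation index by n; the two cross terms in m and n agree because \<tau>
  is symmetric.\<close>

lemma theta_quasi_periodic:
  fixes \<tau> :: "complex^'n::finite^'n"
  assumes "transpose \<tau> = \<tau>"
  shows "theta (v + \<tau> *v vec_of_int n) \<tau> =
    exp (- (\<i> * pi * dotp (vec_of_int n) (\<tau> *v vec_of_int n)) - 2 * \<i> * pi * dotp (vec_of_int n) v) * theta v \<tau>"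
proof -
  let ?e = "\<lambda>m v. \<i> * pi * dotp (vec_of_int m) (\<tau> *v vec_of_int m) + 2 * \<i> * pi * dotp (vec_of_int m) v"
  let ?c = "- (\<i> * pi * dotp (vec_of_int n) (\<tau> *v vec_of_int n)) - 2 * \<i> * pi * dotp (vec_of_int n) v"
  have "?e m (v + \<tau> *v vec_of_int n) = ?c + ?e (m + n) v" for m
    unfolding vec_of_int_add matrix_vector_right_distrib dotp_add_left dotp_add_right
    using dotp_symmetric_matrix[OF assms, of "vec_of_int n" "vec_of_int m"]
    by (simp add: algebra_simps)
  then have "theta (v + \<tau> *v vec_of_int n) \<tau> = (\<Sum>\<^sub>\<infinity>m\<in>UNIV. exp ?c * exp (?e (m + n) v))"
    unfolding theta_def by (simp only: exp_add)
  also have "\<dots> = exp ?c * (\<Sum>\<^sub>\<infinity>m\<in>UNIV. exp (?e (m + n) v))"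
    by (rule infsum_cmult_right')
  also have "(\<Sum>\<^sub>\<infinity>m\<in>UNIV. exp (?e (m + n) v)) = theta v \<tau>"
    unfolding theta_def by (rule infsum_reindex_bij_witness[of _ "\<lambda>m. m - n" "\<lambda>m. m + n"]) auto
  finally show ?thesis .
qed

definition quad_form :: "real^'n^'n \<Rightarrow> int^'n \<Rightarrow> real" where
  "quad_form B m = (\<Sum>i\<in>UNIV. \<Sum>j\<in>UNIV. B $ i $ j * of_int (m $ i) * of_int (m $ j))"

lemma dotp_imat: "dotp (vec_of_int m) (imat B *v vec_of_int m) = \<i> * of_real (quad_form B m)"
  by (simp add: dotp_def vec_of_int_def matrix_vector_mult_def quad_form_def sum_distrib_left mult_ac)

text \<open>Collects what Cauchy estimates require, uniformly in the real base point x: an upper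
  bound M on a complex disc around it and a lower bound r at its centre.\<close>

lemma theta_on_real_line:
  fixes B :: "real^'n^'n::finite" and d :: "'n \<Rightarrow> real" and b :: "'h \<Rightarrow> real^'n" and w :: "real^'n"
  assumes d: "\<And>k. 0 < d k" and H: "finite H"
    and quad_form: "\<And>m. pi * quad_form B m = (\<Sum>k\<in>UNIV. d k * (of_int (m $ k))\<^sup>2) + (\<Sum>h\<in>H. (int_inner m (b h))\<^sup>2 / 2)"
  obtains r M where "0 < r"
    "\<And>x. (\<lambda>t. theta (cvec x + t *s cvec w) (imat B)) holomorphic_on ball 0 1"
    "\<And>x. continuous_on (cball 0 1) (\<lambda>t. theta (cvec x + t *s cvec w) (imat B))"
    "\<And>x t. norm t \<le> 1 \<Longrightarrow> norm (theta (cvec x + t *s cvec w) (imat B)) \<le> M"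
    "\<And>x t. theta (cvec x + of_real t *s cvec w) (imat B) \<in> \<real>"
    "\<And>x. r \<le> Re (theta (cvec x) (imat B))"
proof -
  define T where "T = (\<lambda>x m t. complex_of_real (exp (- pi * quad_form B m)) * exp (2 * \<i> * pi * (of_real (int_inner m x) + t * of_real (int_inner m w))))"
  have e: "\<i> * complex_of_real pi * (\<i> * complex_of_real q) = complex_of_real (- pi * q)" for q
    by (simp add: complex_eq_iff)
  have theta_T: "theta (cvec x + t *s cvec w) (imat B) = (\<Sum>\<^sub>\<infinity>m. T x m t)" for x t
    unfolding theta_def T_def dotp_imat dotp_add_right dotp_smult_right dotp_vec_of_int_cvec exp_add e exp_of_real ..
  \<comment> \<open>Majorant for all x and all t in the unit disc: only the imaginary part of t
    affects the modulus of a term, at a cost of at most exp(2 pi |int_inner m w|).\<close>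
  define N where "N = (\<lambda>m::int^'n. exp (\<Sum>k\<in>UNIV. - d k * (of_int (m $ k))\<^sup>2 + 2 * pi * \<bar>w $ k\<bar> * \<bar>of_int (m $ k)\<bar>))"
  have N: "N summable_on UNIV" unfolding N_def by (rule summable_on_vec_gaussian[OF d])
  have TN: "norm (T x m t) \<le> N m" if t: "norm t \<le> 1" for x m t
  proof -
    have "\<bar>int_inner m w\<bar> \<le> (\<Sum>k\<in>UNIV. \<bar>w $ k\<bar> * \<bar>of_int (m $ k)\<bar>)"
      unfolding int_inner_def by (rule order_trans[OF sum_abs]) (simp add: abs_mult mult.commute)
    moreover have "- (Im t * int_inner m w) \<le> \<bar>Im t\<bar> * \<bar>int_inner m w\<bar>"
      by (metis abs_ge_minus_self abs_mult)
    moreover have "\<bar>Im t\<bar> * \<bar>int_inner m w\<bar> \<le> 1 * \<bar>int_inner m w\<bar>"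
      using t abs_Im_le_cmod[of t] by (intro mult_right_mono) auto
    ultimately have "- (Im t * int_inner m w) \<le> (\<Sum>k\<in>UNIV. \<bar>w $ k\<bar> * \<bar>of_int (m $ k)\<bar>)" by linarith
    then have "2 * pi * - (Im t * int_inner m w) \<le> 2 * pi * (\<Sum>k\<in>UNIV. \<bar>w $ k\<bar> * \<bar>of_int (m $ k)\<bar>)"
      by (intro mult_left_mono) auto
    moreover have "0 \<le> (\<Sum>h\<in>H. (int_inner m (b h))\<^sup>2 / 2)" by (intro sum_nonneg) auto
    ultimately have "- pi * quad_form B m + 2 * pi * - (Im t * int_inner m w)
        \<le> - (\<Sum>k\<in>UNIV. d k * (of_int (m $ k))\<^sup>2) + 2 * pi * (\<Sum>k\<in>UNIV. \<bar>w $ k\<bar> * \<bar>of_int (m $ k)\<bar>)"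
      using quad_form[of m] by linarith
    also have "\<dots> = (\<Sum>k\<in>UNIV. - d k * (of_int (m $ k))\<^sup>2 + 2 * pi * \<bar>w $ k\<bar> * \<bar>of_int (m $ k)\<bar>)"
      by (simp add: sum.distrib sum_negf sum_distrib_left sum_subtractf mult.assoc)
    finally show ?thesis
      unfolding T_def N_def norm_mult norm_exp_eq_Re by (simp add: exp_add[symmetric] mult.assoc)
  qed
  have unif: "uniform_limit (cball 0 1) (\<lambda>F t. \<Sum>m\<in>F. T x m t) (\<lambda>t. \<Sum>\<^sub>\<infinity>m. T x m t) (finite_subsets_at_top UNIV)" for x
    by (rule Weierstrass_m_test_general[OF _ N]) (simp add: TN)
  have hol: "continuous_on (cball 0 1) (\<lambda>t. \<Sum>\<^sub>\<infinity>m. T x m t) \<and> (\<lambda>t. \<Sum>\<^sub>\<infinity>m. T x m t) holomorphic_on ball 0 1" for x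
  proof -
    have "\<forall>\<^sub>F F in finite_subsets_at_top UNIV. continuous_on (cball 0 1) (\<lambda>t. \<Sum>m\<in>F. T x m t) \<and> (\<lambda>t. \<Sum>m\<in>F. T x m t) holomorphic_on ball 0 1"
      unfolding T_def by (intro always_eventually allI conjI continuous_intros holomorphic_intros)
    from holomorphic_uniform_limit[OF this unif] show ?thesis by auto
  qed
  have real: "(\<Sum>\<^sub>\<infinity>m. T x m (of_real t)) \<in> \<real>" for x t
  proof -
    have q: "quad_form B (- m) = quad_form B m" and i: "int_inner (- m) y = - int_inner m y" for m y
      by (simp_all add: quad_form_def int_inner_def sum_negf)
    have "cnj (\<Sum>\<^sub>\<infinity>m. T x m (of_real t)) = (\<Sum>\<^sub>\<infinity>m. cnj (T x m (of_real t)))" by simp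
    also have "\<dots> = (\<Sum>\<^sub>\<infinity>m. T x m (of_real t))"
      by (rule infsum_reindex_bij_witness[of _ uminus uminus])
        (auto simp: T_def q i exp_cnj algebra_simps)
    finally show ?thesis by (simp add: Reals_cnj_iff)
  qed
  obtain r where r: "0 < r"
    "\<And>x::real^'n. r \<le> (\<Sum>\<^sub>\<infinity>m. exp (- (\<Sum>k\<in>UNIV. d k * (of_int (m $ k))\<^sup>2) - (\<Sum>h\<in>H. (int_inner m (b h))\<^sup>2 / 2)) * cos (2 * pi * int_inner m x))"
    using theta_lower_bound_sum_of_squares[of d H b, OF d H] by blast
  show thesis
  proof (rule that[OF r(1), where M = "infsum N UNIV"])
    fix x :: "real^'n"
    show "(\<lambda>t. theta (cvec x + t *s cvec w) (imat B)) holomorphic_on ball 0 1"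
      and "continuous_on (cball 0 1) (\<lambda>t. theta (cvec x + t *s cvec w) (imat B))"
      unfolding theta_T using hol by auto
    show "norm (theta (cvec x + t *s cvec w) (imat B)) \<le> infsum N UNIV" if "norm t \<le> 1" for t
    proof -
      have "(\<lambda>m. norm (T x m t)) summable_on UNIV"
        by (rule summable_on_comparison_test[OF N]) (simp_all add: TN that)
      then have "(\<lambda>m. T x m t) summable_on UNIV" by (rule abs_summable_summable)
      then show ?thesis
        unfolding theta_T using norm_infsum_le[OF has_sum_infsum has_sum_infsum[OF N] TN[OF that, of x]] by blast
    qed
    show "theta (cvec x + of_real t *s cvec w) (imat B) \<in> \<real>" for t
      unfolding theta_T by (rule real)
    have "(\<lambda>m. norm (T x m 0)) summable_on UNIV"
      by (rule summable_on_comparison_test[OF N]) (simp_all add: TN)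
    then have s: "(\<lambda>m. T x m 0) summable_on UNIV" by (rule abs_summable_summable)
    have q: "- (\<Sum>k\<in>UNIV. d k * (of_int (m $ k))\<^sup>2) - (\<Sum>h\<in>H. (int_inner m (b h))\<^sup>2 / 2) = - pi * quad_form B m" for m
      using quad_form[of m] by simp
    have T0: "Re (T x m 0) = exp (- pi * quad_form B m) * cos (2 * pi * int_inner m x)" for m
    proof -
      have "exp (2 * \<i> * pi * (of_real (int_inner m x) + 0 * of_real (int_inner m w))) = cis (2 * pi * int_inner m x)"
        by (simp add: cis_conv_exp mult_ac)
      then show ?thesis unfolding T_def by simp
    qed
    have "r \<le> (\<Sum>\<^sub>\<infinity>m. Re (T x m 0))"
      unfolding T0 using r(2)[of x] unfolding q .
    also have "\<dots> = Re (theta (cvec x + 0 *s cvec w) (imat B))"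
      unfolding theta_T by (rule infsum_Re[OF s])
    finally show "r \<le> Re (theta (cvec x) (imat B))" by simp
  qed
qed

text \<open>The complex derivative can be computed along real increments, where the difference
  quotients are real.\<close>

lemma deriv_real_on_reals:
  assumes hol: "f holomorphic_on ball 0 r" and real: "\<And>t. \<bar>t\<bar> < r \<Longrightarrow> f (of_real t) \<in> \<real>" and t: "\<bar>t\<bar> < r"
  shows "deriv f (of_real t) \<in> \<real>"
proof -
  have "(f has_field_derivative deriv f (of_real t)) (at (of_real t))"
    using holomorphic_derivI[OF hol open_ball] t by (simp add: dist_norm)
  then have "((\<lambda>h. (f (of_real t + h) - f (of_real t)) / h) \<longlongrightarrow> deriv f (of_real t)) (at 0)"
    by (rule DERIV_D)
  moreover have "filterlim (\<lambda>h. complex_of_real h) (at 0) (at 0)"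
    by (auto simp: filterlim_at intro!: tendsto_eq_intros eventually_at_filter[THEN iffD2])
  ultimately have "((\<lambda>h. (f (of_real t + of_real h) - f (of_real t)) / of_real h) \<longlongrightarrow> deriv f (of_real t)) (at (0::real))"
    by (rule filterlim_compose)
  then show ?thesis
  proof (rule Lim_in_closed_set[OF closed_complex_Reals, rotated 2])
    have "\<forall>\<^sub>F h in at (0::real). \<bar>h\<bar> < r - \<bar>t\<bar>"
      unfolding eventually_at by (intro exI[of _ "r - \<bar>t\<bar>"]) (use t in \<open>simp add: dist_real_def\<close>)
    then show "\<forall>\<^sub>F h in at (0::real). (f (of_real t + of_real h) - f (of_real t)) / of_real h \<in> \<real>"
    proof eventually_elim
      case (elim h)
      then have "f (of_real (t + h)) \<in> \<real>" by (intro real) linarith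
      then show ?case using real[OF t] by (auto intro!: Reals_divide Reals_diff)
    qed
  qed simp
qed

lemma deriv2_real_on_reals:
  assumes hol: "f holomorphic_on ball 0 r" and "0 < r" and real: "\<And>t. \<bar>t\<bar> < r \<Longrightarrow> f (of_real t) \<in> \<real>"
  shows "(deriv ^^ 2) f 0 \<in> \<real>"
  using deriv_real_on_reals[OF holomorphic_deriv[OF hol open_ball] deriv_real_on_reals[OF hol real], of 0] \<open>0 < r\<close>
  by (simp add: numeral_2_eq_2)

text \<open>The argument of \<open>Ln\<close> equals 1 at 0 and so stays away from the cut nearby;
  the logarithmic derivative then splits, and the exponential contributes only the constant 2
  \<beta>.\<close>

lemma deriv2_Ln_exp_quadratic_times:
  assumes hol: "\<Theta> holomorphic_on ball 0 1" and nz: "\<Theta> 0 \<noteq> 0"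
  shows "(deriv ^^ 2) (\<lambda>t. Ln (exp (\<alpha> * t + \<beta> * t\<^sup>2) * \<Theta> t / \<Theta> 0)) 0 =
    2 * \<beta> + (deriv ^^ 2) \<Theta> 0 / \<Theta> 0 - (deriv \<Theta> 0 / \<Theta> 0)\<^sup>2"
proof -
  let ?G = "\<lambda>t. exp (\<alpha> * t + \<beta> * t\<^sup>2) * \<Theta> t / \<Theta> 0"
  have D: "(\<Theta> has_field_derivative deriv \<Theta> t) (at t)" if "t \<in> ball 0 1" for t
    using holomorphic_derivI[OF hol open_ball that] .
  have hol': "deriv \<Theta> holomorphic_on ball 0 1" by (rule holomorphic_deriv[OF hol open_ball])
  have D': "(deriv \<Theta> has_field_derivative (deriv ^^ 2) \<Theta> 0) (at 0)"
    using holomorphic_derivI[OF hol' open_ball, of 0] by (simp add: numeral_2_eq_2)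
  have D0: "(\<Theta> has_field_derivative deriv \<Theta> 0) (at 0)" using D[of 0] by simp
  have "isCont ?G 0"
    using DERIV_isCont[OF D0] nz by (intro continuous_intros) auto
  then have "(?G \<longlongrightarrow> 1) (at 0)" using nz by (simp add: isCont_def)
  then have "\<forall>\<^sub>F t in at 0. ?G t \<in> ball 1 1"
    by (rule topological_tendstoD) auto
  moreover have "?G 0 \<in> ball 1 1" using nz by simp
  ultimately have "\<forall>\<^sub>F t in nhds 0. ?G t \<in> ball 1 1"
    by (auto simp: eventually_at_filter elim: eventually_mono)
  moreover have "\<forall>\<^sub>F t in nhds 0. t \<in> ball (0::complex) 1"
    by (intro eventually_nhds_in_open) auto
  ultimately have "\<forall>\<^sub>F t in nhds 0. deriv (\<lambda>t. Ln (?G t)) t = \<alpha> + 2 * \<beta> * t + deriv \<Theta> t / \<Theta> t"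
  proof eventually_elim
    case (elim t)
    then have "\<bar>Re (1 - ?G t)\<bar> < 1"
      using abs_Re_le_cmod[of "1 - ?G t"] by (simp add: dist_norm)
    then have np: "?G t \<notin> \<real>\<^sub>\<le>\<^sub>0" by (auto simp: complex_nonpos_Reals_iff)
    have tnz: "\<Theta> t \<noteq> 0" using np by auto
    have "(?G has_field_derivative ?G t * (\<alpha> + 2 * \<beta> * t + deriv \<Theta> t / \<Theta> t)) (at t)"
      by (rule derivative_eq_intros D[OF elim(2)] nz refl)+
        (use tnz nz in \<open>simp add: field_simps\<close>)
    from DERIV_chain2[OF has_field_derivative_Ln[OF np] this]
    have "((\<lambda>t. Ln (?G t)) has_field_derivative \<alpha> + 2 * \<beta> * t + deriv \<Theta> t / \<Theta> t) (at t)"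
      by (rule DERIV_cong) (use tnz nz in simp)
    then show ?case by (rule DERIV_imp_deriv)
  qed
  then have "deriv (deriv (\<lambda>t. Ln (?G t))) 0 = deriv (\<lambda>t. \<alpha> + 2 * \<beta> * t + deriv \<Theta> t / \<Theta> t) 0"
    by (intro deriv_cong_ev refl)
  also have "\<dots> = 2 * \<beta> + (deriv ^^ 2) \<Theta> 0 / \<Theta> 0 - (deriv \<Theta> 0 / \<Theta> 0)\<^sup>2"
  proof (rule DERIV_imp_deriv)
    show "((\<lambda>t. \<alpha> + 2 * \<beta> * t + deriv \<Theta> t / \<Theta> t) has_field_derivative
       2 * \<beta> + (deriv ^^ 2) \<Theta> 0 / \<Theta> 0 - (deriv \<Theta> 0 / \<Theta> 0)\<^sup>2) (at 0)"
      by (rule derivative_eq_intros D0 D' nz refl)+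
        (use nz in \<open>simp_all add: field_simps power2_eq_square\<close>)
  qed
  finally show ?thesis by (simp add: numeral_2_eq_2)
qed

section \<open>Sigma on the half-period subspace\<close>

lemma matrix_vector_smult: "(M :: complex^'n^'m) *v (t *s x) = t *s (M *v x)"
  by (simp add: matrix_vector_mult_def vec_eq_iff sum_distrib_left mult_ac)

lemma cmat_mult_cvec: "cmat A *v cvec x = cvec (A *v x)"
  by (simp add: matrix_vector_mult_def vec_eq_iff)

lemma dotp_quadratic_line:
  fixes K :: "complex^'n::finite^'n"
  shows "dotp (u + t *s v) (K *v (u + t *s v)) =
    dotp u (K *v u) + t * (dotp u (K *v v) + dotp v (K *v u)) + t\<^sup>2 * dotp v (K *v v)"
  by (simp add: matrix_vector_right_distrib matrix_vector_smult dotp_add_left dotp_add_right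
      dotp_smult_left dotp_smult_right algebra_simps power2_eq_square)

lemma dotp_axis: "dotp (axis i 1) (K *v axis i 1) = K $ i $ i"
  by (simp add: dotp_def matrix_vector_mult_def axis_def if_distrib[of "\<lambda>x. x * _"] if_distrib[of "\<lambda>x. _ * x"]
      cong: if_cong)

lemma cvec_axis: "cvec (axis i 1) = axis i 1"
  by (simp add: vec_eq_iff axis_def)

text \<open>The half period in the argument and the one from \<epsilon>' = (1,...,1) add up to
  \<tau>(1,...,1), which quasi-periodicity removes at the price of an exponential with exponent
  linear in t. The remaining \<epsilon>/2 is a real translation and becomes part of
  \<open>xi\<close>.\<close>

lemma theta_char_on_half_period_line:
  fixes B :: "real^'n^'n::finite" and x w :: "real^'n" and \<epsilon>' \<epsilon> :: "int^'n"
  assumes B: "transpose B = B" and \<epsilon>': "\<And>k. \<epsilon>' $ k = 1"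
  defines "xi \<equiv> x + (\<chi> k. of_int (\<epsilon> $ k) / 2)"
  obtains c \<alpha> where "\<And>t. theta_char \<epsilon>' \<epsilon> ((1/2) *s (imat B *v vec_of_int \<epsilon>') + cvec x + t *s cvec w) (imat B)
      = exp (c + \<alpha> * t) * theta (cvec xi + t *s cvec w) (imat B)"
proof -
  let ?h = "(1/2) *s vec_of_int \<epsilon>' :: complex^'n"
  let ?b = "(1/2) *s vec_of_int \<epsilon> :: complex^'n"
  let ?\<tau> = "imat B"
  let ?o = "vec_of_int \<epsilon>' :: complex^'n"
  let ?v = "\<lambda>t. (1/2) *s (?\<tau> *v ?o) + cvec x + t *s cvec w"
  have sym: "transpose ?\<tau> = ?\<tau>"
    using B by (simp add: transpose_def vec_eq_iff)
  have b: "cvec xi = cvec x + ?b"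
    by (simp add: xi_def vec_eq_iff vec_of_int_def)
  have v: "?v t + ?b + ?\<tau> *v ?h = (cvec xi + t *s cvec w) + ?\<tau> *v ?o" for t
    unfolding b matrix_vector_smult by (simp add: vec_eq_iff algebra_simps)
  define c where "c = \<i> * pi * dotp ?h (?\<tau> *v ?h) + 2 * \<i> * pi * dotp ((1/2) *s (?\<tau> *v ?o) + cvec x + ?b) ?h
    - (\<i> * pi * dotp ?o (?\<tau> *v ?o)) - 2 * \<i> * pi * dotp ?o (cvec xi)"
  define \<alpha> where "\<alpha> = 2 * \<i> * pi * dotp (cvec w) ?h - 2 * \<i> * pi * dotp ?o (cvec w)"
  have "theta_char \<epsilon>' \<epsilon> (?v t) ?\<tau> = exp (c + \<alpha> * t) * theta (cvec xi + t *s cvec w) ?\<tau>" for t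
  proof -
    have "theta_char \<epsilon>' \<epsilon> (?v t) ?\<tau> =
        exp (\<i> * pi * dotp ?h (?\<tau> *v ?h) + 2 * \<i> * pi * dotp (?v t + ?b) ?h) *
        (exp (- (\<i> * pi * dotp ?o (?\<tau> *v ?o)) - 2 * \<i> * pi * dotp ?o (cvec xi + t *s cvec w)) *
         theta (cvec xi + t *s cvec w) ?\<tau>)"
      unfolding theta_char_def Let_def v theta_quasi_periodic[OF sym] ..
    moreover have "exp (\<i> * pi * dotp ?h (?\<tau> *v ?h) + 2 * \<i> * pi * dotp (?v t + ?b) ?h) *
        exp (- (\<i> * pi * dotp ?o (?\<tau> *v ?o)) - 2 * \<i> * pi * dotp ?o (cvec xi + t *s cvec w)) = exp (c + \<alpha> * t)"
      unfolding exp_add[symmetric] c_def \<alpha>_def dotp_add_left dotp_add_right dotp_smult_left dotp_smult_right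
      by (rule arg_cong[of _ _ exp]) (simp add: algebra_simps)
    ultimately show ?thesis by (simp only: mult.assoc[symmetric])
  qed
  then show thesis by (rule that)
qed

text \<open>On the line through h + s in the direction of the first coordinate, sigma is the
  exponential of a quadratic polynomial times \<open>Th x\<close>. Two logarithmic derivatives leave
  one entry of K and the derivatives of \<open>Th x\<close> at 0, which are real since
  \<open>Th x\<close> is real on the real axis. M and r do not depend on s, hence neither does the
  bound.\<close>

lemma wp11_real_bounded_half_period:
  fixes B A :: "('n::{finite,linorder}) rmat" and d :: "'n \<Rightarrow> real" and b :: "'h \<Rightarrow> 'n rvec"
    and K :: "'n cmat" and \<epsilon>' \<epsilon> :: "'n ivec" and \<sigma> :: "'n cvec \<Rightarrow> complex"
  assumes \<sigma>: "\<And>u. \<sigma> u = C * exp (- (1/2) * dotp u (K *v u)) * theta_char \<epsilon>' \<epsilon> (cmat A *v u) (imat B)"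
    and C: "C \<noteq> 0" and K: "K $ Min UNIV $ Min UNIV \<in> \<real>" and \<epsilon>': "\<And>k. \<epsilon>' $ k = 1"
    and B: "transpose B = B"
    and h: "cmat A *v h = (1/2) *s (imat B *v vec_of_int \<epsilon>')"
    and d: "\<And>k. 0 < d k" and H: "finite H"
    and quad_form: "\<And>m. pi * quad_form B m = (\<Sum>k\<in>UNIV. d k * (of_int (m $ k))\<^sup>2) + (\<Sum>h\<in>H. (int_inner m (b h))\<^sup>2 / 2)"
  shows "(\<forall>s. \<sigma> (h + cvec s) \<noteq> 0 \<and> wp11 \<sigma> (h + cvec s) \<in> \<real>) \<and> bounded (range (\<lambda>s. wp11 \<sigma> (h + cvec s)))"
proof -
  let ?i = "Min UNIV :: 'n"
  define w where "w = A *v axis ?i 1"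
  define Th where "Th = (\<lambda>x t. theta (cvec x + t *s cvec w) (imat B))"
  obtain r M where r: "0 < r"
    and hol: "\<And>x. Th x holomorphic_on ball 0 1"
    and cont: "\<And>x. continuous_on (cball 0 1) (Th x)"
    and le_M: "\<And>x t. norm t \<le> 1 \<Longrightarrow> norm (Th x t) \<le> M"
    and re: "\<And>x t. Th x (of_real t) \<in> \<real>"
    and ge_r: "\<And>x. r \<le> Re (Th x 0)"
    using theta_on_real_line[of d H B b w, OF d H quad_form] unfolding Th_def by (auto simp: eta_contract_eq)
  have nz: "Th x 0 \<noteq> 0" for x using r ge_r[of x] by auto
  have form: "\<exists>x. \<sigma> (h + cvec s) \<noteq> 0 \<and> wp11 \<sigma> (h + cvec s) =
      K $ ?i $ ?i - ((deriv ^^ 2) (Th x) 0 / Th x 0 - (deriv (Th x) 0 / Th x 0)\<^sup>2)" for s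
  proof -
    let ?u = "h + cvec s"
    define x where "x = A *v s + (\<chi> k. of_int (\<epsilon> $ k) / 2)"
    obtain c \<alpha> where ca: "\<And>t. theta_char \<epsilon>' \<epsilon> ((1/2) *s (imat B *v vec_of_int \<epsilon>') + cvec (A *v s) + t *s cvec w) (imat B)
      = exp (c + \<alpha> * t) * Th x t"
      using theta_char_on_half_period_line[OF B \<epsilon>', where x = "A *v s" and \<epsilon> = \<epsilon> and w = w] unfolding Th_def x_def by blast
    have Au: "cmat A *v (?u + t *s axis ?i 1) = (1/2) *s (imat B *v vec_of_int \<epsilon>') + cvec (A *v s) + t *s cvec w" for t
      unfolding matrix_vector_right_distrib matrix_vector_smult h cmat_mult_cvec w_def cvec_axis[symmetric] ..
    define p where "p = dotp ?u (K *v ?u)"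
    define q where "q = dotp ?u (K *v axis ?i 1) + dotp (axis ?i 1) (K *v ?u)"
    define a' where "a' = - (1/2) * q + \<alpha>"
    define b' where "b' = - (1/2) * K $ ?i $ ?i"
    have line: "\<sigma> (?u + t *s axis ?i 1) = C * exp (- (1/2) * p + c) * (exp (a' * t + b' * t\<^sup>2) * Th x t)" for t
    proof -
      have "\<sigma> (?u + t *s axis ?i 1) = C * exp (- (1/2) * (p + t * q + t\<^sup>2 * K $ ?i $ ?i)) * (exp (c + \<alpha> * t) * Th x t)"
        unfolding \<sigma> Au ca dotp_quadratic_line dotp_axis p_def q_def ..
      moreover have "exp (- (1/2) * (p + t * q + t\<^sup>2 * K $ ?i $ ?i)) * exp (c + \<alpha> * t)
          = exp (- (1/2) * p + c) * exp (a' * t + b' * t\<^sup>2)"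
        unfolding exp_add[symmetric] a'_def b'_def by (rule arg_cong[of _ _ exp]) (simp add: algebra_simps)
      ultimately show ?thesis by (simp only: mult.assoc[symmetric]) (simp only: mult.assoc)
    qed
    have s0: "\<sigma> ?u = C * exp (- (1/2) * p + c) * Th x 0" using line[of 0] by simp
    have "\<sigma> ?u \<noteq> 0" unfolding s0 using C nz by simp
    have "(\<lambda>t. Ln (\<sigma> (?u + t *s axis ?i 1) / \<sigma> ?u)) = (\<lambda>t. Ln (exp (a' * t + b' * t\<^sup>2) * Th x t / Th x 0))"
      unfolding line s0 using C by (simp add: field_simps)
    then have "wp11 \<sigma> ?u = - (2 * b' + (deriv ^^ 2) (Th x) 0 / Th x 0 - (deriv (Th x) 0 / Th x 0)\<^sup>2)"
      unfolding wp11_def using deriv2_Ln_exp_quadratic_times[OF hol nz, of a' b'] by simp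
    then show ?thesis using \<open>\<sigma> ?u \<noteq> 0\<close> by (intro exI[of _ x]) (simp add: b'_def)
  qed
  have real: "K $ ?i $ ?i - ((deriv ^^ 2) (Th x) 0 / Th x 0 - (deriv (Th x) 0 / Th x 0)\<^sup>2) \<in> \<real>" for x
    using K deriv2_real_on_reals[OF hol _ re, of x] deriv_real_on_reals[OF hol re, of 0 x] re[of x 0]
    by (auto intro!: Reals_diff Reals_divide Reals_power)
  \<comment> \<open>2 M and M bound the second and first derivative by Cauchy's inequality on the
    unit disc; r bounds the denominators from below.\<close>
  define R where "R = norm (K $ ?i $ ?i) + (2 * M / r + (M / r)\<^sup>2)"
  have bound: "norm (K $ ?i $ ?i - ((deriv ^^ 2) (Th x) 0 / Th x 0 - (deriv (Th x) 0 / Th x 0)\<^sup>2)) \<le> R" for x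
  proof -
    have M0: "0 \<le> M" using le_M[of 0 x] norm_ge_zero order_trans by (metis norm_zero zero_le_one)
    have c: "norm ((deriv ^^ n) (Th x) 0) \<le> fact n * M / 1 ^ n" for n
      by (rule Cauchy_inequality[OF hol cont]) (auto simp: le_M)
    have T: "r \<le> norm (Th x 0)" using ge_r[of x] complex_Re_le_cmod order_trans by blast
    have "norm ((deriv ^^ 2) (Th x) 0 / Th x 0) \<le> 2 * M / r"
      unfolding norm_divide using c[of 2] T r M0 by (intro frac_le) auto
    moreover have "norm (deriv (Th x) 0 / Th x 0) \<le> M / r"
      unfolding norm_divide using c[of 1] T r M0 by (intro frac_le) auto
    then have "norm ((deriv (Th x) 0 / Th x 0)\<^sup>2) \<le> (M / r)\<^sup>2"
      unfolding norm_power by (intro power_mono) auto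
    ultimately show ?thesis
      unfolding R_def
      by (intro order_trans[OF norm_triangle_ineq4] add_mono order_refl order_trans[OF norm_triangle_ineq4]) auto
  qed
  have "norm (wp11 \<sigma> (h + cvec s)) \<le> R" for s using form[of s] bound by auto
  then have "bounded (range (\<lambda>s. wp11 \<sigma> (h + cvec s)))" by (auto simp: bounded_iff)
  moreover have "\<sigma> (h + cvec s) \<noteq> 0 \<and> wp11 \<sigma> (h + cvec s) \<in> \<real>" for s
    using form[of s] real by auto
  ultimately show ?thesis by blast
qed

section \<open>Products of square roots in the upper half plane\<close>

text \<open>A product of principal roots, not the principal root of the product: each factor is
  analytic in the open upper half plane, so this is a single analytic branch there.\<close>

definition sqrt_prod :: "real set \<Rightarrow> complex \<Rightarrow> complex" where
  "sqrt_prod A z = (\<Prod>a\<in>A. csqrt (z - of_real a))"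

lemma norm_sqrt_prod: "norm (sqrt_prod A z) = (\<Prod>a\<in>A. sqrt (norm (z - of_real a)))"
  by (simp add: sqrt_prod_def prod_norm[symmetric])

lemma sqrt_prod_eq_0_iff: "finite A \<Longrightarrow> sqrt_prod A z = 0 \<longleftrightarrow> z \<in> of_real ` A"
  by (auto simp: sqrt_prod_def)

text \<open>Multiplication by -i maps the closed upper half plane to the closed right one, which
  meets the cut of \<open>csqrt\<close> only in 0. Hence the root extends continuously to the
  negative real axis from above.\<close>

lemma csqrt_upper: "Im z \<ge> 0 \<Longrightarrow> csqrt z = csqrt \<i> * csqrt (- \<i> * z)"
proof (rule csqrt_unique)
  assume z: "Im z \<ge> 0"
  show "(csqrt \<i> * csqrt (- \<i> * z))\<^sup>2 = z" unfolding power_mult_distrib power2_csqrt by (simp flip: mult.assoc)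
  define w where "w = csqrt (- \<i> * z)"
  have "Re (w\<^sup>2) \<ge> 0" using z by (simp add: w_def)
  then have "(Im w)\<^sup>2 \<le> (Re w)\<^sup>2" by (simp add: power2_eq_square)
  then have "\<bar>Im w\<bar> \<le> \<bar>Re w\<bar>" by (simp add: abs_le_square_iff)
  moreover have "0 \<le> Re w" unfolding w_def by (rule Re_csqrt)
  \<comment> \<open>w lies in the sector |arg w| \<le> pi/4; rotation by pi/4 takes it to the closed
    first quadrant, where the principal root is the right one.\<close>
  ultimately have le: "\<bar>Im w\<bar> \<le> Re w" by simp
  have "Re (csqrt \<i> * w) = (Re w - Im w) / sqrt 2" "Im (csqrt \<i> * w) = (Re w + Im w) / sqrt 2"
    by (simp_all add: Re_divide Im_divide field_simps)
  then show "0 < Re (csqrt \<i> * csqrt (- \<i> * z)) \<or> Re (csqrt \<i> * csqrt (- \<i> * z)) = 0 \<and> 0 \<le> Im (csqrt \<i> * csqrt (- \<i> * z))"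
    unfolding w_def[symmetric] using le by (auto simp: divide_simps zero_le_divide_iff)
qed

lemma continuous_on_csqrt_upper: "continuous_on {z. 0 \<le> Im z} csqrt"
proof -
  have "continuous_on {z. 0 \<le> Im z} (\<lambda>z. csqrt \<i> * csqrt (- \<i> * z))"
    unfolding continuous_on
  proof
    fix z assume "z \<in> {z. 0 \<le> Im z}"
    show "((\<lambda>z. csqrt \<i> * csqrt (- \<i> * z)) \<longlongrightarrow> csqrt \<i> * csqrt (- \<i> * z)) (at z within {z. 0 \<le> Im z})"
    proof (cases "z = 0")
      case True
      have "((\<lambda>z::complex. sqrt (norm (- \<i> * z))) \<longlongrightarrow> sqrt (norm (- \<i> * 0))) (at 0 within {z. 0 \<le> Im z})"
        by (intro tendsto_intros)
      then have "((\<lambda>z::complex. norm (csqrt (- \<i> * z))) \<longlongrightarrow> 0) (at 0 within {z. 0 \<le> Im z})"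
        by simp
      then have "((\<lambda>z. csqrt (- \<i> * z)) \<longlongrightarrow> 0) (at 0 within {z. 0 \<le> Im z})"
        by (rule tendsto_norm_zero_cancel)
      then show ?thesis using True by (intro tendsto_intros) auto
    next
      case False
      then have "- \<i> * z \<notin> \<real>\<^sub>\<le>\<^sub>0"
        using \<open>z \<in> {z. 0 \<le> Im z}\<close> by (auto simp: complex_nonpos_Reals_iff complex_eq_iff)
      then have "isCont (\<lambda>z. csqrt \<i> * csqrt (- \<i> * z)) z"
        by (intro continuous_intros) auto
      then show ?thesis
        by (simp add: isCont_def) (rule tendsto_within_subset, assumption, simp)
    qed
  qed
  moreover have "continuous_on {z. 0 \<le> Im z} csqrt = continuous_on {z. 0 \<le> Im z} (\<lambda>z. csqrt \<i> * csqrt (- \<i> * z))"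
    by (rule continuous_on_cong[OF refl]) (rule csqrt_upper, simp)
  ultimately show ?thesis by blast
qed

lemma continuous_on_sqrt_prod: "continuous_on {z. 0 \<le> Im z} (sqrt_prod A)"
  unfolding sqrt_prod_def
  by (intro continuous_intros continuous_on_compose2[OF continuous_on_csqrt_upper]) auto

lemma holomorphic_on_sqrt_prod: "sqrt_prod A holomorphic_on {z. 0 < Im z}"
  unfolding sqrt_prod_def by (intro holomorphic_intros) (auto simp: complex_nonpos_Reals_iff)

lemma sqrt_prod_of_real_measurable [measurable]: "(\<lambda>x. sqrt_prod A (of_real x)) \<in> borel_measurable borel"
  by (rule borel_measurable_continuous_onI, rule continuous_on_compose2[OF continuous_on_sqrt_prod])
    (auto intro!: continuous_intros)

lemma sqrt_prod_shift_measurable [measurable]: "0 \<le> t \<Longrightarrow> (\<lambda>x. sqrt_prod A (of_real x + \<i> * of_real t)) \<in> borel_measurable borel"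
  by (rule borel_measurable_continuous_onI, rule continuous_on_compose2[OF continuous_on_sqrt_prod])
    (auto intro!: continuous_intros)

section \<open>Growth, domination and integrability of p divided by the square root\<close>

lemma poly_norm_bound:
  fixes p :: "complex poly"
  assumes "degree p \<le> d"
  obtains C where "0 < C" "\<And>z. norm (poly p z) \<le> C * (1 + norm z) ^ d"
proof
  define C where "C = 1 + (\<Sum>i\<le>d. norm (coeff p i))"
  show "0 < C" unfolding C_def by (simp add: add_pos_nonneg sum_nonneg)
  fix z
  have "poly p z = (\<Sum>i\<le>d. coeff p i * z ^ i)"
    unfolding poly_altdef using assms by (intro sum.mono_neutral_left) (auto simp: coeff_eq_0)
  then have "norm (poly p z) \<le> (\<Sum>i\<le>d. norm (coeff p i * z ^ i))"
    by (simp only: norm_sum)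
  also have "\<dots> = (\<Sum>i\<le>d. norm (coeff p i) * norm z ^ i)"
    by (simp add: norm_mult norm_power)
  finally have "norm (poly p z) \<le> (\<Sum>i\<le>d. norm (coeff p i) * norm z ^ i)" .
  also have "\<dots> \<le> (\<Sum>i\<le>d. norm (coeff p i) * (1 + norm z) ^ d)"
  proof (intro sum_mono mult_left_mono)
    fix i assume "i \<in> {..d}"
    have "norm z ^ i \<le> (1 + norm z) ^ i" by (intro power_mono) auto
    also have "\<dots> \<le> (1 + norm z) ^ d" using \<open>i \<in> {..d}\<close> by (intro power_increasing) auto
    finally show "norm z ^ i \<le> (1 + norm z) ^ d" .
  qed auto
  also have "\<dots> \<le> C * (1 + norm z) ^ d"
    unfolding C_def sum_distrib_right[symmetric] by (intro mult_right_mono) auto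
  finally show "norm (poly p z) \<le> C * (1 + norm z) ^ d" .
qed

text \<open>For a = 0 the function 2 arctan (sqrt x) is an antiderivative on the positive half line;
  reflection gives the other half. Translation changes the weight 1 + |x| by at most the factor 1 +
  |a|.\<close>

lemma integrable_inverse_sqrt_weight:
  "integrable lborel (\<lambda>x. 1 / (sqrt \<bar>x - a\<bar> * (1 + \<bar>x\<bar>)))"
proof -
  let ?f = "\<lambda>x::real. 1 / (sqrt \<bar>x\<bar> * (1 + \<bar>x\<bar>))"
  have "set_integrable lborel (einterval 0 \<infinity>) ?f"
  proof (rule interval_integral_FTC_nonneg(1)[where F = "\<lambda>x. 2 * arctan (sqrt x)"])
    fix x :: real assume "0 < ereal x"
    then have x: "0 < x" by simp
    have "2 / (sqrt x * 2 + x * (sqrt x * 2)) = 1 / (sqrt x + x * sqrt x)"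
      using x by (subst frac_eq_eq) (auto simp: add_pos_pos algebra_simps add_nonneg_eq_0_iff)
    then show "DERIV (\<lambda>x. 2 * arctan (sqrt x)) x :> ?f x"
      using x by (auto intro!: derivative_eq_intros simp: field_simps)
    show "isCont ?f x" using x by (intro continuous_intros) auto
  next
    show "(((\<lambda>x. 2 * arctan (sqrt x)) \<circ> real_of_ereal) \<longlongrightarrow> 0) (at_right 0)"
      unfolding zero_ereal_def ereal_tendsto_simps1 by real_asymp
    show "(((\<lambda>x. 2 * arctan (sqrt x)) \<circ> real_of_ereal) \<longlongrightarrow> pi) (at_left \<infinity>)"
      unfolding ereal_tendsto_simps1 by real_asymp
  qed auto
  then have p: "integrable lborel (\<lambda>x. indicator {0<..} x * ?f x)"
    by (simp add: set_integrable_def einterval_def greaterThan_def zero_ereal_def)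
  have m: "integrable lborel (\<lambda>x. indicator {..<0} x * ?f x)"
  proof -
    have "integrable lborel (\<lambda>x. indicator {0<..} (0 + (-1) * x) * ?f (0 + (-1) * x))"
      by (rule lborel_integrable_real_affine[OF p]) simp
    moreover have "indicator {0<..} (0 + (-1) * x) = (indicator {..<0} x :: real)" for x :: real
      by (auto simp: indicator_def)
    ultimately show ?thesis by simp
  qed
  have "integrable lborel (\<lambda>x. indicator {0<..} x * ?f x + indicator {..<0} x * ?f x)"
    by (intro Bochner_Integration.integrable_add p m)
  moreover have "indicator {0<..} x * ?f x + indicator {..<0} x * ?f x = ?f x" for x :: real
    by (auto simp: indicator_def)
  ultimately have f: "integrable lborel ?f" by simp
  have "integrable lborel (\<lambda>x. (1 + \<bar>a\<bar>) * ?f (- a + 1 * x))"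
    by (intro integrable_mult_right lborel_integrable_real_affine[OF f]) simp
  then show ?thesis
  proof (rule Bochner_Integration.integrable_bound)
    show "AE x in lborel. norm (1 / (sqrt \<bar>x - a\<bar> * (1 + \<bar>x\<bar>))) \<le> norm ((1 + \<bar>a\<bar>) * ?f (- a + 1 * x))"
    proof (rule AE_I2)
      fix x
      have "\<bar>x - a\<bar> \<le> \<bar>x\<bar> + \<bar>a\<bar>" by simp
      moreover have "0 \<le> \<bar>a\<bar> * \<bar>x\<bar>" by simp
      ultimately have "1 + \<bar>x - a\<bar> \<le> (1 + \<bar>a\<bar>) * (1 + \<bar>x\<bar>)"
        by (simp only: distrib_left distrib_right mult_1 mult_1_right; linarith)
      then have "1 / (1 + \<bar>x\<bar>) \<le> (1 + \<bar>a\<bar>) / (1 + \<bar>x - a\<bar>)"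
        by (simp add: field_simps add_pos_nonneg)
      then have "1 / sqrt \<bar>x - a\<bar> * (1 / (1 + \<bar>x\<bar>)) \<le> 1 / sqrt \<bar>x - a\<bar> * ((1 + \<bar>a\<bar>) / (1 + \<bar>x - a\<bar>))"
        by (intro mult_left_mono) auto
      then show "norm (1 / (sqrt \<bar>x - a\<bar> * (1 + \<bar>x\<bar>))) \<le> norm ((1 + \<bar>a\<bar>) * ?f (- a + 1 * x))"
        by (simp add: abs_mult)
    qed
  qed measurable
qed

lemma finite_real_set_bound:
  assumes "finite (A :: real set)"
  obtains R where "0 \<le> R" "\<And>a. a \<in> A \<Longrightarrow> \<bar>a\<bar> \<le> R"
proof -
  obtain B where "\<And>a. a \<in> A \<Longrightarrow> \<bar>a\<bar> \<le> B"
    using finite_imp_bounded[OF assms] unfolding bounded_iff by auto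
  then show thesis by (intro that[of "max 0 B"]) (auto intro: max.coboundedI2)
qed

text \<open>Only the branch point nearest to x can cause a singularity; all others are at distance
  at least \<kappa> (1 + |x|). There are at least 2 (d + 1) of them, enough to absorb the growth of
  degree d and to gain one more factor 1 + |x|.\<close>

lemma inverse_sqrt_prod_bound:
  fixes A :: "real set"
  assumes A: "finite A" and card: "2 * d + 3 \<le> card A"
  obtains C where "0 < C"
    "\<And>x. (1 + \<bar>x\<bar>) ^ d / (\<Prod>a\<in>A. sqrt \<bar>x - a\<bar>) \<le> C * (\<Sum>a\<in>A. 1 / (sqrt \<bar>x - a\<bar> * (1 + \<bar>x\<bar>)))"
proof -
  have A0: "A \<noteq> {}" using card by auto
  obtain \<delta> where \<delta>: "0 < \<delta>" "\<And>a b. a \<in> A \<Longrightarrow> b \<in> A \<Longrightarrow> a \<noteq> b \<Longrightarrow> 2 * \<delta> \<le> \<bar>a - b\<bar>"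
  proof -
    let ?D = "insert 1 ((\<lambda>(a,b). \<bar>a - b\<bar>) ` {p \<in> A \<times> A. fst p \<noteq> snd p})"
    have fin: "finite ?D" using A by simp
    have "0 < Min ?D" using fin by (subst Min_gr_iff) auto
    moreover have "Min ?D \<le> \<bar>a - b\<bar>" if "a \<in> A" "b \<in> A" "a \<noteq> b" for a b
      using that by (intro Min_le fin) force
    ultimately show thesis by (intro that[of "Min ?D / 2"]) auto
  qed
  obtain R where R: "0 \<le> R" "\<And>a. a \<in> A \<Longrightarrow> \<bar>a\<bar> \<le> R"
    using finite_real_set_bound[OF A] by blast
  \<comment> \<open>\<kappa> combines two lower bounds for |x - b|: the separation \<delta> near the
    branch points and |x| - R far away from them.\<close>
  define \<kappa> where "\<kappa> = 1 / ((1 + R) / \<delta> + 1)"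
  have \<kappa>: "0 < \<kappa>" unfolding \<kappa>_def using \<delta> R by (simp add: add_pos_nonneg add_nonneg_pos)
  define m where "m = card A - 1"
  have m: "2 * (d + 1) \<le> m" using card by (simp add: m_def)
  define C where "C = 1 / sqrt \<kappa> ^ m"
  have C: "0 < C" unfolding C_def using \<kappa> by simp
  show thesis
  proof (rule that[OF C])
    fix x :: real
    define t where "t = 1 + \<bar>x\<bar>"
    have t: "1 \<le> t" by (simp add: t_def)
    obtain a where a: "a \<in> A" "\<And>b. b \<in> A \<Longrightarrow> \<bar>x - a\<bar> \<le> \<bar>x - b\<bar>"
      using ex_min_if_finite[of "(\<lambda>a. \<bar>x - a\<bar>) ` A"] A A0 by (auto simp: not_less)
    have far: "\<kappa> * t \<le> \<bar>x - b\<bar>" if "b \<in> A - {a}" for b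
    proof -
      have "2 * \<delta> \<le> \<bar>a - b\<bar>" using that a \<delta> by auto
      then have d: "\<delta> \<le> \<bar>x - b\<bar>" using a(2)[of b] that by auto
      have "t \<le> 1 + R + \<bar>x - b\<bar>" using R(2)[of b] that unfolding t_def by auto
      moreover have "(1 + R) / \<delta> * \<delta> \<le> (1 + R) / \<delta> * \<bar>x - b\<bar>"
        using \<delta> R by (intro mult_left_mono d divide_nonneg_nonneg) auto
      then have "1 + R \<le> (1 + R) / \<delta> * \<bar>x - b\<bar>" using \<delta> by simp
      ultimately have "t \<le> ((1 + R) / \<delta> + 1) * \<bar>x - b\<bar>"
        by (simp only: distrib_right mult_1; linarith)
      moreover have "0 < (1 + R) / \<delta> + 1" using \<delta> R by (simp add: add_nonneg_pos)
      ultimately show ?thesis unfolding \<kappa>_def by (simp add: field_simps)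
    qed
    have "(sqrt \<kappa> * sqrt t) ^ m = (\<Prod>b\<in>A - {a}. sqrt (\<kappa> * t))"
      using A a by (simp add: m_def real_sqrt_mult)
    also have "\<dots> \<le> (\<Prod>b\<in>A - {a}. sqrt \<bar>x - b\<bar>)"
      using far t \<kappa> by (intro prod_mono conjI) auto
    finally have p: "sqrt \<kappa> ^ m * sqrt t ^ m \<le> (\<Prod>b\<in>A - {a}. sqrt \<bar>x - b\<bar>)"
      by (simp add: power_mult_distrib)
    have "t ^ d * t = sqrt t ^ (2 * (d + 1))" using t by (simp add: power_mult)
    also have "\<dots> \<le> sqrt t ^ m" using t m by (intro power_increasing) auto
    finally have q: "t ^ d * t \<le> sqrt t ^ m" .
    have k: "0 < sqrt \<kappa> ^ m" using \<kappa> by simp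
    have td: "0 < t ^ d" using t by simp
    have "sqrt \<kappa> ^ m * (t ^ d * t) \<le> sqrt \<kappa> ^ m * sqrt t ^ m"
      using k by (intro mult_left_mono q) simp
    with p have le: "sqrt \<kappa> ^ m * (t ^ d * t) \<le> (\<Prod>b\<in>A - {a}. sqrt \<bar>x - b\<bar>)" by linarith
    have pos: "0 < sqrt \<kappa> ^ m * (t ^ d * t)" using t by (intro mult_pos_pos k td) simp
    have "t ^ d / (\<Prod>b\<in>A - {a}. sqrt \<bar>x - b\<bar>) \<le> t ^ d / (sqrt \<kappa> ^ m * (t ^ d * t))"
      by (rule divide_left_mono[OF le less_imp_le[OF td] mult_pos_pos[OF order_less_le_trans[OF pos le] pos]])
    also have "\<dots> = C / t" using td k by (simp add: C_def)
    finally have "t ^ d / (\<Prod>b\<in>A - {a}. sqrt \<bar>x - b\<bar>) \<le> C / t" .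
    then have "1 / sqrt \<bar>x - a\<bar> * (t ^ d / (\<Prod>b\<in>A - {a}. sqrt \<bar>x - b\<bar>)) \<le> 1 / sqrt \<bar>x - a\<bar> * (C / t)"
      by (intro mult_left_mono) auto
    also have "\<dots> = C * (1 / (sqrt \<bar>x - a\<bar> * t))" by simp
    also have "\<dots> \<le> C * (\<Sum>a\<in>A. 1 / (sqrt \<bar>x - a\<bar> * t))"
      using C A a t by (intro mult_left_mono member_le_sum) auto
    finally show "(1 + \<bar>x\<bar>) ^ d / (\<Prod>a\<in>A. sqrt \<bar>x - a\<bar>) \<le> C * (\<Sum>a\<in>A. 1 / (sqrt \<bar>x - a\<bar> * (1 + \<bar>x\<bar>)))"
      unfolding t_def[symmetric] prod.remove[OF A a(1)] by simp
  qed
qed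

text \<open>On the real line this is, up to a constant factor, the density of the differential p dx
  / y.\<close>

definition sqrt_quot :: "real set \<Rightarrow> complex poly \<Rightarrow> complex \<Rightarrow> complex" where
  "sqrt_quot A p z = poly p z / sqrt_prod A z"

lemma sqrt_quot_shift_measurable [measurable]:
  "0 \<le> t \<Longrightarrow> (\<lambda>x. sqrt_quot A p (of_real x + \<i> * of_real t)) \<in> borel_measurable borel"
proof -
  assume t: "0 \<le> t"
  have "(\<lambda>x. poly p (of_real x + \<i> * of_real t)) \<in> borel_measurable borel"
    by (intro borel_measurable_continuous_onI continuous_intros)
  then show ?thesis unfolding sqrt_quot_def using sqrt_prod_shift_measurable[OF t] by measurable
qed

lemma sqrt_quot_of_real_measurable [measurable]: "(\<lambda>x. sqrt_quot A p (of_real x)) \<in> borel_measurable borel"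
  using sqrt_quot_shift_measurable[of 0 A p] by simp

lemma AE_lborel_notin_finite: "finite (A :: real set) \<Longrightarrow> AE x in lborel. x \<notin> A"
  by (rule AE_not_in) (simp add: finite_imp_null_set_lborel)

text \<open>One majorant for all heights t serves the limit t -> 0: moving up only increases the
  distance to the real branch points, and t \<le> 1 controls the numerator.\<close>

lemma sqrt_quot_dominated:
  assumes A: "finite A" and card: "2 * degree p + 3 \<le> card A"
  obtains g where "integrable lborel g"
    "\<And>x t. 0 \<le> t \<Longrightarrow> t \<le> 1 \<Longrightarrow> x \<notin> A \<Longrightarrow> norm (sqrt_quot A p (of_real x + \<i> * of_real t)) \<le> g x"
proof -
  let ?d = "degree p"
  obtain P where P: "0 < P" "\<And>z. norm (poly p z) \<le> P * (1 + norm z) ^ ?d"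
    using poly_norm_bound[OF order_refl[of "degree p"]] by blast
  obtain C where C: "0 < C"
    "\<And>x. (1 + \<bar>x\<bar>) ^ ?d / (\<Prod>a\<in>A. sqrt \<bar>x - a\<bar>) \<le> C * (\<Sum>a\<in>A. 1 / (sqrt \<bar>x - a\<bar> * (1 + \<bar>x\<bar>)))"
    using inverse_sqrt_prod_bound[OF A card] by blast
  let ?g = "\<lambda>x. P * 2 ^ ?d * (C * (\<Sum>a\<in>A. 1 / (sqrt \<bar>x - a\<bar> * (1 + \<bar>x\<bar>))))"
  show thesis
  proof (rule that[of ?g])
    show "integrable lborel ?g"
      by (intro integrable_mult_right Bochner_Integration.integrable_sum integrable_inverse_sqrt_weight)
    fix x t :: real
    assume t: "0 \<le> t" "t \<le> 1" and x: "x \<notin> A"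
    let ?z = "of_real x + \<i> * of_real t :: complex"
    have "norm ?z \<le> \<bar>x\<bar> + t" using t by (intro order_trans[OF norm_triangle_ineq]) (auto simp: norm_mult)
    then have "norm (poly p ?z) \<le> P * (2 * (1 + \<bar>x\<bar>)) ^ ?d"
      using t P(1) by (intro order_trans[OF P(2)] mult_left_mono power_mono) auto
    moreover have "(\<Prod>a\<in>A. sqrt \<bar>x - a\<bar>) \<le> norm (sqrt_prod A ?z)"
    proof -
      have "\<bar>x - a\<bar> \<le> norm (?z - of_real a)" for a
        using abs_Re_le_cmod[of "?z - of_real a"] by simp
      then show ?thesis unfolding norm_sqrt_prod by (intro prod_mono) auto
    qed
    moreover have "0 < (\<Prod>a\<in>A. sqrt \<bar>x - a\<bar>)" using x by (intro prod_pos) auto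
    ultimately have "norm (sqrt_quot A p ?z) \<le> P * (2 * (1 + \<bar>x\<bar>)) ^ ?d / (\<Prod>a\<in>A. sqrt \<bar>x - a\<bar>)"
      unfolding sqrt_quot_def norm_divide using P(1) by (intro frac_le) auto
    also have "\<dots> = P * 2 ^ ?d * ((1 + \<bar>x\<bar>) ^ ?d / (\<Prod>a\<in>A. sqrt \<bar>x - a\<bar>))"
      by (simp add: power_mult_distrib del: distrib_left_numeral)
    also have "\<dots> \<le> ?g x" using P(1) by (intro mult_left_mono C(2)) auto
    finally show "norm (sqrt_quot A p ?z) \<le> ?g x" .
  qed
qed

lemma sqrt_quot_shift_integrable:
  assumes "finite A" "2 * degree p + 3 \<le> card A" "0 \<le> t" "t \<le> 1"
  shows "integrable lborel (\<lambda>x. sqrt_quot A p (of_real x + \<i> * of_real t))"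
proof -
  obtain g where g: "integrable lborel g"
    "\<And>x t. 0 \<le> t \<Longrightarrow> t \<le> 1 \<Longrightarrow> x \<notin> A \<Longrightarrow> norm (sqrt_quot A p (of_real x + \<i> * of_real t)) \<le> g x"
    using sqrt_quot_dominated[OF assms(1,2)] by blast
  show ?thesis
  proof (rule Bochner_Integration.integrable_bound[OF g(1)])
    show "(\<lambda>x. sqrt_quot A p (of_real x + \<i> * of_real t)) \<in> borel_measurable lborel"
      using sqrt_quot_shift_measurable[OF assms(3)] by simp
    show "AE x in lborel. norm (sqrt_quot A p (of_real x + \<i> * of_real t)) \<le> norm (g x)"
      using AE_lborel_notin_finite[OF assms(1)]
      by eventually_elim (use g(2) assms in force)
  qed
qed

lemma sqrt_quot_integrable:
  assumes "finite A" "2 * degree p + 3 \<le> card A"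
  shows "integrable lborel (\<lambda>x. sqrt_quot A p (of_real x))"
  using sqrt_quot_shift_integrable[OF assms order_refl zero_le_one] unfolding of_real_0 mult_zero_right add_0_right .

text \<open>The exponent -3/2 beats the linear growth of the length of a large contour.\<close>

lemma sqrt_quot_decay:
  assumes A: "finite A" and card: "2 * degree p + 3 \<le> card A" and t: "0 \<le> t" "t \<le> 1"
  obtains C R0 where "0 < C" "2 \<le> R0"
    "\<And>z. R0 \<le> norm z \<Longrightarrow> norm (sqrt_quot A p (z + \<i> * of_real t)) \<le> C / sqrt (norm z) ^ 3"
proof -
  let ?d = "degree p"
  obtain P where P: "0 < P" "\<And>z. norm (poly p z) \<le> P * (1 + norm z) ^ ?d"
    using poly_norm_bound[OF order_refl[of "degree p"]] by blast
  obtain R where R: "0 \<le> R" "\<And>a. a \<in> A \<Longrightarrow> \<bar>a\<bar> \<le> R"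
    using finite_real_set_bound[OF A] by blast
  define m where "m = card A"
  define C where "C = P * 2 ^ ?d * sqrt 2 ^ m"
  show thesis
  proof (rule that[of C "2 * (1 + R)"])
    show "0 < C" using P(1) by (simp add: C_def)
    show "2 \<le> 2 * (1 + R)" using R by simp
    fix z :: complex assume z: "2 * (1 + R) \<le> norm z"
    let ?z = "z + \<i> * of_real t"
    have z2: "2 \<le> norm z" using z R by simp
    have n: "norm (\<i> * of_real t :: complex) \<le> 1" using t by (simp add: norm_mult)
    have "1 + norm ?z \<le> 2 * norm z"
      using norm_triangle_ineq[of z "\<i> * of_real t"] n z2 by linarith
    then have 1: "norm (poly p ?z) \<le> P * (2 * norm z) ^ ?d"
      using P(1) by (intro order_trans[OF P(2)] mult_left_mono power_mono) auto
    have "norm z / 2 \<le> norm (?z - of_real a)" if "a \<in> A" for a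
    proof -
      have "norm z \<le> norm (?z - of_real a) + norm (\<i> * of_real t :: complex) + norm (of_real a :: complex)"
        using norm_triangle_ineq[of "?z - of_real a" "of_real a - \<i> * of_real t"]
          norm_triangle_ineq4[of "of_real a" "\<i> * of_real t :: complex"] by simp
      then show ?thesis using n R(2)[OF that] z by simp
    qed
    then have "(\<Prod>a\<in>A. sqrt (norm z / 2)) \<le> norm (sqrt_prod A ?z)"
      unfolding norm_sqrt_prod by (intro prod_mono) auto
    then have 2: "(sqrt (norm z) / sqrt 2) ^ m \<le> norm (sqrt_prod A ?z)"
      by (simp add: m_def real_sqrt_divide)
    let ?s = "sqrt (norm z)"
    have s: "1 \<le> ?s" using z2 by simp
    have "?s ^ (2 * ?d) * ?s ^ 3 \<le> ?s ^ m"
      unfolding power_add[symmetric] using s card by (intro power_increasing) (auto simp: m_def)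
    then have 3: "norm z ^ ?d * ?s ^ 3 \<le> ?s ^ m" by (simp add: power_mult)
    have s0: "0 < (?s / sqrt 2) ^ m"
      by (intro zero_less_power divide_pos_pos) (use s in linarith, simp)
    have P0: "0 \<le> P * (2 * norm z) ^ ?d" using P(1) by simp
    have "norm (sqrt_quot A p ?z) \<le> P * (2 * norm z) ^ ?d / (?s / sqrt 2) ^ m"
      unfolding sqrt_quot_def norm_divide by (rule frac_le[OF P0 1 s0 2])
    also have "\<dots> = C * (norm z ^ ?d / ?s ^ m)"
      by (simp add: C_def power_mult_distrib power_divide)
    also have "\<dots> \<le> C * (1 / ?s ^ 3)"
    proof (rule mult_left_mono)
      have "0 < ?s ^ m" "0 < ?s ^ 3" using s by (auto intro!: zero_less_power)
      then show "norm z ^ ?d / ?s ^ m \<le> 1 / ?s ^ 3"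
        using 3 by (simp only: pos_divide_le_eq times_divide_eq_left mult_1 pos_le_divide_eq)
      show "0 \<le> C" using P(1) by (simp add: C_def)
    qed
    finally show "norm (sqrt_quot A p ?z) \<le> C / ?s ^ 3" by simp
  qed
qed

section \<open>Cauchy's theorem in the upper half plane\<close>

lemma sqrt_quot_shift_holomorphic:
  assumes "finite A" "0 < t"
  shows "(\<lambda>z. sqrt_quot A p (z + \<i> * of_real t)) holomorphic_on {z. - t < Im z}"
proof -
  have "(sqrt_prod A \<circ> (\<lambda>z. z + \<i> * of_real t)) holomorphic_on {z. - t < Im z}"
  proof (rule holomorphic_on_compose_gen[OF _ holomorphic_on_sqrt_prod])
    show "(\<lambda>z. z + \<i> * of_real t) holomorphic_on {z. - t < Im z}" by (intro holomorphic_intros)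
  qed auto
  then have "(\<lambda>z. sqrt_prod A (z + \<i> * of_real t)) holomorphic_on {z. - t < Im z}" by (simp add: o_def)
  moreover have "sqrt_prod A (z + \<i> * of_real t) \<noteq> 0" if "- t < Im z" for z
  proof
    assume "sqrt_prod A (z + \<i> * of_real t) = 0"
    then obtain x where "z + \<i> * of_real t = of_real x" unfolding sqrt_prod_eq_0_iff[OF assms(1)] by auto
    then have "Im (z + \<i> * of_real t) = Im (of_real x)" by (simp only:)
    then show False using that by simp
  qed
  ultimately show ?thesis
    unfolding sqrt_quot_def by (intro holomorphic_intros) auto
qed

text \<open>At height t > 0 the integrand is analytic in a neighbourhood of the closed upper half
  plane. Cauchy's theorem is applied to the triangle with vertices -R, R and i R, whose slanted
  sides contribute O(R^(-1/2)).\<close>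

lemma integral_sqrt_quot_shift_eq_0:
  assumes A: "finite A" and card: "2 * degree p + 3 \<le> card A" and t: "0 < t" "t \<le> 1"
  shows "(\<integral>x. sqrt_quot A p (of_real x + \<i> * of_real t) \<partial>lborel) = 0"
proof -
  let ?F = "\<lambda>z. sqrt_quot A p (z + \<i> * of_real t)"
  obtain C R0 where C: "0 < C" "2 \<le> R0"
    and decay: "\<And>z. R0 \<le> norm z \<Longrightarrow> norm (?F z) \<le> C / sqrt (norm z) ^ 3"
    using sqrt_quot_decay[OF A card, of t] t by (metis less_imp_le)
  have int: "integrable lborel (\<lambda>x. ?F (of_real x))"
    using sqrt_quot_shift_integrable[OF A card, of t] t by simp
  have hol: "?F holomorphic_on {z. - t < Im z}" by (rule sqrt_quot_shift_holomorphic[OF A t(1)])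
  have bound: "norm (integral {- R..R} (\<lambda>x. ?F (of_real x))) \<le> 8 * C * (2 * R) / sqrt R ^ 3"
    if R: "2 * R0 \<le> R" for R
  proof -
    have R1: "0 < R" using R C by simp
    let ?a = "of_real (- R) :: complex" and ?b = "of_real R :: complex" and ?c = "\<i> * of_real R :: complex"
    have conv: "convex {z. - t < Im z}" by (rule convex_halfspace_Im_gt)
    have sub: "convex hull {?a, ?b, ?c} \<subseteq> {z. - t < Im z}"
      using R1 t by (intro hull_minimal conv) auto
    have seg: "closed_segment u v \<subseteq> {z. - t < Im z}" if "u \<in> {?a, ?b, ?c}" "v \<in> {?a, ?b, ?c}" for u v
      using that R1 t by (intro closed_segment_subset conv) auto
    have ci: "?F contour_integrable_on (linepath u v)" if "u \<in> {?a, ?b, ?c}" "v \<in> {?a, ?b, ?c}" for u v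
      by (rule contour_integrable_continuous_linepath)
        (rule continuous_on_subset[OF holomorphic_on_imp_continuous_on[OF hol] seg[OF that]])
    have "(?F has_contour_integral 0) (linepath ?a ?b +++ linepath ?b ?c +++ linepath ?c ?a)"
      by (rule Cauchy_theorem_triangle[OF holomorphic_on_subset[OF hol sub]])
    moreover have "(?F has_contour_integral (contour_integral (linepath ?a ?b) ?F +
        (contour_integral (linepath ?b ?c) ?F + contour_integral (linepath ?c ?a) ?F)))
      (linepath ?a ?b +++ linepath ?b ?c +++ linepath ?c ?a)"
      by (intro has_contour_integral_join has_contour_integral_integral ci valid_path_join) auto
    ultimately have sum0: "contour_integral (linepath ?a ?b) ?F +
        (contour_integral (linepath ?b ?c) ?F + contour_integral (linepath ?c ?a) ?F) = 0"
      by (metis has_contour_integral_unique)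
    \<comment> \<open>On the slanted sides |Re z| + |Im z| = R, so one of the two parts is at least
      R / 2; this is why R has to exceed 2 R0.\<close>
    have far: "R / 2 \<le> norm z" if "z \<in> closed_segment ?b ?c \<or> z \<in> closed_segment ?c ?a" for z
    proof -
      have "R \<le> \<bar>Re z\<bar> + \<bar>Im z\<bar>"
        using that
      proof
        assume "z \<in> closed_segment ?b ?c"
        then obtain u where u: "0 \<le> u" "u \<le> 1" "z = (1 - u) *\<^sub>R ?b + u *\<^sub>R ?c"
          unfolding in_segment by auto
        then have "Re z = (1 - u) * R" "Im z = u * R" by auto
        then have "Re z + Im z = R" by (simp add: algebra_simps)
        then show ?thesis by linarith
      next
        assume "z \<in> closed_segment ?c ?a"
        then obtain u where u: "0 \<le> u" "u \<le> 1" "z = (1 - u) *\<^sub>R ?c + u *\<^sub>R ?a"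
          unfolding in_segment by auto
        then have "Re z = - (u * R)" "Im z = (1 - u) * R" by auto
        then have "Im z - Re z = R" by (simp add: algebra_simps)
        then show ?thesis by linarith
      qed
      then show ?thesis using abs_Re_le_cmod[of z] abs_Im_le_cmod[of z] by linarith
    qed
    have le: "norm (?F z) \<le> 4 * C / sqrt R ^ 3" if "z \<in> closed_segment ?b ?c \<or> z \<in> closed_segment ?c ?a" for z
    proof -
      have z: "R / 2 \<le> norm z" by (rule far[OF that])
      have "norm (?F z) \<le> C / sqrt (norm z) ^ 3" by (rule decay) (use z R in linarith)
      also have "\<dots> \<le> C / sqrt (R / 2) ^ 3"
        using z R1 C by (intro divide_left_mono power_mono mult_pos_pos) auto
      also have "\<dots> = sqrt 2 ^ 3 * C / sqrt R ^ 3" by (simp add: real_sqrt_divide power_divide)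
      also have "sqrt 2 ^ 3 \<le> (4::real)"
      proof -
        have "sqrt 2 ^ 3 = 2 * sqrt (2::real)" by (simp add: power3_eq_cube)
        also have "\<dots> \<le> 2 * 2" using sqrt2_less_2 by simp
        finally show ?thesis by simp
      qed
      finally show ?thesis using R1 C by (simp add: divide_right_mono mult_right_mono)
    qed
    have len: "norm (?c - ?b) \<le> 2 * R" "norm (?a - ?c) \<le> 2 * R"
      using R1 norm_triangle_ineq4[of ?c ?b] norm_triangle_ineq4[of ?a ?c] by (simp_all add: norm_mult)
    have B0: "0 \<le> 4 * C / sqrt R ^ 3" using C R1 by simp
    have "norm (contour_integral (linepath ?b ?c) ?F) \<le> 4 * C / sqrt R ^ 3 * norm (?c - ?b)"
      by (rule has_contour_integral_bound_linepath[OF has_contour_integral_integral[OF ci] B0]) (auto simp: le)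
    also have "\<dots> \<le> 4 * C / sqrt R ^ 3 * (2 * R)" by (intro mult_left_mono len B0)
    finally have n1: "norm (contour_integral (linepath ?b ?c) ?F) \<le> 4 * C / sqrt R ^ 3 * (2 * R)" .
    have "norm (contour_integral (linepath ?c ?a) ?F) \<le> 4 * C / sqrt R ^ 3 * norm (?a - ?c)"
      by (rule has_contour_integral_bound_linepath[OF has_contour_integral_integral[OF ci] B0]) (auto simp: le)
    also have "\<dots> \<le> 4 * C / sqrt R ^ 3 * (2 * R)" by (intro mult_left_mono len B0)
    finally have n2: "norm (contour_integral (linepath ?c ?a) ?F) \<le> 4 * C / sqrt R ^ 3 * (2 * R)" .
    have "contour_integral (linepath ?a ?b) ?F = integral {Re ?a..Re ?b} (\<lambda>x. ?F (of_real x))"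
      by (rule contour_integral_linepath_Reals_eq) (use R1 in auto)
    then have "integral {- R..R} (\<lambda>x. ?F (of_real x)) =
        - (contour_integral (linepath ?b ?c) ?F + contour_integral (linepath ?c ?a) ?F)"
      using sum0 unfolding eq_neg_iff_add_eq_0 by simp
    then have "norm (integral {- R..R} (\<lambda>x. ?F (of_real x))) \<le>
        norm (contour_integral (linepath ?b ?c) ?F) + norm (contour_integral (linepath ?c ?a) ?F)"
      by (simp add: norm_triangle_ineq del: minus_add_distrib)
    also have "\<dots> \<le> 4 * C / sqrt R ^ 3 * (2 * R) + 4 * C / sqrt R ^ 3 * (2 * R)" by (intro add_mono n1 n2)
    finally show ?thesis by simp
  qed
  have lim1: "(\<lambda>n. LINT x:{- real n..real n}|lborel. ?F (of_real x)) \<longlonglongrightarrow> (\<integral>x. ?F (of_real x) \<partial>lborel)"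
    unfolding set_lebesgue_integral_def
  proof (rule integral_dominated_convergence[where w = "\<lambda>x. norm (?F (of_real x))"])
    show "AE x in lborel. (\<lambda>n. indicat_real {- real n..real n} x *\<^sub>R ?F (of_real x)) \<longlonglongrightarrow> ?F (of_real x)"
    proof (rule AE_I2)
      fix x :: real
      obtain N where "\<bar>x\<bar> \<le> real N" using real_arch_simple by blast
      then have "\<forall>\<^sub>F n in sequentially. indicat_real {- real n..real n} x *\<^sub>R ?F (of_real x) = ?F (of_real x)"
        unfolding eventually_sequentially by (intro exI[of _ N]) (auto simp: indicator_def)
      then show "(\<lambda>n. indicat_real {- real n..real n} x *\<^sub>R ?F (of_real x)) \<longlonglongrightarrow> ?F (of_real x)"
        by (rule tendsto_eventually)
    qed
    show "integrable lborel (\<lambda>x. norm (?F (of_real x)))" using int by (rule integrable_norm)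
    show "(\<lambda>x. ?F (of_real x)) \<in> borel_measurable lborel" using int by auto
    show "(\<lambda>x. indicat_real {- real n..real n} x *\<^sub>R ?F (of_real x)) \<in> borel_measurable lborel" for n
      using borel_measurable_integrable[OF int] by measurable
  qed (auto simp: indicator_def)
  have eq: "(LINT x:{- real n..real n}|lborel. ?F (of_real x)) = integral {- real n..real n} (\<lambda>x. ?F (of_real x))" for n
    using int by (intro set_borel_integral_eq_integral integrable_mult_indicator
        [of _ lborel, folded set_integrable_def]) auto
  have lim0: "(\<lambda>n. LINT x:{- real n..real n}|lborel. ?F (of_real x)) \<longlonglongrightarrow> 0"
  proof (rule Lim_null_comparison)
    show "\<forall>\<^sub>F n in sequentially. norm (LINT x:{- real n..real n}|lborel. ?F (of_real x)) \<le> 8 * C * (2 * real n) / sqrt (real n) ^ 3"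
      unfolding eq using eventually_ge_at_top[of "nat \<lceil>2 * R0\<rceil>"]
      by eventually_elim (rule bound, linarith)
    show "(\<lambda>n. 8 * C * (2 * real n) / sqrt (real n) ^ 3) \<longlonglongrightarrow> 0"
      by real_asymp
  qed
  show ?thesis by (rule LIMSEQ_unique[OF lim1 lim0])
qed

text \<open>The branch points lie on the line itself, so the line is approached from above by
  dominated convergence.\<close>

lemma integral_sqrt_quot_eq_0:
  assumes A: "finite A" and card: "2 * degree p + 3 \<le> card A"
  shows "(\<integral>x. sqrt_quot A p (of_real x) \<partial>lborel) = 0"
proof -
  obtain g where g: "integrable lborel g"
    "\<And>x t. 0 \<le> t \<Longrightarrow> t \<le> 1 \<Longrightarrow> x \<notin> A \<Longrightarrow> norm (sqrt_quot A p (of_real x + \<i> * of_real t)) \<le> g x"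
    using sqrt_quot_dominated[OF A card] by blast
  let ?t = "\<lambda>n. 1 / real (Suc n)"
  have "(\<lambda>n. \<integral>x. sqrt_quot A p (of_real x + \<i> * of_real (?t n)) \<partial>lborel) \<longlonglongrightarrow> (\<integral>x. sqrt_quot A p (of_real x) \<partial>lborel)"
  proof (rule integral_dominated_convergence[OF _ _ g(1)])
    show "(\<lambda>x. sqrt_quot A p (of_real x)) \<in> borel_measurable lborel" by simp
    show "(\<lambda>x. sqrt_quot A p (of_real x + \<i> * of_real (?t n))) \<in> borel_measurable lborel" for n
      using sqrt_quot_shift_measurable[of "?t n"] by simp
    show "AE x in lborel. norm (sqrt_quot A p (of_real x + \<i> * of_real (?t n))) \<le> g x" for n
      using AE_lborel_notin_finite[OF A] by eventually_elim (rule g(2), auto)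
    show "AE x in lborel. (\<lambda>n. sqrt_quot A p (of_real x + \<i> * of_real (?t n))) \<longlonglongrightarrow> sqrt_quot A p (of_real x)"
      using AE_lborel_notin_finite[OF A]
    proof eventually_elim
      case (elim x)
      have lim: "(\<lambda>n. of_real x + \<i> * of_real (?t n)) \<longlonglongrightarrow> complex_of_real x + \<i> * of_real 0"
      proof -
        have "?t \<longlonglongrightarrow> 0" by real_asymp
        then show ?thesis by (rule tendsto_add[OF tendsto_const tendsto_mult[OF tendsto_const tendsto_of_real]])
      qed
      have l1: "(\<lambda>n. sqrt_prod A (of_real x + \<i> * of_real (?t n))) \<longlonglongrightarrow> sqrt_prod A (of_real x + \<i> * of_real 0)"
        by (rule continuous_on_tendsto_compose[OF continuous_on_sqrt_prod lim]) (auto intro!: always_eventually)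
      have l2: "(\<lambda>n. poly p (of_real x + \<i> * of_real (?t n))) \<longlonglongrightarrow> poly p (of_real x + \<i> * of_real 0)"
        by (rule isCont_tendsto_compose[OF _ lim]) simp
      have nz: "sqrt_prod A (of_real x + \<i> * of_real 0) \<noteq> 0"
        using elim A by (auto simp: sqrt_prod_eq_0_iff)
      have "(\<lambda>n. sqrt_quot A p (of_real x + \<i> * of_real (?t n))) \<longlonglongrightarrow> sqrt_quot A p (of_real x + \<i> * of_real 0)"
        unfolding sqrt_quot_def by (rule tendsto_divide[OF l2 l1 nz])
      then show ?case by simp
    qed
  qed
  moreover have "(\<integral>x. sqrt_quot A p (of_real x + \<i> * of_real (?t n)) \<partial>lborel) = 0" for n
    by (rule integral_sqrt_quot_shift_eq_0[OF A card]) auto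
  ultimately show ?thesis by (simp add: LIMSEQ_const_iff)
qed

section \<open>Products of translates and iterated integrals\<close>

abbreviation cpoly :: "real poly \<Rightarrow> complex poly" where
  "cpoly p \<equiv> map_poly of_real p"

lemma poly_cpoly: "poly (cpoly p) (of_real x) = of_real (poly p x)"
  by (induction p) (auto simp: map_poly_pCons)

lemma degree_cpoly_le: "degree (cpoly p) \<le> degree p"
  by (rule map_poly_degree_leq)

lemma sqrt_prod_translate: "sqrt_prod ((\<lambda>a. a + s) ` A) z = sqrt_prod A (z - of_real s)"
proof -
  have "sqrt_prod ((\<lambda>a. a + s) ` A) z = (\<Prod>a\<in>A. csqrt (z - of_real (a + s)))"
    unfolding sqrt_prod_def by (subst prod.reindex) (auto simp: inj_on_def)
  then show ?thesis unfolding sqrt_prod_def by (simp add: algebra_simps)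
qed

text \<open>The product is again a polynomial over a product of roots, with branch points A and A +
  s: their number doubles while the degrees only add. For the excluded s two of the roots would
  merge into a non-integrable pole.\<close>

lemma integral_sqrt_quot_mult_translate_eq_0:
  assumes A: "finite A" and p: "2 * degree p + 3 \<le> card A" and q: "2 * degree q + 3 \<le> card A"
    and s: "s \<notin> (\<lambda>(a,b). a - b) ` (A \<times> A)"
  shows "(\<integral>x. sqrt_quot A p (of_real (x - s)) * sqrt_quot A q (of_real x) \<partial>lborel) = 0"
proof -
  let ?B = "(\<lambda>a. a + s) ` A"
  let ?r = "pcompose p [:- of_real s, 1:] * q"
  have disj: "A \<inter> ?B = {}"
  proof (rule equals0I)
    fix x assume "x \<in> A \<inter> ?B"
    then obtain b where "x \<in> A" "b \<in> A" "x = b + s" by auto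
    then have "s = x - b" by simp
    then show False using s \<open>x \<in> A\<close> \<open>b \<in> A\<close> by auto
  qed
  have sqrt_prod: "sqrt_prod (A \<union> ?B) z = sqrt_prod A z * sqrt_prod A (z - of_real s)" for z
    unfolding sqrt_prod_translate[symmetric] by (simp add: sqrt_prod_def prod.union_disjoint[OF A _ disj] A)
  have eq: "sqrt_quot A p (of_real (x - s)) * sqrt_quot A q (of_real x) = sqrt_quot (A \<union> ?B) ?r (of_real x)" for x
    by (simp add: sqrt_quot_def sqrt_prod poly_pcompose)
  have "card (A \<union> ?B) = card A + card A"
    using card_Un_disjoint[OF A _ disj] A by (simp add: card_image inj_on_def)
  moreover have "degree ?r \<le> degree p + degree q"
    by (rule order_trans[OF degree_mult_le]) (use degree_pcompose_le[of p "[:- of_real s, 1:]"] in simp)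
  ultimately have "2 * degree ?r + 3 \<le> card (A \<union> ?B)" using p q by linarith
  then show ?thesis unfolding eq using A by (intro integral_sqrt_quot_eq_0) auto
qed

definition iterated_integral :: "(real \<Rightarrow> complex) \<Rightarrow> (real \<Rightarrow> complex) \<Rightarrow> complex" where
  "iterated_integral f k = (\<integral>x. (\<integral>t. indicator {..<x} t *\<^sub>R f t \<partial>lborel) * k x \<partial>lborel)"

lemma inner_measurable [measurable]:
  fixes f :: "real \<Rightarrow> complex"
  assumes [measurable]: "f \<in> borel_measurable borel"
  shows "(\<lambda>x. \<integral>t. indicator {..<x} t *\<^sub>R f t \<partial>lborel) \<in> borel_measurable borel"
proof -
  have "(\<lambda>x. \<integral>t. (if t < x then f t else 0) \<partial>lborel) \<in> borel_measurable borel"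
    by measurable
  moreover have "(\<lambda>x. \<integral>t. indicator {..<x} t *\<^sub>R f t \<partial>lborel) = (\<lambda>x. \<integral>t. (if t < x then f t else 0) \<partial>lborel)"
    by (intro ext Bochner_Integration.integral_cong) (auto simp: indicator_def)
  ultimately show ?thesis by simp
qed

lemma integrable_iterated:
  fixes f k :: "real \<Rightarrow> complex"
  assumes f: "integrable lborel f" and k: "integrable lborel k"
  shows "integrable lborel (\<lambda>x. (\<integral>t. indicator {..<x} t *\<^sub>R f t \<partial>lborel) * k x)"
proof (rule Bochner_Integration.integrable_bound)
  have [measurable]: "f \<in> borel_measurable borel" "k \<in> borel_measurable borel" using f k by auto
  show "integrable lborel (\<lambda>x. (\<integral>t. norm (f t) \<partial>lborel) * norm (k x))"
    using k by (intro integrable_mult_right integrable_norm)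
  show "(\<lambda>x. (\<integral>t. indicator {..<x} t *\<^sub>R f t \<partial>lborel) * k x) \<in> borel_measurable lborel"
    by measurable
  show "AE x in lborel. norm ((\<integral>t. indicator {..<x} t *\<^sub>R f t \<partial>lborel) * k x) \<le> norm ((\<integral>t. norm (f t) \<partial>lborel) * norm (k x))"
  proof (rule AE_I2)
    fix x
    have "norm (\<integral>t. indicator {..<x} t *\<^sub>R f t \<partial>lborel) \<le> (\<integral>t. norm (indicator {..<x} t *\<^sub>R f t) \<partial>lborel)"
      by (rule integral_norm_bound)
    also have "\<dots> \<le> (\<integral>t. norm (f t) \<partial>lborel)"
      by (intro integral_mono integrable_norm f integrable_mult_indicator) (auto simp: indicator_def)
    finally show "norm ((\<integral>t. indicator {..<x} t *\<^sub>R f t \<partial>lborel) * k x) \<le> norm ((\<integral>t. norm (f t) \<partial>lborel) * norm (k x))"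
      by (simp add: norm_mult mult_right_mono abs_mult)
  qed
qed

text \<open>Substituting \<open>t = x - s\<close> turns the iterated integral into integrals of the products
  \<open>f (x - s) * k x\<close>, which are again boundary values of functions analytic in the upper half plane.\<close>

lemma iterated_integral_eq_0:
  fixes f k :: "real \<Rightarrow> complex"
  assumes f: "integrable lborel f" and k: "integrable lborel k"
    and z: "AE s in lborel. (\<integral>x. f (x - s) * k x \<partial>lborel) = 0"
  shows "iterated_integral f k = 0"
proof -
  have [measurable]: "f \<in> borel_measurable borel" "k \<in> borel_measurable borel" using f k by auto
  have f': "integrable lborel (\<lambda>s. f (x - s))" for x
    using lborel_integrable_real_affine[OF f, of "-1" x] by simp
  have nf: "(\<integral>s. norm (f (x - s)) \<partial>lborel) = (\<integral>s. norm (f s) \<partial>lborel)" for x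
    using lborel_integral_real_affine[of "-1" "\<lambda>s. norm (f s)" x] by simp
  \<comment> \<open>As for convolutions: the integral of |f (x - s)| over s does not depend on
    x.\<close>
  have i1: "integrable (lborel \<Otimes>\<^sub>M lborel) (\<lambda>p. f (fst p - snd p) * k (fst p))"
  proof (rule lborel_pair.Fubini_integrable)
    show "(\<lambda>p. f (fst p - snd p) * k (fst p)) \<in> borel_measurable (lborel \<Otimes>\<^sub>M lborel)" by measurable
    show "integrable lborel (\<lambda>x. \<integral>y. norm (f (fst (x, y) - snd (x, y)) * k (fst (x, y))) \<partial>lborel)"
      using k by (simp add: norm_mult nf)
    show "AE x in lborel. integrable lborel (\<lambda>y. f (fst (x, y) - snd (x, y)) * k (fst (x, y)))"
      using f' by (intro AE_I2) simp
  qed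
  have [measurable]: "(\<lambda>p::real\<times>real. indicator {0<..} (snd p) :: real) \<in> borel_measurable (lborel \<Otimes>\<^sub>M lborel)"
    by measurable
  have i2: "integrable (lborel \<Otimes>\<^sub>M lborel) (\<lambda>(x,s). indicator {0<..} s *\<^sub>R (f (x - s) * k x))"
    by (rule Bochner_Integration.integrable_bound[OF i1])
      (auto simp: case_prod_unfold indicator_def intro!: AE_I2)
  have "iterated_integral f k = (\<integral>x. (\<integral>s. indicator {0<..} s *\<^sub>R (f (x - s) * k x) \<partial>lborel) \<partial>lborel)"
    unfolding iterated_integral_def
  proof (rule Bochner_Integration.integral_cong[OF refl])
    fix x
    have "(\<integral>t. indicator {..<x} t *\<^sub>R f t \<partial>lborel) = (\<integral>s. indicator {..<x} (x - s) *\<^sub>R f (x - s) \<partial>lborel)"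
      using lborel_integral_real_affine[of "-1" "\<lambda>t. indicator {..<x} t *\<^sub>R f t" x] by simp
    also have "\<dots> = (\<integral>s. indicator {0<..} s *\<^sub>R f (x - s) \<partial>lborel)"
      by (intro Bochner_Integration.integral_cong) (auto simp: indicator_def)
    finally show "(\<integral>t. indicator {..<x} t *\<^sub>R f t \<partial>lborel) * k x = (\<integral>s. indicator {0<..} s *\<^sub>R (f (x - s) * k x) \<partial>lborel)"
      by (simp flip: integral_mult_left_zero)
  qed
  also have "\<dots> = (\<integral>s. (\<integral>x. indicator {0<..} s *\<^sub>R (f (x - s) * k x) \<partial>lborel) \<partial>lborel)"
    using lborel_pair.Fubini_integral[OF i2] by simp
  also have "\<dots> = (\<integral>s. 0 \<partial>(lborel :: real measure))"
    by (rule integral_cong_AE) (use z in \<open>auto elim: eventually_mono\<close>)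
  finally show ?thesis by simp
qed

section \<open>Integrals between consecutive branch points\<close>

lemma integral_pos_on_open:
  fixes f :: "real \<Rightarrow> real"
  assumes int: "integrable lborel f" and nn: "\<And>x. 0 \<le> f x"
    and ab: "a < b" and pos: "\<And>x. a < x \<Longrightarrow> x < b \<Longrightarrow> 0 < f x"
  shows "0 < (\<integral>x. f x \<partial>lborel)"
proof -
  have "(\<integral>x. f x \<partial>lborel) \<noteq> 0"
  proof
    assume "(\<integral>x. f x \<partial>lborel) = 0"
    then have "AE x in lborel. f x = 0"
      using integral_nonneg_eq_0_iff_AE[OF int] nn by simp
    then have "AE x in lborel. x \<notin> {a<..<b}"
      by eventually_elim (use pos in force)
    then have "emeasure lborel {a<..<b} = 0"
      by (subst (asm) AE_iff_measurable[where N = "{a<..<b}"]) auto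
    then show False using ab by simp
  qed
  moreover have "0 \<le> (\<integral>x. f x \<partial>lborel)" using nn by simp
  ultimately show ?thesis by simp
qed

locale branch_points =
  fixes e :: "nat \<Rightarrow> real" and N :: nat
  assumes mono: "strict_mono_on {1..N} e" and N1: "1 \<le> N"
begin

definition E :: "real set" where "E = e ` {1..N}"

text \<open>The intervals are numbered so that \<open>I j\<close> has \<open>j\<close> branch points on its left;
  \<open>I 0\<close> and \<open>I N\<close> are unbounded.\<close>

definition I :: "nat \<Rightarrow> real set" where
  "I j = {x. (\<forall>k\<in>{1..j}. e k < x) \<and> (\<forall>k\<in>{j+1..N}. x < e k)}"

definition h :: "real poly \<Rightarrow> real \<Rightarrow> complex" where
  "h p x = sqrt_quot E (cpoly p) (of_real x)"

definition D :: "real \<Rightarrow> real" where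
  "D x = (\<Prod>a\<in>E. sqrt \<bar>x - a\<bar>)"

definition H :: "nat \<Rightarrow> real poly \<Rightarrow> complex" where
  "H j p = (\<integral>x. indicator (I j) x *\<^sub>R h p x \<partial>lborel)"

definition A :: "nat \<Rightarrow> real poly \<Rightarrow> real" where
  "A j p = (\<integral>x. indicator (I j) x * (poly p x / D x) \<partial>lborel)"

text \<open>For N = 2 g + 1 this means degree below g, the condition for p dx / y to be holomorphic
  at infinity too; in this form it is the integrability condition used so far.\<close>

definition low_deg :: "real poly \<Rightarrow> bool" where
  "low_deg p \<longleftrightarrow> 2 * degree p + 3 \<le> N"

lemma e_less_iff: "j \<in> {1..N} \<Longrightarrow> k \<in> {1..N} \<Longrightarrow> e j < e k \<longleftrightarrow> j < k"
  using mono strict_mono_onD linorder_less_linear order_less_asym by (metis order_less_irrefl)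

lemma inj_e: "inj_on e {1..N}"
  using mono by (rule strict_mono_on_imp_inj_on)

lemma finite_E: "finite E" and card_E: "card E = N"
  by (simp add: E_def, simp only: E_def card_image[OF inj_e]) simp

lemma I_disjoint_E: "j \<le> N \<Longrightarrow> x \<in> I j \<Longrightarrow> x \<notin> E"
proof
  assume "j \<le> N" and x: "x \<in> I j" and "x \<in> E"
  then obtain k where "k \<in> {1..N}" "x = e k" by (auto simp: E_def)
  then show False using x by (cases "k \<le> j") (auto simp: I_def)
qed

lemma I_less: "i < j \<Longrightarrow> j \<le> N \<Longrightarrow> x \<in> I i \<Longrightarrow> y \<in> I j \<Longrightarrow> x < y"
proof -
  assume "i < j" "j \<le> N" "x \<in> I i" "y \<in> I j"
  then have "x < e j" "e j < y" by (auto simp: I_def)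
  then show "x < y" by simp
qed

lemma ex_I: "x \<notin> E \<Longrightarrow> \<exists>j\<le>N. x \<in> I j"
proof -
  assume x: "x \<notin> E"
  let ?S = "{k \<in> {1..N}. e k < x}"
  show ?thesis
  proof (cases "?S = {}")
    case True
    then have "x \<in> I 0" using x by (auto simp: I_def E_def) (metis atLeastAtMost_iff image_eqI linorder_neqE_linordered_idom)
    then show ?thesis by auto
  next
    case False
    define j where "j = Max ?S"
    have j: "j \<in> ?S" unfolding j_def using False by (intro Max_in) auto
    have "e k < x" if "k \<in> {1..j}" for k
      using j that e_less_iff[of k j] by (cases "k = j") force+
    moreover have "x < e k" if "k \<in> {j+1..N}" for k
    proof (rule ccontr)
      assume "\<not> x < e k"
      moreover have "x \<noteq> e k" using x that by (auto simp: E_def)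
      ultimately have "k \<in> ?S" using that by auto
      then have "k \<le> j" unfolding j_def by (intro Max_ge) auto
      then show False using that by simp
    qed
    ultimately show ?thesis using j by (intro exI[of _ j]) (auto simp: I_def)
  qed
qed

lemma I_contains_interval: "j \<le> N \<Longrightarrow> \<exists>a b. a < b \<and> {a<..<b} \<subseteq> I j"
proof -
  assume j: "j \<le> N"
  define a where "a = (if j = 0 then e 1 - 1 else e j)"
  define b where "b = (if j = N then e N + 1 else e (j + 1))"
  have le: "e k \<le> e l" if "1 \<le> k" "k \<le> l" "l \<le> N" for k l
    using e_less_iff[of k l] that by (cases "k = l") auto
  have "a < b" using j N1 e_less_iff[of j "j+1"] by (auto simp: a_def b_def)
  moreover have "{a<..<b} \<subseteq> I j"
  proof
    fix x assume x: "x \<in> {a<..<b}"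
    have "e k < x" if "k \<in> {1..j}" for k
      using that x j le[of k j] by (auto simp: a_def split: if_splits)
    moreover have "x < e k" if "k \<in> {j+1..N}" for k
      using that x j le[of "j+1" k] by (auto simp: b_def split: if_splits)
    ultimately show "x \<in> I j" by (auto simp: I_def)
  qed
  ultimately show ?thesis by blast
qed

lemma connected_I: "connected (I j)"
proof -
  have "is_interval (I j)"
    unfolding is_interval_1 I_def by (auto intro: order_less_le_trans order_le_less_trans)
  then show ?thesis by (rule is_interval_connected)
qed

lemma I_measurable [measurable]: "I j \<in> sets borel"
proof -
  have "I j = (\<Inter>k\<in>{1..j}. {e k<..}) \<inter> (\<Inter>k\<in>{j+1..N}. {..<e k})"
    by (auto simp: I_def)
  moreover have "open \<dots>" by (intro open_Int open_INT) auto
  ultimately show ?thesis by simp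
qed

lemma D_pos: "x \<notin> E \<Longrightarrow> 0 < D x"
  unfolding D_def by (intro prod_pos) auto

text \<open>Every branch point to the right of x contributes the root of a negative number, hence a
  factor i. All phases of the periods come from this power.\<close>

lemma sqrt_prod_on_I:
  assumes j: "j \<le> N" and x: "x \<in> I j"
  shows "sqrt_prod E (of_real x) = \<i> ^ (N - j) * of_real (D x)"
proof -
  have "sqrt_prod E (of_real x) = (\<Prod>k\<in>{1..N}. csqrt (of_real (x - e k)))"
    unfolding sqrt_prod_def E_def by (subst prod.reindex[OF inj_e]) simp
  also have "\<dots> = (\<Prod>k\<in>{1..N}. of_real (sqrt \<bar>x - e k\<bar>) * (if k \<in> {j+1..N} then \<i> else 1))"
  proof (rule prod.cong[OF refl])
    fix k assume "k \<in> {1..N}"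
    then show "csqrt (of_real (x - e k)) = of_real (sqrt \<bar>x - e k\<bar>) * (if k \<in> {j+1..N} then \<i> else 1)"
    proof (cases "k \<le> j")
      case True
      then have "e k < x" using x \<open>k \<in> {1..N}\<close> by (auto simp: I_def)
      then show ?thesis using True unfolding csqrt_of_real' by simp
    next
      case False
      then have "x < e k" using x \<open>k \<in> {1..N}\<close> by (auto simp: I_def)
      then show ?thesis using False \<open>k \<in> {1..N}\<close> unfolding csqrt_of_real' by simp
    qed
  qed
  also have "\<dots> = of_real (\<Prod>k\<in>{1..N}. sqrt \<bar>x - e k\<bar>) * (\<Prod>k\<in>{1..N}. if k \<in> {j+1..N} then \<i> else 1)"
    by (simp add: prod.distrib)
  also have "(\<Prod>k\<in>{1..N}. sqrt \<bar>x - e k\<bar>) = D x"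
    unfolding D_def E_def by (subst prod.reindex[OF inj_e]) simp
  also have "(\<Prod>k\<in>{1..N}. if k \<in> {j+1..N} then \<i> else 1) = (\<Prod>k\<in>{j+1..N}. \<i>)"
    by (rule prod.mono_neutral_cong_right) auto
  also have "\<dots> = \<i> ^ (N - j)" by simp
  finally show ?thesis by (simp add: mult.commute)
qed

lemma h_on_I: "j \<le> N \<Longrightarrow> x \<in> I j \<Longrightarrow> h p x = of_real (poly p x / D x) / \<i> ^ (N - j)"
  by (simp add: h_def sqrt_quot_def sqrt_prod_on_I poly_cpoly)

text \<open>Division by 0 has the value 0, which lets the decomposition into open intervals hold at
  every x and not just almost everywhere.\<close>

lemma h_on_E: "x \<in> E \<Longrightarrow> h p x = 0"
  using finite_E by (auto simp: h_def sqrt_quot_def sqrt_prod_eq_0_iff)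

lemma indicator_h: "j \<le> N \<Longrightarrow> indicator (I j) x *\<^sub>R h p x = of_real (indicator (I j) x * (poly p x / D x)) / \<i> ^ (N - j)"
  by (auto simp: indicator_def h_on_I)

lemma h_measurable [measurable]: "h p \<in> borel_measurable borel"
  unfolding h_def by measurable

lemma h_integrable: "low_deg p \<Longrightarrow> integrable lborel (h p)"
  unfolding h_def low_deg_def using degree_cpoly_le[of p]
  by (intro sqrt_quot_integrable finite_E) (simp add: card_E)

lemma indicator_h_integrable: "low_deg p \<Longrightarrow> integrable lborel (\<lambda>x. indicator (I j) x *\<^sub>R h p x)"
  by (intro integrable_mult_indicator h_integrable) auto

lemma h_decompose: "h p x = (\<Sum>j\<le>N. indicator (I j) x *\<^sub>R h p x)"
proof (cases "x \<in> E")
  case True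
  then show ?thesis by (simp add: h_on_E)
next
  case False
  then obtain j where j: "j \<le> N" "x \<in> I j" using ex_I by blast
  have "indicator (I i) x *\<^sub>R h p x = (if i = j then h p x else 0)" if "i \<le> N" for i
    using j that I_less[of i j x x] I_less[of j i x x] by (cases i j rule: linorder_cases) (auto simp: indicator_def)
  then have "(\<Sum>j\<le>N. indicator (I j) x *\<^sub>R h p x) = (\<Sum>i\<le>N. if i = j then h p x else 0)"
    by (intro sum.cong) auto
  then show ?thesis using j by simp
qed

lemma indicator_A_integrable:
  assumes "low_deg p" "j \<le> N"
  shows "integrable lborel (\<lambda>x. indicator (I j) x * (poly p x / D x))"
proof -
  have "integrable lborel (\<lambda>x. Re (\<i> ^ (N - j) * (indicator (I j) x *\<^sub>R h p x)))"
    by (intro integrable_Re integrable_mult_right indicator_h_integrable assms)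
  then show ?thesis unfolding indicator_h[OF assms(2)] by simp
qed

lemma H_eq_A: "j \<le> N \<Longrightarrow> H j p = of_real (A j p) / \<i> ^ (N - j)"
  unfolding H_def A_def indicator_h by (simp del: of_real_mult of_real_divide add: integral_complex_of_real)

lemma sum_H_eq_0: "low_deg p \<Longrightarrow> (\<Sum>j\<le>N. H j p) = 0"
proof -
  assume p: "low_deg p"
  have "(\<Sum>j\<le>N. H j p) = (\<integral>x. (\<Sum>j\<le>N. indicator (I j) x *\<^sub>R h p x) \<partial>lborel)"
    unfolding H_def by (rule Bochner_Integration.integral_sum[symmetric]) (rule indicator_h_integrable[OF p])
  also have "\<dots> = (\<integral>x. h p x \<partial>lborel)" by (simp flip: h_decompose)
  also have "\<dots> = 0"
    unfolding h_def using p degree_cpoly_le[of p]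
    by (intro integral_sqrt_quot_eq_0 finite_E) (simp add: card_E low_deg_def)
  finally show ?thesis .
qed

section \<open>The bilinear relation between integrals over the intervals\<close>

lemma iterated_integral_h_eq_0:
  assumes p: "low_deg p" and q: "low_deg q"
  shows "iterated_integral (h p) (h q) = 0"
proof (rule iterated_integral_eq_0[OF h_integrable[OF p] h_integrable[OF q]])
  have "AE s in lborel. s \<notin> (\<lambda>(a,b). a - b) ` (E \<times> E)"
    by (rule AE_lborel_notin_finite) (simp add: finite_E)
  then show "AE s in lborel. (\<integral>x. h p (x - s) * h q x \<partial>lborel) = 0"
  proof eventually_elim
    case (elim s)
    show ?case
      unfolding h_def using p q degree_cpoly_le[of p] degree_cpoly_le[of q]
      by (intro integral_sqrt_quot_mult_translate_eq_0 finite_E elim) (simp_all add: card_E low_deg_def)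
  qed
qed

lemma iterated_integral_decompose:
  assumes p: "low_deg p" and q: "low_deg q"
  shows "iterated_integral (h p) (h q) =
    (\<Sum>i\<le>N. \<Sum>j\<le>N. iterated_integral (\<lambda>x. indicator (I i) x *\<^sub>R h p x) (\<lambda>x. indicator (I j) x *\<^sub>R h q x))"
proof -
  let ?f = "\<lambda>i x. indicator (I i) x *\<^sub>R h p x" and ?k = "\<lambda>j x. indicator (I j) x *\<^sub>R h q x"
  have f: "integrable lborel (?f i)" and k: "integrable lborel (?k i)" for i
    by (intro indicator_h_integrable p q)+
  have inner: "(\<integral>t. indicator {..<x} t *\<^sub>R h p t \<partial>lborel) = (\<Sum>i\<le>N. \<integral>t. indicator {..<x} t *\<^sub>R ?f i t \<partial>lborel)" for x
  proof -
    have "(\<Sum>i\<le>N. \<integral>t. indicator {..<x} t *\<^sub>R ?f i t \<partial>lborel) = (\<integral>t. (\<Sum>i\<le>N. indicator {..<x} t *\<^sub>R ?f i t) \<partial>lborel)"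
      by (intro Bochner_Integration.integral_sum[symmetric] integrable_mult_indicator f) auto
    also have "\<dots> = (\<integral>t. indicator {..<x} t *\<^sub>R h p t \<partial>lborel)"
      unfolding scaleR_right.sum[symmetric] h_decompose[symmetric] ..
    finally show ?thesis by simp
  qed
  have "iterated_integral (h p) (h q) =
      (\<integral>x. (\<Sum>i\<le>N. \<Sum>j\<le>N. (\<integral>t. indicator {..<x} t *\<^sub>R ?f i t \<partial>lborel) * ?k j x) \<partial>lborel)"
    unfolding iterated_integral_def inner sum_distrib_left[symmetric] sum_distrib_right[symmetric] h_decompose[symmetric] ..
  also have "\<dots> = (\<Sum>i\<le>N. \<Sum>j\<le>N. \<integral>x. (\<integral>t. indicator {..<x} t *\<^sub>R ?f i t \<partial>lborel) * ?k j x \<partial>lborel)"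
    by (subst Bochner_Integration.integral_sum, (intro Bochner_Integration.integrable_sum integrable_iterated f k),
        subst Bochner_Integration.integral_sum, (intro integrable_iterated f k), rule refl)
  finally show ?thesis unfolding iterated_integral_def .
qed

text \<open>Distinct intervals are ordered, so t < x holds always or never, and the integral factors
  or vanishes. On a single interval the two equal phases multiply to 1 or -1, so the contribution is
  real; this term, which is no product of periods, thus disappears from the imaginary part.\<close>

lemma iterated_integral_pieces:
  assumes p: "low_deg p" and q: "low_deg q" and i: "i \<le> N" and j: "j \<le> N"
  shows "Im (iterated_integral (\<lambda>x. indicator (I i) x *\<^sub>R h p x) (\<lambda>x. indicator (I j) x *\<^sub>R h q x))
    = (if i < j then Im (H i p * H j q) else 0)" (is "Im ?T = _")
proof -
  let ?F = "\<lambda>x. (\<integral>t. indicator {..<x} t *\<^sub>R (indicator (I i) t *\<^sub>R h p t) \<partial>lborel)"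
  show ?thesis
  proof (cases i j rule: linorder_cases)
    case less
    have "?F x * (indicator (I j) x *\<^sub>R h q x)
        = H i p * (indicator (I j) x *\<^sub>R h q x)" for x
    proof (cases "x \<in> I j")
      case True
      have "?F x = H i p"
        unfolding H_def using I_less[OF less j _ True]
        by (intro Bochner_Integration.integral_cong) (auto simp: indicator_def)
      then show ?thesis by simp
    qed simp
    then have "?T = (\<integral>x. H i p * (indicator (I j) x *\<^sub>R h q x) \<partial>lborel)"
      unfolding iterated_integral_def by (simp only:)
    also have "\<dots> = H i p * H j q"
      unfolding H_def[of j q] by (rule integral_mult_right_zero)
    finally have "?T = H i p * H j q" .
    then show ?thesis using less by simp
  next
    case greater
    have "?F x * (indicator (I j) x *\<^sub>R h q x) = 0" for x
    proof (cases "x \<in> I j")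
      case True
      have "indicator {..<x} t *\<^sub>R (indicator (I i) t *\<^sub>R h p t) = 0" for t
        using I_less[OF greater i True, of t] by (auto simp: indicator_def)
      then show ?thesis by (simp only: Bochner_Integration.integral_zero mult_zero_left)
    qed simp
    then have "?T = (\<integral>x. 0 \<partial>(lborel :: real measure))"
      unfolding iterated_integral_def by (simp only:)
    then show ?thesis using greater by simp
  next
    case equal
    let ?u = "\<lambda>x. indicator (I j) x * (poly p x / D x)" and ?v = "\<lambda>x. indicator (I j) x * (poly q x / D x)"
    define r where "r = (\<integral>x. (\<integral>t. indicator {..<x} t * ?u t \<partial>lborel) * ?v x \<partial>lborel)"
    have inner: "?F x = of_real (\<integral>t. indicator {..<x} t * ?u t \<partial>lborel) / \<i> ^ (N - j)" for x
    proof -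
      have "indicator {..<x} t *\<^sub>R (indicator (I i) t *\<^sub>R h p t) = of_real (indicator {..<x} t * ?u t) / \<i> ^ (N - j)" for t
      proof -
        have "a *\<^sub>R (of_real u / c) = of_real (a * u) / c" for a u :: real and c :: complex
          by (simp add: scaleR_conv_of_real)
        then show ?thesis unfolding equal indicator_h[OF j] .
      qed
      then have "?F x = (\<integral>t. of_real (indicator {..<x} t * ?u t) / \<i> ^ (N - j) \<partial>lborel)"
        by (simp only:)
      also have "\<dots> = of_real (\<integral>t. indicator {..<x} t * ?u t \<partial>lborel) / \<i> ^ (N - j)"
        unfolding integral_divide_zero integral_complex_of_real ..
      finally show ?thesis .
    qed
    have "?F x * (indicator (I j) x *\<^sub>R h q x)
      = of_real ((\<integral>t. indicator {..<x} t * ?u t \<partial>lborel) * ?v x) / (\<i> ^ (N - j) * \<i> ^ (N - j))" for x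
      unfolding inner indicator_h[OF j] of_real_mult times_divide_times_eq ..
    then have "?T =
        (\<integral>x. of_real ((\<integral>t. indicator {..<x} t * ?u t \<partial>lborel) * ?v x) / (\<i> ^ (N - j) * \<i> ^ (N - j)) \<partial>lborel)"
      unfolding iterated_integral_def by (simp only:)
    also have "\<dots> = of_real r / (\<i> ^ (N - j) * \<i> ^ (N - j))"
      unfolding r_def integral_divide_zero integral_complex_of_real ..
    finally have "?T = of_real r / (\<i> ^ (N - j) * \<i> ^ (N - j))" .
    moreover have "\<i> ^ (N - j) * \<i> ^ (N - j) = of_real ((- 1) ^ (N - j))"
      by (simp flip: power_mult_distrib)
    ultimately show ?thesis using equal by (simp flip: of_real_divide)
  qed
qed

lemma Im_bilinear_relation:
  assumes p: "low_deg p" and q: "low_deg q"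
  shows "(\<Sum>i\<le>N. \<Sum>j\<in>{i<..N}. Im (H i p * H j q)) = 0"
proof -
  have "0 = Im (iterated_integral (h p) (h q))"
    using iterated_integral_h_eq_0[OF p q] by simp
  also have "\<dots> = (\<Sum>i\<le>N. \<Sum>j\<le>N. if i < j then Im (H i p * H j q) else 0)"
    unfolding iterated_integral_decompose[OF p q] Im_sum
    by (intro sum.cong refl iterated_integral_pieces p q) auto
  also have "\<dots> = (\<Sum>i\<le>N. \<Sum>j\<in>{i<..N}. Im (H i p * H j q))"
    by (intro sum.cong refl sum.mono_neutral_cong_right) auto
  finally show ?thesis by simp
qed

end

text \<open>In the expansion of (U i - U l)^2 the pure squares are weighted by row and column sums
  and drop out; only the mixed terms remain. W is the Laplacian of a weighted network.\<close>

lemma laplacian_quadratic_form: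
  fixes W :: "'i \<Rightarrow> 'i \<Rightarrow> real"
  assumes row: "\<And>i. i \<in> S \<Longrightarrow> (\<Sum>l\<in>S. W i l) = 0" and col: "\<And>l. l \<in> S \<Longrightarrow> (\<Sum>i\<in>S. W i l) = 0"
  shows "(\<Sum>i\<in>S. \<Sum>l\<in>S. W i l * U i * U l) = (\<Sum>i\<in>S. \<Sum>l\<in>S. - W i l / 2 * (U i - U l)\<^sup>2)"
proof -
  have "(\<Sum>i\<in>S. \<Sum>l\<in>S. W i l * (U i)\<^sup>2) = (\<Sum>i\<in>S. (\<Sum>l\<in>S. W i l) * (U i)\<^sup>2)"
    by (simp add: sum_distrib_right)
  then have r: "(\<Sum>i\<in>S. \<Sum>l\<in>S. W i l * (U i)\<^sup>2) = 0" using row by simp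
  have "(\<Sum>i\<in>S. \<Sum>l\<in>S. W i l * (U l)\<^sup>2) = (\<Sum>l\<in>S. (\<Sum>i\<in>S. W i l) * (U l)\<^sup>2)"
    by (subst sum.swap) (simp add: sum_distrib_right)
  then have c: "(\<Sum>i\<in>S. \<Sum>l\<in>S. W i l * (U l)\<^sup>2) = 0" using col by simp
  have "- W i l / 2 * (U i - U l)\<^sup>2 = W i l * U i * U l - (W i l * (U i)\<^sup>2) / 2 - (W i l * (U l)\<^sup>2) / 2" for i l
    by (simp add: power2_eq_square algebra_simps)
  then show ?thesis
    by (simp add: sum_subtractf sum_divide_distrib[symmetric] r c)
qed

lemma sum_even_odd:
  fixes f :: "nat \<Rightarrow> 'a::comm_monoid_add"
  shows "(\<Sum>j\<le>2*g+1. f j) = (\<Sum>i\<le>g. f (2*i)) + (\<Sum>k=1..g+1. f (2*k-1))"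
proof (induction g)
  case 0
  have "{1..0+1} = {1::nat}" by auto
  then show ?case by (simp add: numeral_2_eq_2)
next
  case (Suc g)
  have "(\<Sum>j\<le>2 * Suc g + 1. f j) = (\<Sum>j\<le>2*g+1. f j) + f (2 * Suc g) + f (2 * Suc g + 1)"
    by (simp add: add.assoc)
  also have "\<dots> = ((\<Sum>i\<le>g. f (2*i)) + f (2 * Suc g)) + ((\<Sum>k=1..g+1. f (2*k-1)) + f (2 * Suc g + 1))"
    unfolding Suc.IH by (simp add: ac_simps)
  also have "\<dots> = (\<Sum>i\<le>Suc g. f (2*i)) + (\<Sum>k=1..Suc g+1. f (2*k-1))"
    by simp
  finally show ?case .
qed

section \<open>Real and imaginary periods in genus g and their symmetry\<close>

locale real_hyperelliptic = branch_points +
  fixes g :: nat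
  assumes N_eq: "N = 2 * g + 1" and g1: "1 \<le> g"
begin

lemma odd_index_le: "k \<in> {1..g+1} \<Longrightarrow> 2 * k - 1 \<le> N" and even_index_le: "i \<le> g \<Longrightarrow> 2 * i \<le> N"
  by (auto simp: N_eq)

lemma low_deg_iff: "low_deg p \<longleftrightarrow> degree p < g"
  unfolding low_deg_def using g1 N_eq by linarith

lemma low_deg_smult: "low_deg p \<Longrightarrow> low_deg (smult c p)"
  unfolding low_deg_iff by (rule order_le_less_trans[OF degree_smult_le])

text \<open>The integrals over the cuts \<open>I (2 * k - 1)\<close> are real and those over the gaps \<open>I (2 * i)\<close> are
  purely imaginary. Up to a common sign, \<open>X k\<close> and \<open>\<i> * V k\<close> are the \<open>\<aa>\<^sub>k\<close>- and \<open>\<bb>\<^sub>k\<close>-period of \<open>p dx / (- 2 y)\<close>.\<close>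

definition X :: "nat \<Rightarrow> real poly \<Rightarrow> real" where "X k p = - Re (H (2 * k - 1) p)"
definition Z :: "nat \<Rightarrow> real poly \<Rightarrow> real" where "Z i p = - Im (H (2 * i) p)"
definition V :: "nat \<Rightarrow> real poly \<Rightarrow> real" where "V k p = (\<Sum>i=k..g. Z i p)"

lemma H_odd:
  assumes "k \<in> {1..g+1}"
  shows "H (2 * k - 1) p = of_real (- X k p)" and "X k p = - ((- 1) ^ (g + 1 - k) * A (2 * k - 1) p)"
proof -
  have "\<i> ^ (N - (2 * k - 1)) = of_real ((- 1) ^ (g + 1 - k))"
  proof -
    have "N - (2 * k - 1) = 2 * (g + 1 - k)" using assms by (auto simp: N_eq)
    then show ?thesis by (simp add: power_mult)
  qed
  then have "H (2 * k - 1) p = of_real (A (2 * k - 1) p) / of_real ((- 1) ^ (g + 1 - k))"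
    using H_eq_A[OF odd_index_le[OF assms], of p] by simp
  also have "\<dots> = of_real ((- 1) ^ (g + 1 - k) * A (2 * k - 1) p)"
    by (cases "even (g + 1 - k)") auto
  finally have H: "H (2 * k - 1) p = of_real ((- 1) ^ (g + 1 - k) * A (2 * k - 1) p)" .
  then show "X k p = - ((- 1) ^ (g + 1 - k) * A (2 * k - 1) p)" by (simp add: X_def)
  then show "H (2 * k - 1) p = of_real (- X k p)" using H by simp
qed

lemma H_even:
  assumes "i \<le> g"
  shows "H (2 * i) p = - \<i> * of_real (Z i p)" and "Z i p = (- 1) ^ (g - i) * A (2 * i) p"
proof -
  have "\<i> ^ (N - 2 * i) = \<i> * of_real ((- 1) ^ (g - i))"
  proof -
    have "N - 2 * i = Suc (2 * (g - i))" using assms by (auto simp: N_eq)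
    then show ?thesis by (simp add: power_mult)
  qed
  then have "H (2 * i) p = of_real (A (2 * i) p) / (\<i> * of_real ((- 1) ^ (g - i)))"
    using H_eq_A[OF even_index_le[OF assms], of p] by simp
  also have "\<dots> = - \<i> * of_real ((- 1) ^ (g - i) * A (2 * i) p)"
    by (cases "even (g - i)") auto
  finally have H: "H (2 * i) p = - \<i> * of_real ((- 1) ^ (g - i) * A (2 * i) p)" .
  then show "Z i p = (- 1) ^ (g - i) * A (2 * i) p" by (simp add: Z_def)
  then show "H (2 * i) p = - \<i> * of_real (Z i p)" using H by simp
qed

text \<open>Real and imaginary part of the vanishing integral over the whole line. They determine
  the integrals over the two unbounded intervals, the last cut and gap 0.\<close>

lemma sum_X_Z_eq_0:
  assumes "low_deg p"
  shows "(\<Sum>k=1..g+1. X k p) = 0" and "(\<Sum>i\<le>g. Z i p) = 0"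
proof -
  have "0 = (\<Sum>i\<le>g. H (2 * i) p) + (\<Sum>k=1..g+1. H (2 * k - 1) p)"
    using sum_H_eq_0[OF assms] unfolding N_eq sum_even_odd by simp
  also have "\<dots> = - \<i> * of_real (\<Sum>i\<le>g. Z i p) - of_real (\<Sum>k=1..g+1. X k p)"
  proof -
    have "(\<Sum>i\<le>g. H (2 * i) p) = (\<Sum>i\<le>g. - \<i> * of_real (Z i p))" by (intro sum.cong) (auto simp: H_even(1))
    moreover have "(\<Sum>k=1..g+1. H (2 * k - 1) p) = (\<Sum>k=1..g+1. - of_real (X k p))"
      by (intro sum.cong refl) (simp add: H_odd(1) del: One_nat_def)
    ultimately show ?thesis by (simp add: sum_negf sum_distrib_left del: One_nat_def)
  qed
  finally have z: "- \<i> * of_real (\<Sum>i\<le>g. Z i p) - of_real (\<Sum>k=1..g+1. X k p) = (0::complex)" by simp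
  show "(\<Sum>k=1..g+1. X k p) = 0" using arg_cong[OF z, of Re] by simp
  show "(\<Sum>i\<le>g. Z i p) = 0" using arg_cong[OF z, of Im] by simp
qed

lemma Re_H_even: "i \<le> g \<Longrightarrow> Re (H (2 * i) p) = 0" and Im_H_odd: "k \<in> {1..g+1} \<Longrightarrow> Im (H (2 * k - 1) p) = 0"
  by (simp_all add: H_even(1) H_odd(1) del: One_nat_def)

lemma Re_times_Im_H_eq_0: "j \<le> N \<Longrightarrow> Re (H j p) * Im (H j q) = 0"
proof (cases "even j")
  case True
  moreover assume "j \<le> N"
  ultimately show ?thesis using Re_H_even[of "j div 2" p] by (auto simp: N_eq)
next
  case False
  moreover assume "j \<le> N"
  ultimately show ?thesis using Im_H_odd[of "(j + 1) div 2" q] by (auto elim!: oddE simp: N_eq)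
qed

text \<open>In the imaginary part of the bilinear relation only products of a cut with a gap
  survive. If the gap is to the right of the cut, they form X and V directly. Gaps to the left are
  traded for those to the right, since all gap integrals add up to 0; this exchanges p and q and
  produces the minus sign.\<close>

lemma period_form_symmetric:
  assumes p: "low_deg p" and q: "low_deg q"
  shows "(\<Sum>k=1..g. X k p * V k q) = (\<Sum>k=1..g. X k q * V k p)"
proof -
    define R where "R = (\<lambda>p q. \<Sum>i\<le>N. Re (H i p) * (\<Sum>j\<in>{i<..N}. Im (H j q)))"
  have tail: "(\<Sum>j\<in>{2*k-1<..N}. Im (H j q)) = - V k q" if "k \<in> {1..g+1}" for k q
  proof -
    have "(\<Sum>j\<in>{2*k-1<..N}. Im (H j q)) = (\<Sum>j\<in>(\<lambda>i. 2 * i) ` {k..g}. Im (H j q))"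
    proof (rule sum.mono_neutral_right)
      show "\<forall>j\<in>{2*k-1<..N} - (\<lambda>i. 2 * i) ` {k..g}. Im (H j q) = 0"
      proof
        fix j assume j: "j \<in> {2*k-1<..N} - (\<lambda>i. 2 * i) ` {k..g}"
        then have "odd j" using that by (auto elim!: evenE simp: image_iff N_eq)
        then show "Im (H j q) = 0" using j Im_H_odd[of "(j + 1) div 2" q] by (auto elim!: oddE simp: N_eq)
      qed
    qed (use that in \<open>auto simp: N_eq\<close>)
    also have "\<dots> = (\<Sum>i=k..g. Im (H (2 * i) q))" by (subst sum.reindex) (auto simp: inj_on_def)
    also have "\<dots> = - V k q" by (simp add: V_def Z_def sum_negf)
    finally show ?thesis .
  qed
  have RS: "R p q = (\<Sum>k=1..g. X k p * V k q)" for p q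
  proof -
    have "R p q = (\<Sum>i\<le>g. Re (H (2*i) p) * (\<Sum>j\<in>{2*i<..N}. Im (H j q))) +
        (\<Sum>k=1..g+1. Re (H (2*k-1) p) * (\<Sum>j\<in>{2*k-1<..N}. Im (H j q)))"
      using sum_even_odd[of _ g] unfolding R_def N_eq by blast
    also have "(\<Sum>i\<le>g. Re (H (2*i) p) * (\<Sum>j\<in>{2*i<..N}. Im (H j q))) = 0"
      by (intro sum.neutral) (simp add: Re_H_even)
    also have "(\<Sum>k=1..g+1. Re (H (2*k-1) p) * (\<Sum>j\<in>{2*k-1<..N}. Im (H j q))) = (\<Sum>k=1..g+1. X k p * V k q)"
      by (intro sum.cong refl) (simp add: tail X_def del: One_nat_def)
    \<comment> \<open>The last cut has no gap to its right: \<open>V (g+1) q\<close> is an empty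
      sum.\<close>
    also have "\<dots> = (\<Sum>k=1..g. X k p * V k q)" by (simp add: V_def)
    finally show ?thesis by simp
  qed
  have Zsum: "(\<Sum>j\<le>N. Im (H j p)) = 0"
    using arg_cong[OF sum_H_eq_0[OF p], of Im] by simp
  have "0 = (\<Sum>i\<le>N. \<Sum>j\<in>{i<..N}. Re (H i p) * Im (H j q)) + (\<Sum>i\<le>N. \<Sum>j\<in>{i<..N}. Im (H i p) * Re (H j q))"
    using Im_bilinear_relation[OF p q] by (simp add: sum.distrib)
  also have "(\<Sum>i\<le>N. \<Sum>j\<in>{i<..N}. Re (H i p) * Im (H j q)) = R p q"
    by (simp add: R_def sum_distrib_left)
  also have "(\<Sum>i\<le>N. \<Sum>j\<in>{i<..N}. Im (H i p) * Re (H j q)) = (\<Sum>j\<le>N. Re (H j q) * (\<Sum>i<j. Im (H i p)))"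
  proof -
    have "(\<Sum>i\<le>N. \<Sum>j\<in>{i<..N}. Im (H i p) * Re (H j q)) = (\<Sum>(i,j)\<in>Sigma {..N} (\<lambda>i. {i<..N}). Im (H i p) * Re (H j q))"
      by (rule sum.Sigma) auto
    also have "\<dots> = (\<Sum>(j,i)\<in>Sigma {..N} (\<lambda>j. {..<j}). Re (H j q) * Im (H i p))"
      by (rule sum.reindex_bij_witness[of _ prod.swap prod.swap]) auto
    also have "\<dots> = (\<Sum>j\<le>N. \<Sum>i<j. Re (H j q) * Im (H i p))" by (rule sum.Sigma[symmetric]) auto
    finally show ?thesis by (simp add: sum_distrib_left)
  qed
  also have "\<dots> = (\<Sum>j\<le>N. - (Re (H j q) * (\<Sum>i\<in>{j<..N}. Im (H i p))))"
  proof (rule sum.cong[OF refl])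
    fix j assume j: "j \<in> {..N}"
    have "{..N} = insert j ({..<j} \<union> {j<..N})" using j by auto
    then have "(\<Sum>i\<le>N. Im (H i p)) = Im (H j p) + ((\<Sum>i<j. Im (H i p)) + (\<Sum>i\<in>{j<..N}. Im (H i p)))"
      by (simp only:) (subst sum.insert, simp, simp, subst sum.union_disjoint, auto)
    then have "(\<Sum>i<j. Im (H i p)) = - Im (H j p) - (\<Sum>i\<in>{j<..N}. Im (H i p))" using Zsum by linarith
    \<comment> \<open>The remaining term at j itself vanishes: whether the integral over
      \<open>I j\<close> is real or imaginary does not depend on the polynomial.\<close>
    from this show "Re (H j q) * (\<Sum>i<j. Im (H i p)) = - (Re (H j q) * (\<Sum>i\<in>{j<..N}. Im (H i p)))"
      using Re_times_Im_H_eq_0[of j q p] j by (simp add: right_diff_distrib)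
  qed
  also have "\<dots> = - R q p" by (simp add: R_def sum_negf)
  finally show ?thesis unfolding RS by simp
qed

section \<open>Zeros of differentials and the signs of their periods\<close>

lemma A_pos:
  assumes p: "low_deg p" and j: "j \<le> N" and pos: "\<And>x. x \<in> I j \<Longrightarrow> 0 < poly p x"
  shows "0 < A j p"
proof -
  obtain a b where ab: "a < b" "{a<..<b} \<subseteq> I j" using I_contains_interval[OF j] by blast
  have "0 < poly p x / D x" if "x \<in> I j" for x
    using pos[OF that] D_pos[OF I_disjoint_E[OF j that]] by simp
  then show ?thesis
    unfolding A_def
    by (intro integral_pos_on_open[OF indicator_A_integrable[OF p j] _ ab(1)])
      (use ab(2) in \<open>force simp: indicator_def intro: less_imp_le\<close>)+
qed

lemma A_smult: "A j (smult c p) = c * A j p"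
  unfolding A_def by (simp add: mult.left_commute flip: integral_mult_right_zero)

lemma X_smult: "k \<in> {1..g+1} \<Longrightarrow> X k (smult c p) = c * X k p"
  by (simp add: H_odd(2) A_smult del: One_nat_def)

lemma Z_smult: "i \<le> g \<Longrightarrow> Z i (smult c p) = c * Z i p"
  by (simp add: H_even(2) A_smult)

lemma A_add:
  assumes "low_deg p" "low_deg q" "j \<le> N"
  shows "A j (p + q) = A j p + A j q"
proof -
  have "indicator (I j) x * (poly (p + q) x / D x) =
      indicator (I j) x * (poly p x / D x) + indicator (I j) x * (poly q x / D x)" for x
    by (simp add: add_divide_distrib distrib_left)
  then show ?thesis
    unfolding A_def
    by (simp only: Bochner_Integration.integral_add indicator_A_integrable assms)
qed

lemma low_deg_sum: "(\<And>l. l \<in> S \<Longrightarrow> low_deg (f l)) \<Longrightarrow> low_deg (\<Sum>l\<in>S. smult (c l) (f l))"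
  unfolding low_deg_iff using g1 low_deg_smult[unfolded low_deg_iff] by (intro degree_sum_less) simp_all

lemma A_sum:
  assumes "finite S" "\<And>l. l \<in> S \<Longrightarrow> low_deg (f l)" "j \<le> N"
  shows "A j (\<Sum>l\<in>S. smult (c l) (f l)) = (\<Sum>l\<in>S. c l * A j (f l))"
  using assms
proof (induction S rule: finite_induct)
  case empty
  then show ?case by (simp add: A_def)
next
  case (insert l S)
  have "low_deg (smult (c l) (f l))" using insert.prems by (simp add: low_deg_smult)
  moreover have "low_deg (\<Sum>l\<in>S. smult (c l) (f l))" using insert.prems by (intro low_deg_sum) auto
  ultimately show ?case using insert by (simp add: A_add A_smult)
qed

lemma X_sum:
  assumes "finite S" "\<And>l. l \<in> S \<Longrightarrow> low_deg (f l)" "k \<in> {1..g+1}"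
  shows "X k (\<Sum>l\<in>S. smult (c l) (f l)) = (\<Sum>l\<in>S. c l * X k (f l))"
proof -
  have "2 * k - 1 \<le> N" using odd_index_le[OF assms(3)] .
  then show ?thesis using assms
    by (simp add: H_odd(2) A_sum sum_negf sum_distrib_left mult_ac del: One_nat_def)
qed

lemma Z_sum:
  assumes "finite S" "\<And>l. l \<in> S \<Longrightarrow> low_deg (f l)" "i \<le> g"
  shows "Z i (\<Sum>l\<in>S. smult (c l) (f l)) = (\<Sum>l\<in>S. c l * Z i (f l))"
  using assms even_index_le[OF assms(3)] by (simp add: H_even(2) A_sum sum_distrib_left mult_ac)

text \<open>A polynomial of constant sign on the interval would have a nonzero integral against the
  positive weight 1 / D.\<close>

lemma root_in_I:
  assumes p: "low_deg p" and j: "j \<le> N" and "A j p = 0"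
  shows "\<exists>x\<in>I j. poly p x = 0"
proof (rule ccontr)
  assume "\<not> ?thesis"
  then have nz: "poly p x \<noteq> 0" if "x \<in> I j" for x using that by auto
  have conn: "connected (poly p ` I j)"
    by (intro connected_continuous_image connected_I) (auto intro!: continuous_intros)
  have nosign: False if "x \<in> I j" "y \<in> I j" "poly p x \<le> 0" "0 \<le> poly p y" for x y
  proof -
    have "0 \<in> poly p ` I j"
      using conn[unfolded connected_iff_interval] that by blast
    then show False using nz by force
  qed
  have "(\<forall>x\<in>I j. 0 < poly p x) \<or> (\<forall>x\<in>I j. poly p x < 0)"
  proof (rule ccontr)
    assume neg: "\<not> ?thesis"
    from neg obtain x where x: "x \<in> I j" "\<not> 0 < poly p x" by blast
    from neg obtain y where y: "y \<in> I j" "\<not> poly p y < 0" by blast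
    show False using nosign[OF x(1) y(1)] x(2) y(2) by simp
  qed
  then consider "\<forall>x\<in>I j. 0 < poly p x" | "\<forall>x\<in>I j. poly p x < 0" by blast
  then show False
  proof cases
    case 1
    then show ?thesis using A_pos[OF p j] \<open>A j p = 0\<close> by auto
  next
    case 2
    have "low_deg (smult (- 1) p)" using p by (rule low_deg_smult)
    then have "0 < A j (smult (- 1) p)" using 2 by (intro A_pos[OF _ j]) auto
    then show ?thesis unfolding A_smult using \<open>A j p = 0\<close> by simp
  qed
qed

lemma roots_in_cuts:
  assumes p: "low_deg p" and K: "K \<subseteq> {1..g+1}" and zero: "\<And>k. k \<in> K \<Longrightarrow> X k p = 0"
  obtains r where "\<And>k. k \<in> K \<Longrightarrow> r k \<in> I (2 * k - 1)" "\<And>k. k \<in> K \<Longrightarrow> poly p (r k) = 0" "inj_on r K"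
proof -
  have "\<exists>x\<in>I (2 * k - 1). poly p x = 0" if "k \<in> K" for k
  proof (rule root_in_I[OF p])
    have k: "k \<in> {1..g+1}" using K that by auto
    then show "2 * k - 1 \<le> N" by (rule odd_index_le)
    show "A (2 * k - 1) p = 0" using zero[OF that] H_odd(2)[OF k, of p] by simp
  qed
  then obtain r where r: "\<And>k. k \<in> K \<Longrightarrow> r k \<in> I (2 * k - 1)" "\<And>k. k \<in> K \<Longrightarrow> poly p (r k) = 0"
    by metis
  have "inj_on r K"
  proof (rule linorder_inj_onI)
    fix k l assume kl: "k < l" "k \<in> K" "l \<in> K"
    then have "r k < r l" using r(1) K by (intro I_less[of "2 * k - 1" "2 * l - 1"]) (auto simp: N_eq)
    then show "r k \<noteq> r l" by simp
  qed auto
  with r show thesis by (rule that)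
qed

text \<open>Each vanishing real period costs a zero in its own cut, and g zeros are too many for the
  degree. This is the source of the invertibility of \<omega>.\<close>

lemma eq_0_if_X_eq_0:
  assumes p: "low_deg p" and zero: "\<And>k. k \<in> {1..g} \<Longrightarrow> X k p = 0"
  shows "p = 0"
proof (rule ccontr)
  assume "p \<noteq> 0"
  have sub: "{1..g} \<subseteq> {1..g+1}" by auto
  obtain r where r: "\<And>k. k \<in> {1..g} \<Longrightarrow> poly p (r k) = 0" "inj_on r {1..g}"
    using roots_in_cuts[OF p sub zero] by blast
  have "g = card (r ` {1..g})" using r(2) by (simp add: card_image)
  also have "\<dots> \<le> card {x. poly p x = 0}"
    using r(1) by (intro card_mono poly_roots_finite[OF \<open>p \<noteq> 0\<close>]) auto
  also have "\<dots> \<le> degree p" by (rule card_poly_roots_bound[OF \<open>p \<noteq> 0\<close>])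
  finally show False using p by (simp add: low_deg_iff)
qed

text \<open>If all but two of the real periods vanish, all zeros of the differential are located in the
  remaining cuts, and hence the sign of every imaginary period is determined.\<close>

lemma sign_pattern:
  assumes p: "low_deg p" and "p \<noteq> 0" and K: "K \<subseteq> {1..g+1}" "card K = g - 1"
    and zero: "\<And>k. k \<in> K \<Longrightarrow> X k p = 0"
  obtains a where "a \<noteq> 0"
    "\<And>j. j \<le> N \<Longrightarrow> (\<And>k. k \<in> K \<Longrightarrow> j \<noteq> 2 * k - 1) \<Longrightarrow> 0 < a * (- 1) ^ card {k\<in>K. j < 2 * k - 1} * A j p"
proof -
  have finK: "finite K" using K(1) finite_subset by blast
  obtain r where r: "\<And>k. k \<in> K \<Longrightarrow> r k \<in> I (2 * k - 1)" "\<And>k. k \<in> K \<Longrightarrow> poly p (r k) = 0" "inj_on r K"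
    using roots_in_cuts[OF p K(1) zero] by blast
  define q where "q = (\<Prod>k\<in>K. [:- r k, 1:])"
  define a where "a = coeff p (g - 1)"
  have q: "degree q = g - 1" "coeff q (g - 1) = 1"
  proof -
    have "degree q = (\<Sum>k\<in>K. degree [:- r k, 1:])"
      unfolding q_def by (rule degree_prod_eq_sum_degree) auto
    then show d: "degree q = g - 1" using K(2) by simp
    have "lead_coeff q = 1" unfolding q_def lead_coeff_prod by simp
    then show "coeff q (g - 1) = 1" by (simp add: d)
  qed
  \<comment> \<open>The difference has degree below g - 1 but still g - 1 zeros, so it vanishes; in
    particular p has no zeros besides the r k.\<close>
  have pq: "p = smult a q"
  proof (rule ccontr)
    define d where "d = p - smult a q"
    assume "p \<noteq> smult a q"
    then have d0: "d \<noteq> 0" by (simp add: d_def)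
    have "degree d \<le> g - 1"
      unfolding d_def using p q(1) low_deg_smult[OF p] degree_smult_le[of a q]
      by (intro degree_diff_le) (simp_all add: low_deg_iff)
    moreover have "coeff d (g - 1) = 0" using q by (simp add: d_def a_def)
    then have "degree d \<noteq> g - 1" using d0 leading_coeff_0_iff by metis
    ultimately have "degree d < g - 1" by simp
    have "g - 1 = card (r ` K)" using r(3) K(2) by (simp add: card_image)
    also have "\<dots> \<le> card {x. poly d x = 0}"
      using r(2) finK by (intro card_mono poly_roots_finite[OF d0]) (auto simp: d_def q_def poly_prod)
    also have "\<dots> \<le> degree d" by (rule card_poly_roots_bound[OF d0])
    finally show False using \<open>degree d < g - 1\<close> by simp
  qed
  show thesis
  proof (rule that[of a])
    show "a \<noteq> 0" using pq \<open>p \<noteq> 0\<close> by auto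
    fix j assume j: "j \<le> N" and jK: "\<And>k. k \<in> K \<Longrightarrow> j \<noteq> 2 * k - 1"
    let ?K = "{k\<in>K. j < 2 * k - 1}"
    let ?c = "a * (- 1) ^ card ?K"
    \<comment> \<open>The factor a turns the leading coefficient into a^2, and one sign for every
      root to the right of \<open>I j\<close> makes all linear factors positive there.\<close>
    have "0 < A j (smult ?c p)"
    proof (rule A_pos[OF _ j])
      show "low_deg (smult ?c p)" using p by (rule low_deg_smult)
      fix x assume x: "x \<in> I j"
      have "(\<Prod>k\<in>K. x - r k) = (\<Prod>k\<in>?K. x - r k) * (\<Prod>k\<in>K - ?K. x - r k)"
        using finK by (subst prod.subset_diff[of ?K K]) (auto simp: mult.commute)
      also have "(\<Prod>k\<in>?K. x - r k) = (\<Prod>k\<in>?K. (- 1) * (r k - x))" by simp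
      also have "\<dots> = (- 1) ^ card ?K * (\<Prod>k\<in>?K. r k - x)" unfolding prod.distrib by simp
      finally have e: "(- 1) ^ card ?K * (\<Prod>k\<in>K. x - r k) = (\<Prod>k\<in>?K. r k - x) * (\<Prod>k\<in>K - ?K. x - r k)"
        by (simp flip: mult.assoc power_mult_distrib)
      have "0 < (\<Prod>k\<in>?K. r k - x)"
      proof (rule prod_pos)
        fix k assume "k \<in> ?K"
        then have "2 * k - 1 \<le> N" using K(1) by (intro odd_index_le) auto
        then show "0 < r k - x" using I_less[OF _ _ x r(1)[of k]] \<open>k \<in> ?K\<close> by auto
      qed
      moreover have "0 < (\<Prod>k\<in>K - ?K. x - r k)"
      proof (rule prod_pos)
        fix k assume "k \<in> K - ?K"
        then have "2 * k - 1 < j" using jK[of k] by auto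
        then show "0 < x - r k" using I_less[OF _ j r(1)[of k] x] \<open>k \<in> K - ?K\<close> by auto
      qed
      ultimately have "0 < (- 1) ^ card ?K * (\<Prod>k\<in>K. x - r k)" unfolding e by (rule mult_pos_pos)
      moreover have "0 < a * a" using \<open>a \<noteq> 0\<close> by (auto simp: zero_less_mult_iff linorder_neq_iff)
      ultimately have "0 < (a * a) * ((- 1) ^ card ?K * (\<Prod>k\<in>K. x - r k))"
        by (rule mult_pos_pos[rotated])
      also have "\<dots> = poly (smult ?c p) x"
        by (simp add: pq q_def poly_prod mult_ac)
      finally show "0 < poly (smult ?c p) x" .
    qed
    then show "0 < ?c * A j p" by (simp add: A_smult)
  qed
qed

lemma X_diff: "low_deg p \<Longrightarrow> low_deg q \<Longrightarrow> k \<in> {1..g+1} \<Longrightarrow> X k (p - q) = X k p - X k q"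
proof -
  assume p: "low_deg p" and q: "low_deg q" and k: "k \<in> {1..g+1}"
  have eq: "p + smult (- 1) q = p - q" by simp
  have "A (2 * k - 1) (p - q) = A (2 * k - 1) p - A (2 * k - 1) q"
    using A_add[OF p low_deg_smult[OF q, of "- 1"] odd_index_le[OF k]] unfolding A_smult eq by simp
  then show ?thesis unfolding H_odd(2)[OF k] by (simp add: right_diff_distrib)
qed

text \<open>Gap l lies between the cuts l and l + 1; gap 0 has the cuts g + 1 and 1 as neighbours,
  seen through infinity. The differential has real periods 1 and -1 on these two neighbours and 0 on
  all other cuts, which therefore contain all its zeros. In the network picture a unit current is
  thus exchanged at node l, and the signs say that the conductances to all other nodes are
  positive.\<close>

lemma neg_imaginary_period:
  assumes p: "low_deg p" and l: "l \<le> g"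
    and Xp: "\<And>k. k \<in> {1..g} \<Longrightarrow> X k p = of_bool (k = l) - of_bool (k = l + 1)"
    and i: "i \<le> g" "i \<noteq> l"
  shows "Z i p < 0"
proof -
  have "(\<Sum>k=1..g. X k p) + X (g+1) p = 0"
    using sum_X_Z_eq_0(1)[OF p] by simp
  moreover have "(\<Sum>k=1..g. X k p) = of_bool (1 \<le> l) - of_bool (l + 1 \<le> g)"
  proof -
    have "(\<Sum>k=1..g. X k p) = (\<Sum>k=1..g. if k = l then 1 else 0) - (\<Sum>k=1..g. if k = l + 1 then 1 else 0)"
      unfolding sum_subtractf[symmetric] by (intro sum.cong refl) (simp add: Xp)
    then show ?thesis using l by simp
  qed
  \<comment> \<open>The period over the last cut is not prescribed but forced by the total; for l =
    0 and l = g this cut is one of the two neighbours.\<close>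
  ultimately have Xlast: "X (g+1) p = of_bool (l + 1 \<le> g) - of_bool (1 \<le> l)" by simp
  have X0: "X k 0 = 0" if "k \<in> {1..g+1}" for k
    using X_smult[OF that, of 0 p] by simp
  show ?thesis
  proof (cases "l = 0")
    case False
    define K where "K = {1..g+1} - {l, l+1}"
    have K: "K \<subseteq> {1..g+1}" "card K = g - 1"
    proof -
      have "card K = card {1..g+1} - card {l, l+1}"
        unfolding K_def using False l by (intro card_Diff_subset) auto
      then show "card K = g - 1" by simp
    qed (auto simp: K_def)
    have X1: "X l p = 1" using Xp[of l] False l by simp
    then have p0: "p \<noteq> 0" using X0[of l] False l by auto
    have zero: "X k p = 0" if "k \<in> K" for k
      using that Xp[of k] Xlast False l by (cases "k = g + 1") (auto simp: K_def)
    obtain a where a: "\<And>j. j \<le> N \<Longrightarrow> (\<And>k. k \<in> K \<Longrightarrow> j \<noteq> 2 * k - 1) \<Longrightarrow> 0 < a * (- 1) ^ card {k\<in>K. j < 2 * k - 1} * A j p"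
      using sign_pattern[OF p p0 K zero] by blast
    \<comment> \<open>The normalisation on cut l fixes the sign of the leading coefficient; the
      zeros to its right are those in the cuts l + 2, ..., g + 1.\<close>
    have "0 < a"
    proof -
      have "{k\<in>K. 2 * l - 1 < 2 * k - 1} = {l+2..g+1}" using False by (auto simp: K_def)
      moreover have "0 < a * (- 1) ^ card {k\<in>K. 2 * l - 1 < 2 * k - 1} * A (2 * l - 1) p"
      proof (rule a)
        show "2 * l - 1 \<le> N" using False l by (intro odd_index_le) simp
        fix k assume "k \<in> K"
        then show "2 * l - 1 \<noteq> 2 * k - 1" using False by (auto simp: K_def)
      qed
      moreover have "card {l+2..g+1} = g - l" by simp
      ultimately have "0 < a * (- 1) ^ (g - l) * A (2 * l - 1) p" by (simp only:)
      moreover have "X l p = (- 1) ^ (g - l) * A (2 * l - 1) p"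
        using H_odd(2)[of l p] False l by (simp add: Suc_diff_le)
      ultimately show ?thesis using X1 by (simp add: mult.assoc)
    qed
    moreover have "0 < a * (- 1) ^ card {k\<in>K. 2 * i < 2 * k - 1} * A (2 * i) p"
    proof (rule a[OF even_index_le[OF i(1)]])
      fix k assume "k \<in> K"
      then have "1 \<le> k" by (auto simp: K_def)
      then show "2 * i \<noteq> 2 * k - 1" by presburger
    qed
    \<comment> \<open>To the left of gap l both exceptional cuts are missing from the count, to its
      right neither would be counted: g - i - 1 or g - i + 1 zeros, which have the same
      parity.\<close>
    moreover have "(- 1 :: real) ^ card {k\<in>K. 2 * i < 2 * k - 1} = - ((- 1) ^ (g - i))"
    proof (cases "i < l")
      case True
      have "{k\<in>K. 2 * i < 2 * k - 1} = {i+1..g+1} - {l, l+1}" by (auto simp: K_def)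
      moreover have "card ({i+1..g+1} - {l, l+1}) = card {i+1..g+1} - card {l, l+1}"
        using True l by (intro card_Diff_subset) auto
      ultimately have "card {k\<in>K. 2 * i < 2 * k - 1} + 1 = g - i" using True l by simp
      then have "(- 1 :: real) ^ (g - i) = (- 1) ^ (card {k\<in>K. 2 * i < 2 * k - 1} + 1)" by (simp only:)
      then show ?thesis by simp
    next
      case False
      have "{k\<in>K. 2 * i < 2 * k - 1} = {i+1..g+1}" using False i by (auto simp: K_def)
      then have "card {k\<in>K. 2 * i < 2 * k - 1} = (g - i) + 1" using i by simp
      then show ?thesis by simp
    qed
    ultimately have "0 < a * - Z i p" using H_even(2)[OF i(1), of p] by (simp add: mult.assoc)
    then show ?thesis using \<open>0 < a\<close> by (simp add: zero_less_mult_iff mult_less_0_iff)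
  next
    case True
    define K where "K = {2..g}"
    have K: "K \<subseteq> {1..g+1}" "card K = g - 1" by (auto simp: K_def)
    have X1: "X 1 p = - 1" using Xp[of 1] True g1 by simp
    then have p0: "p \<noteq> 0" using X0[of 1] by auto
    have zero: "X k p = 0" if "k \<in> K" for k
      using that Xp[of k] True by (auto simp: K_def)
    obtain a where a: "\<And>j. j \<le> N \<Longrightarrow> (\<And>k. k \<in> K \<Longrightarrow> j \<noteq> 2 * k - 1) \<Longrightarrow> 0 < a * (- 1) ^ card {k\<in>K. j < 2 * k - 1} * A j p"
      using sign_pattern[OF p p0 K zero] by blast
    have "a < 0"
    proof -
      have "{k\<in>K. 1 < 2 * k - 1} = {2..g}" by (auto simp: K_def)
      moreover have "0 < a * (- 1) ^ card {k\<in>K. 1 < 2 * k - 1} * A 1 p"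
      proof (rule a)
        show "1 \<le> N" by (simp add: N_eq)
        fix k assume "k \<in> K"
        then show "1 \<noteq> 2 * k - 1" by (auto simp: K_def)
      qed
      moreover have "card {2..g} = g - 1" by simp
      ultimately have "0 < a * (- 1) ^ (g - 1) * A 1 p" by (simp only:)
      moreover have "X 1 p = (- 1) ^ (g - 1) * A 1 p"
        using H_odd(2)[of 1 p] g1 by (cases g) simp_all
      ultimately have "0 < a * (- 1)" using X1 by (simp add: mult.assoc)
      then show ?thesis by simp
    qed
    moreover have "0 < a * (- 1) ^ card {k\<in>K. 2 * i < 2 * k - 1} * A (2 * i) p"
    proof (rule a[OF even_index_le[OF i(1)]])
      fix k assume "k \<in> K"
      then have "1 \<le> k" by (auto simp: K_def)
      then show "2 * i \<noteq> 2 * k - 1" by presburger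
    qed
    moreover have "{k\<in>K. 2 * i < 2 * k - 1} = {i+1..g}" using i True by (auto simp: K_def)
    ultimately have "0 < a * Z i p" using H_even(2)[OF i(1), of p] by (simp add: mult.assoc)
    then show ?thesis using \<open>a < 0\<close> by (simp add: zero_less_mult_iff)
  qed
qed

text \<open>The q l are the basis in which p has the coefficients U l, because X turns coefficients
  into differences of consecutive ones. The period form becomes a quadratic form in U with the
  matrix Z i (q l). Its row sums vanish because the q l add up to a differential without real
  periods, its column sums because the gap integrals of each q l add up to 0.\<close>

lemma period_form_sum_of_squares:
  assumes p: "low_deg p" and q: "\<And>l. l \<le> g \<Longrightarrow> low_deg (q l)"
    and Xq: "\<And>k l. l \<le> g \<Longrightarrow> k \<in> {1..g} \<Longrightarrow> X k (q l) = of_bool (k = l) - of_bool (k = l + 1)"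
  defines "U \<equiv> \<lambda>i. \<Sum>k=1..i. X k p"
  shows "(\<Sum>k=1..g. X k p * V k p) = (\<Sum>i\<le>g. \<Sum>l\<le>g. - Z i (q l) / 2 * (U i - U l)\<^sup>2)"
proof -
  have lin: "(\<Sum>l\<le>g. c l * (of_bool (k = l) - of_bool (k = l + 1))) = c k - c (k - 1)"
    if "k \<in> {1..g}" for k and c :: "nat \<Rightarrow> real"
  proof -
    have "(\<Sum>l\<le>g. c l * (of_bool (k = l) - of_bool (k = l + 1))) =
        (\<Sum>l\<le>g. if l = k then c l else 0) - (\<Sum>l\<le>g. if l = k - 1 then c l else 0)"
      unfolding sum_subtractf[symmetric] using that by (intro sum.cong refl) auto
    then show ?thesis using that by auto
  qed
  have low_deg_comb: "low_deg (\<Sum>l\<in>{..g}. smult (c l) (q l))" for c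
    by (rule low_deg_sum) (simp add: q)
  have X_comb: "X k (\<Sum>l\<in>{..g}. smult (c l) (q l)) = c k - c (k - 1)" if k: "k \<in> {1..g}" for k c
  proof -
    have "X k (\<Sum>l\<in>{..g}. smult (c l) (q l)) = (\<Sum>l\<le>g. c l * X k (q l))"
      by (rule X_sum) (use q k in auto)
    also have "\<dots> = (\<Sum>l\<le>g. c l * (of_bool (k = l) - of_bool (k = l + 1)))"
      by (intro sum.cong refl) (use Xq k in auto)
    finally show ?thesis using lin[OF k] by simp
  qed
  have Z_comb: "Z i (\<Sum>l\<in>{..g}. smult (c l) (q l)) = (\<Sum>l\<le>g. c l * Z i (q l))" if "i \<le> g" for i c
    by (rule Z_sum) (use q that in auto)
  have row: "(\<Sum>l\<le>g. Z i (q l)) = 0" if i: "i \<le> g" for i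
  proof -
    have "(\<Sum>l\<in>{..g}. smult 1 (q l)) = 0"
      by (rule eq_0_if_X_eq_0[OF low_deg_comb]) (simp only: X_comb diff_self)
    then have "Z i (\<Sum>l\<in>{..g}. smult 1 (q l)) = Z i (smult 0 p)" by simp
    then show ?thesis unfolding Z_comb[OF i] Z_smult[OF i] by simp
  qed
  have col: "(\<Sum>i\<le>g. Z i (q l)) = 0" if "l \<le> g" for l
    by (rule sum_X_Z_eq_0(2)[OF q[OF that]])
  have p_eq: "p = (\<Sum>l\<in>{..g}. smult (U l) (q l))"
  proof -
    have "p - (\<Sum>l\<in>{..g}. smult (U l) (q l)) = 0"
    proof (rule eq_0_if_X_eq_0)
      show "low_deg (p - (\<Sum>l\<in>{..g}. smult (U l) (q l)))"
        using p low_deg_comb[of U] unfolding low_deg_iff by (rule degree_diff_less)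
      fix k assume k: "k \<in> {1..g}"
      then have "{1..k} = insert k {1..k-1}" "k \<notin> {1..k-1}" by auto
      then have "U k = X k p + U (k - 1)" unfolding U_def by (metis finite_atLeastAtMost sum.insert)
      then show "X k (p - (\<Sum>l\<in>{..g}. smult (U l) (q l))) = 0"
        using k X_diff[OF p low_deg_comb[of U], of k] X_comb[OF k, of U] by simp
    qed
    then show ?thesis by simp
  qed
  have Zp: "Z i p = (\<Sum>l\<le>g. U l * Z i (q l))" if "i \<le> g" for i
    using Z_comb[OF that, of U] p_eq by simp
  \<comment> \<open>Abel summation: gap i occurs in V k for all k \<le> i and thus collects U i. Gap
    0 can be included because U 0 = 0.\<close>
  have "(\<Sum>k=1..g. X k p * V k p) = (\<Sum>(k,i)\<in>Sigma {1..g} (\<lambda>k. {k..g}). X k p * Z i p)"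
    unfolding V_def sum_distrib_left by (rule sum.Sigma) auto
  also have "\<dots> = (\<Sum>(i,k)\<in>Sigma {..g} (\<lambda>i. {1..i}). X k p * Z i p)"
    by (rule sum.reindex_bij_witness[of _ prod.swap prod.swap]) auto
  also have "\<dots> = (\<Sum>i\<le>g. \<Sum>k=1..i. X k p * Z i p)"
    by (rule sum.Sigma[symmetric]) auto
  also have "\<dots> = (\<Sum>i\<le>g. \<Sum>l\<le>g. Z i (q l) * U i * U l)"
  proof (rule sum.cong[OF refl])
    fix i assume "i \<in> {..g}"
    then have i: "i \<le> g" by simp
    have "(\<Sum>k=1..i. X k p * Z i p) = U i * Z i p" unfolding U_def sum_distrib_right ..
    also have "\<dots> = (\<Sum>l\<le>g. Z i (q l) * U i * U l)"
      unfolding Zp[OF i] sum_distrib_left by (intro sum.cong refl) simp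
    finally show "(\<Sum>k=1..i. X k p * Z i p) = (\<Sum>l\<le>g. Z i (q l) * U i * U l)" .
  qed
  also have "\<dots> = (\<Sum>i\<le>g. \<Sum>l\<le>g. - Z i (q l) / 2 * (U i - U l)\<^sup>2)"
    by (rule laplacian_quadratic_form) (auto simp: row col)
  finally show ?thesis .
qed

end

section \<open>Period matrices\<close>

lemma pos_mono: "i < j \<Longrightarrow> pos i < pos (j :: 'n::{finite,linorder})"
  unfolding pos_def by (rule psubset_card_mono) auto

lemma inj_pos: "inj (pos :: 'n::{finite,linorder} \<Rightarrow> nat)"
  by (rule linorder_injI) (use pos_mono in force)

lemma pos_range: "pos (i :: 'n::{finite,linorder}) \<in> {1..CARD('n)}"
proof -
  have "card {..i} \<le> CARD('n)" by (rule card_mono) auto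
  moreover have "0 < card {..i}" by (subst card_gt_0_iff) auto
  ultimately show ?thesis by (simp add: pos_def Suc_le_eq)
qed

lemma bij_betw_pos: "bij_betw (pos :: 'n::{finite,linorder} \<Rightarrow> nat) UNIV {1..CARD('n)}"
proof -
  have "range (pos :: 'n \<Rightarrow> nat) = {1..CARD('n)}"
    by (rule card_subset_eq) (use pos_range[where 'n = 'n] in \<open>auto simp: card_image inj_pos\<close>)
  then show ?thesis by (simp add: bij_betw_def inj_pos)
qed

lemma sum_pos: "(\<Sum>k\<in>(UNIV :: 'n::{finite,linorder} set). f (pos k)) = (\<Sum>k=1..CARD('n). f k)"
  by (rule sum.reindex_bij_betw[OF bij_betw_pos])

context real_hyperelliptic
begin

text \<open>The exponents follow the numbering of the differentials du, so that multiplying a row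
  vector c into a period matrix yields the periods of \<open>vpoly c\<close>.\<close>

definition vpoly :: "('n::{finite,linorder}) rvec \<Rightarrow> real poly" where
  "vpoly c = (\<Sum>i\<in>UNIV. smult (c $ i) (monom 1 (g - pos i)))"

lemma low_deg_monom:
  assumes "g = CARD('n)"
  shows "low_deg (monom 1 (g - pos (i :: 'n::{finite,linorder})))"
  unfolding low_deg_iff using pos_range[of i] g1 by (simp add: degree_monom_eq)

lemma low_deg_vpoly: "g = CARD('n) \<Longrightarrow> low_deg (vpoly (c :: ('n::{finite,linorder}) rvec))"
  unfolding vpoly_def by (rule low_deg_sum) (rule low_deg_monom)

lemma coeff_vpoly:
  assumes "g = CARD('n)"
  shows "coeff (vpoly c) (g - pos (i :: 'n::{finite,linorder})) = c $ i"
proof -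
  have "coeff (vpoly c) (g - pos i) = (\<Sum>j\<in>UNIV. if j = i then c $ i else 0)"
    unfolding vpoly_def coeff_sum
  proof (rule sum.cong[OF refl])
    fix j :: 'n
    have "g - pos j = g - pos i \<longleftrightarrow> pos j = pos i"
      using pos_range[of i] pos_range[of j] assms by auto
    also have "\<dots> \<longleftrightarrow> j = i" by (rule inj_eq[OF inj_pos])
    finally have "g - pos j = g - pos i \<longleftrightarrow> j = i" .
    then show "coeff (smult (c $ j) (monom 1 (g - pos j))) (g - pos i) = (if j = i then c $ i else 0)"
      by auto
  qed
  then show ?thesis by simp
qed

lemma X_vpoly:
  assumes "g = CARD('n)" "k \<in> {1..g+1}"
  shows "X k (vpoly (c :: ('n::{finite,linorder}) rvec)) = (\<Sum>i\<in>UNIV. c $ i * X k (monom 1 (g - pos i)))"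
  unfolding vpoly_def by (rule X_sum[OF _ low_deg_monom[OF assms(1)] assms(2)]) simp

lemma V_vpoly:
  assumes "g = CARD('n)"
  shows "V k (vpoly (c :: ('n::{finite,linorder}) rvec)) = (\<Sum>i\<in>UNIV. c $ i * V k (monom 1 (g - pos i)))"
proof -
  have "V k (vpoly c) = (\<Sum>l=k..g. \<Sum>i\<in>UNIV. c $ i * Z l (monom 1 (g - pos i)))"
    unfolding V_def vpoly_def by (intro sum.cong refl Z_sum low_deg_monom assms) auto
  also have "\<dots> = (\<Sum>i\<in>UNIV. c $ i * V k (monom 1 (g - pos i)))"
    unfolding V_def sum_distrib_left by (rule sum.swap)
  finally show ?thesis .
qed

text \<open>\<open>Oi ** Om'\<close> is \<tau> divided by i. Injectivity of the real periods gives
  the inverse, the bilinear relation gives the symmetry of \<open>Om ** transpose Om'\<close> and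
  hence of \<tau>, and solving c Om = m turns the quadratic form at m into the period form of a
  single polynomial. The sign s stands for the choice of the branch of y; it cancels in
  \<tau>.\<close>

lemma period_matrices:
  fixes s :: real and Om Om' :: "('n::{finite,linorder}) rmat"
  assumes g: "g = CARD('n)" and s: "s * s = 1"
    and Om: "\<And>i k. Om $ i $ k = s * X (pos k) (monom 1 (g - pos i))"
    and Om': "\<And>i k. Om' $ i $ k = s * V (pos k) (monom 1 (g - pos i))"
  shows "\<exists>(Oi :: 'n rmat) (d :: 'n \<Rightarrow> real) (b :: nat \<times> nat \<Rightarrow> 'n rvec) H.
    Om ** Oi = mat 1 \<and> transpose (Oi ** Om') = Oi ** Om' \<and> (\<forall>k. 0 < d k) \<and> finite H \<and>
    (\<forall>m. pi * quad_form (Oi ** Om') m = (\<Sum>k\<in>UNIV. d k * (of_int (m $ k))\<^sup>2) + (\<Sum>h\<in>H. (int_inner m (b h))\<^sup>2 / 2))"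
proof -
  have pos_le: "pos k \<in> {1..g+1}" for k :: 'n using pos_range[of k] g by auto
  have cX: "(c v* Om) $ k = s * X (pos k) (vpoly c)" for c k
    unfolding vector_matrix_mult_def X_vpoly[OF g pos_le] by (simp add: Om sum_distrib_left mult_ac)
  have cV: "(c v* Om') $ k = s * V (pos k) (vpoly c)" for c k
    unfolding vector_matrix_mult_def V_vpoly[OF g] by (simp add: Om' sum_distrib_left mult_ac)
  have "c = 0" if "transpose Om *v c = 0" for c
  proof -
    have "c v* Om = 0" using that by simp
    then have z: "X (pos k) (vpoly c) = 0" for k :: 'n
      using cX[of c k] s by auto
    have "vpoly c = 0"
    proof (rule eq_0_if_X_eq_0[OF low_deg_vpoly[OF g]])
      fix k assume "k \<in> {1..g}"
      then obtain k' :: 'n where "k = pos k'" using bij_betw_pos[where 'n = 'n] g unfolding bij_betw_def by blast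
      then show "X k (vpoly c) = 0" using z by simp
    qed
    then show "c = 0" using coeff_vpoly[OF g, of c] by (simp add: vec_eq_iff)
  qed
  then obtain B where "B ** transpose Om = mat 1"
    using matrix_left_invertible_ker[of "transpose Om"] by blast
  then obtain Oi where right: "Om ** Oi = mat 1" using left_invertible_transpose[of Om] by blast
  then have left: "Oi ** Om = mat 1" by (rule matrix_left_right_inverse1)
  have sym0: "Om ** transpose Om' = Om' ** transpose Om"
  proof -
    have "(Om ** transpose Om') $ i $ j = (Om' ** transpose Om) $ i $ j" for i j
    proof -
      let ?p = "\<lambda>i :: 'n. monom 1 (g - pos i) :: real poly"
      have "(Om ** transpose Om') $ i $ j = (\<Sum>k\<in>(UNIV :: 'n set). (s * s) * (X (pos k) (?p i) * V (pos k) (?p j)))"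
        by (simp add: matrix_matrix_mult_def transpose_def Om Om' mult_ac)
      also have "\<dots> = (\<Sum>k=1..g. X k (?p i) * V k (?p j))"
        unfolding s using sum_pos[where 'n = 'n, of "\<lambda>k. X k (?p i) * V k (?p j)"] g by simp
      also have "\<dots> = (\<Sum>k=1..g. X k (?p j) * V k (?p i))"
        by (rule period_form_symmetric[OF low_deg_monom[OF g] low_deg_monom[OF g]])
      also have "\<dots> = (\<Sum>k\<in>(UNIV :: 'n set). (s * s) * (X (pos k) (?p j) * V (pos k) (?p i)))"
        unfolding s using sum_pos[where 'n = 'n, of "\<lambda>k. X k (?p j) * V k (?p i)"] g by simp
      also have "\<dots> = (Om' ** transpose Om) $ i $ j"
        by (simp add: matrix_matrix_mult_def transpose_def Om Om' mult_ac)
      finally show ?thesis .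
    qed
    then show ?thesis by (simp add: vec_eq_iff)
  qed
  have tO: "transpose Om ** transpose Oi = mat 1"
    using arg_cong[OF left, of transpose] by (simp add: matrix_transpose_mul transpose_mat)
  have B_eq: "Oi ** Om' = transpose Om' ** transpose Oi"
  proof -
    have "Oi ** Om' = Oi ** (Om' ** transpose Om) ** transpose Oi"
      by (metis matrix_mul_assoc matrix_mul_rid tO)
    also have "\<dots> = transpose Om' ** transpose Oi"
      unfolding sym0[symmetric] by (metis matrix_mul_assoc matrix_mul_lid left)
    finally show ?thesis .
  qed
  then have sym: "transpose (Oi ** Om') = Oi ** Om'" by (simp add: matrix_transpose_mul)
  have solve: "(transpose Oi *v a) v* Om = a" for a
  proof -
    have "transpose Om *v (transpose Oi *v a) = a"
      by (simp only: matrix_vector_mul_assoc tO matrix_vector_mul_lid)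
    then show ?thesis by simp
  qed
  \<comment> \<open>Real periods 1 and -1 at the neighbours of gap l; the factor s undoes the one in
    \<open>Om\<close>.\<close>
  define q where "q = (\<lambda>l. vpoly (transpose Oi *v ((\<chi> k. s * (of_bool (pos k = l) - of_bool (pos k = l + 1))) :: 'n rvec)))"
  have low_deg_q: "low_deg (q l)" for l unfolding q_def by (rule low_deg_vpoly[OF g])
  have s_cancel: "s * (s * x) = x" for x using s by (simp flip: mult.assoc)
  have Xq: "X k (q l) = of_bool (k = l) - of_bool (k = l + 1)" if kg: "k \<in> {1..g}" for k l
  proof -
    obtain k' :: 'n where k': "k = pos k'" using kg bij_betw_pos[where 'n = 'n] g unfolding bij_betw_def by blast
    have "s * X k (q l) = s * (of_bool (pos k' = l) - of_bool (pos k' = l + 1))"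
      unfolding q_def k' cX[symmetric] solve by simp
    then have "s * (s * X k (q l)) = s * (s * (of_bool (pos k' = l) - of_bool (pos k' = l + 1)))" by simp
    then show ?thesis unfolding s_cancel k' .
  qed
  have neg: "Z i (q l) < 0" if "l \<le> g" "i \<le> g" "i \<noteq> l" for i l
    by (rule neg_imaginary_period[OF low_deg_q that(1) _ that(2,3)]) (rule Xq)
  define u where "u = (\<lambda>(m :: 'n ivec) i. \<Sum>k\<in>UNIV. of_bool (pos k \<le> i) * real_of_int (m $ k))"
  \<comment> \<open>The ordered pairs (k, k - 1) have u k - u (k - 1) equal to an entry of m and
    form the diagonal part d. All other pairs, the reversed (k - 1, k) included, become squares of
    the linear forms b.\<close>
  define H where "H = {(i,l). i \<le> g \<and> l \<le> g \<and> i \<noteq> l \<and> i \<noteq> l + 1}"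
  define d where "d = (\<lambda>k :: 'n. - pi * Z (pos k) (q (pos k - 1)) / 2)"
  define b where "b = (\<lambda>(i,l). (\<chi> k. sqrt (- pi * Z i (q l)) * (of_bool (pos k \<le> i) - of_bool (pos k \<le> l))) :: 'n rvec)"
  have finH: "finite H" by (rule finite_subset[of _ "{..g} \<times> {..g}"]) (auto simp: H_def)
  have d: "0 < d k" for k
  proof -
    have "Z (pos k) (q (pos k - 1)) < 0" using pos_range[of k] g by (intro neg) auto
    then show ?thesis by (simp add: d_def mult_less_0_iff)
  qed
  have quad_form_eq: "quad_form (Oi ** Om') m = (\<Sum>i\<le>g. \<Sum>l\<le>g. - Z i (q l) / 2 * (u m i - u m l)\<^sup>2)" for m
  proof -
    define a :: "'n rvec" where "a = (\<chi> k. of_int (m $ k))"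
    define c where "c = transpose Oi *v a"
    have "quad_form (Oi ** Om') m = (\<Sum>i\<in>UNIV. a $ i * ((Oi ** Om') *v a) $ i)"
      by (simp add: quad_form_def a_def matrix_vector_mult_def sum_distrib_left mult_ac)
    also have "(Oi ** Om') *v a = c v* Om'"
      unfolding B_eq c_def by (simp add: matrix_vector_mul_assoc[symmetric] del: transpose_matrix_vector) simp
    also have "a = c v* Om" unfolding c_def solve ..
    finally have "quad_form (Oi ** Om') m = (\<Sum>k\<in>(UNIV :: 'n set). (s * s) * (X (pos k) (vpoly c) * V (pos k) (vpoly c)))"
      unfolding cX cV by (simp add: mult_ac)
    also have "\<dots> = (\<Sum>k=1..g. X k (vpoly c) * V k (vpoly c))"
      unfolding s using sum_pos[where 'n = 'n, of "\<lambda>k. X k (vpoly c) * V k (vpoly c)"] g by simp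
    also have "\<dots> = (\<Sum>i\<le>g. \<Sum>l\<le>g. - Z i (q l) / 2 * ((\<Sum>k=1..i. X k (vpoly c)) - (\<Sum>k=1..l. X k (vpoly c)))\<^sup>2)"
      by (rule period_form_sum_of_squares[OF low_deg_vpoly[OF g] low_deg_q Xq])
    also have "\<dots> = (\<Sum>i\<le>g. \<Sum>l\<le>g. - Z i (q l) / 2 * (u m i - u m l)\<^sup>2)"
    proof (intro sum.cong refl)
      have U: "(\<Sum>k=1..i. X k (vpoly c)) = s * u m i" if "i \<in> {..g}" for i
      proof -
        have Xa: "X (pos k) (vpoly c) = s * of_int (m $ k)" for k :: 'n
        proof -
          have "s * X (pos k) (vpoly c) = a $ k" unfolding cX[symmetric] c_def solve ..
          then have "s * (s * X (pos k) (vpoly c)) = s * a $ k" by simp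
          then show ?thesis unfolding s_cancel by (simp add: a_def)
        qed
        have "(\<Sum>k=1..i. X k (vpoly c)) = (\<Sum>k=1..g. of_bool (k \<le> i) * X k (vpoly c))"
          using that by (intro sum.mono_neutral_cong_left) auto
        also have "\<dots> = (\<Sum>k\<in>UNIV. of_bool (pos k \<le> i) * X (pos (k::'n)) (vpoly c))"
          using sum_pos[where 'n = 'n, of "\<lambda>k. of_bool (k \<le> i) * X k (vpoly c)"] g by simp
        also have "\<dots> = s * u m i"
          unfolding Xa u_def sum_distrib_left by (intro sum.cong refl) simp
        finally show ?thesis .
      qed
      fix i l assume il: "i \<in> {..g}" "l \<in> {..g}"
      have "(s * u m i - s * u m l)\<^sup>2 = (s * s) * (u m i - u m l)\<^sup>2"
        by (simp add: power2_eq_square algebra_simps)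
      then show "- Z i (q l) / 2 * ((\<Sum>k=1..i. X k (vpoly c)) - (\<Sum>k=1..l. X k (vpoly c)))\<^sup>2 = - Z i (q l) / 2 * (u m i - u m l)\<^sup>2"
        unfolding U[OF il(1)] U[OF il(2)] s by simp
    qed
    finally show ?thesis .
  qed
  have "pi * quad_form (Oi ** Om') m = (\<Sum>k\<in>UNIV. d k * (of_int (m $ k))\<^sup>2) + (\<Sum>h\<in>H. (int_inner m (b h))\<^sup>2 / 2)" for m
  proof -
    let ?t = "\<lambda>(i,l). - pi * Z i (q l) / 2 * (u m i - u m l)\<^sup>2"
    have step: "u m (pos k) - u m (pos k - 1) = of_int (m $ k)" for k
    proof -
      have "u m (pos k) - u m (pos k - 1) = (\<Sum>j\<in>UNIV. if j = k then of_int (m $ k) else 0)"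
        unfolding u_def sum_subtractf[symmetric]
      proof (rule sum.cong[OF refl])
        fix j :: 'n
        have "pos j = pos k \<longleftrightarrow> j = k" by (rule inj_eq[OF inj_pos])
        then show "of_bool (pos j \<le> pos k) * real_of_int (m $ j) - of_bool (pos j \<le> pos k - 1) * real_of_int (m $ j)
            = (if j = k then of_int (m $ k) else 0)"
          using pos_range[of k] by (cases "pos j" "pos k" rule: linorder_cases) auto
      qed
      then show ?thesis by simp
    qed
    have "pi * quad_form (Oi ** Om') m = (\<Sum>i\<le>g. \<Sum>l\<le>g. ?t (i,l))"
      unfolding quad_form_eq sum_distrib_left by (simp add: mult_ac)
    also have "\<dots> = sum ?t ({..g} \<times> {..g})" by (simp add: sum.cartesian_product)
    also have "\<dots> = sum ?t ((\<lambda>k. (k, k - 1)) ` {1..g} \<union> H)"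
    proof (rule sum.mono_neutral_right)
      show "\<forall>p\<in>{..g} \<times> {..g} - ((\<lambda>k. (k, k - 1)) ` {1..g} \<union> H). ?t p = 0"
        by (auto simp: H_def image_iff)
    qed (auto simp: H_def)
    also have "\<dots> = sum ?t ((\<lambda>k. (k, k - 1)) ` {1..g}) + sum ?t H"
    proof (rule sum.union_disjoint)
      show "finite H" by (rule finH)
    qed (auto simp: H_def)
    also have "sum ?t ((\<lambda>k. (k, k - 1)) ` {1..g}) = (\<Sum>k=1..g. ?t (k, k - 1))"
      by (subst sum.reindex) (auto simp: inj_on_def)
    also have "\<dots> = (\<Sum>k\<in>UNIV. ?t (pos (k::'n), pos k - 1))"
      using sum_pos[where 'n = 'n, of "\<lambda>k. ?t (k, k - 1)"] g by simp
    also have "\<dots> = (\<Sum>k\<in>UNIV. d k * (of_int (m $ k))\<^sup>2)"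
      by (intro sum.cong refl) (simp only: prod.case step d_def)
    also have "sum ?t H = (\<Sum>h\<in>H. (int_inner m (b h))\<^sup>2 / 2)"
    proof (rule sum.cong[OF refl])
      fix h assume "h \<in> H"
      then obtain i l where h: "h = (i,l)" "i \<le> g" "l \<le> g" "i \<noteq> l" by (auto simp: H_def)
      have "int_inner m (b h) = sqrt (- pi * Z i (q l)) * (u m i - u m l)"
        unfolding h(1) b_def int_inner_def u_def sum_subtractf[symmetric]
        by (simp add: sum_distrib_left algebra_simps)
      moreover have "0 \<le> - pi * Z i (q l)" using neg[OF h(3,2,4)] by (simp add: mult_nonneg_nonpos less_imp_le)
      ultimately show "?t h = (int_inner m (b h))\<^sup>2 / 2" by (simp add: h(1) power_mult_distrib)
    qed
    finally show ?thesis .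
  qed
  then show ?thesis
    by (intro exI[of _ Oi] exI[of _ d] exI[of _ b] exI[of _ H] conjI allI right sym d finH)
qed

end

section \<open>Identification of the given period matrices\<close>

lemma matrix_inv_eq:
  fixes A :: "'a::field^'n^'n"
  assumes "A ** B = mat 1"
  shows "matrix_inv A = B"
proof -
  have "A ** B = mat 1 \<and> B ** A = mat 1" using assms matrix_left_right_inverse1 by blast
  then have "A ** matrix_inv A = mat 1 \<and> matrix_inv A ** A = mat 1"
    unfolding matrix_inv_def by (rule someI)
  then have "matrix_inv A ** (A ** B) = B"
    by (simp add: matrix_mul_assoc)
  then show ?thesis by (simp add: assms)
qed

lemma cmat_mult: "cmat A ** cmat B = cmat (A ** B)"
  by (simp add: matrix_matrix_mult_def vec_eq_iff)

lemma cmat_mult_imat: "cmat A ** imat B = imat (A ** B)"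
  by (simp add: matrix_matrix_mult_def vec_eq_iff sum_distrib_left mult_ac)

lemma cmat_mat_1: "cmat (mat 1) = mat 1"
  by (simp add: mat_def vec_eq_iff)

text \<open>The integral commutes with conjugation unconditionally, the value being 0 for a
  non-integrable function; so the reality of \<eta> requires no estimate of the differentials
  dr.\<close>

lemma integral_in_Reals:
  fixes f :: "real \<Rightarrow> complex"
  assumes "\<And>x. x \<in> S \<Longrightarrow> f x \<in> \<real>"
  shows "integral S f \<in> \<real>"
proof -
  have "cnj (integral S f) = integral S (\<lambda>x. cnj (f x))" by (rule integral_cnj)
  also have "\<dots> = integral S f" by (rule Henstock_Kurzweil_Integration.integral_cong) (metis assms Reals_cnj_iff)
  finally show ?thesis by (simp add: Reals_cnj_iff)
qed

text \<open>Both sides are monic of degree 2 g + 1 with the same 2 g + 1 distinct zeros, so their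
  difference has too many zeros for its degree. Comparing coefficients yields the reality of the
  \<lambda>, on which that of \<eta> rests.\<close>

lemma Lambda_eq_prod:
  assumes e: "strict_mono_on {1..2*g+1} e"
    and roots: "{x. Lambda g lam x = 0} = complex_of_real ` e ` {1..2*g+1}"
  shows "Lambda g lam z = (\<Prod>a\<in>e ` {1..2*g+1}. z - of_real a)"
    and "i \<le> 2 * g \<Longrightarrow> lam (2 * i + 2) \<in> \<real>"
proof -
  let ?N = "2 * g + 1" and ?E = "e ` {1..2*g+1}"
  define L where "L = monom 1 ?N + (\<Sum>i=0..2*g. monom (lam (2*i+2)) (2*g-i))"
  define R where "R = (\<Prod>a\<in>?E. [:- complex_of_real a, 1:])"
  have polyL: "poly L z = Lambda g lam z" for z
    by (simp add: L_def Lambda_def poly_monom poly_sum)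
  have coeffL: "coeff L n = (if ?N = n then 1 else 0) + (\<Sum>i=0..2*g. if 2*g-i = n then lam (2*i+2) else 0)" for n
    unfolding L_def coeff_add coeff_sum coeff_monom ..
  have inj: "inj_on e {1..?N}" using e by (rule strict_mono_on_imp_inj_on)
  have cardE: "card ?E = ?N" by (simp only: card_image[OF inj]) simp
  have degR: "degree R = ?N"
  proof -
    have "degree R = (\<Sum>a\<in>?E. degree [:- complex_of_real a, 1:])"
      unfolding R_def by (rule degree_prod_eq_sum_degree) auto
    also have "\<dots> = card ?E" by simp
    finally show ?thesis using cardE by simp
  qed
  have lcR: "coeff R ?N = 1"
  proof -
    have "lead_coeff R = 1" unfolding R_def lead_coeff_prod by simp
    then show ?thesis using degR by simp
  qed
  have LR: "L = R"
  proof (rule ccontr)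
    assume "L \<noteq> R"
    then have d0: "L - R \<noteq> 0" by simp
    have cL: "coeff L n = 0" if "?N < n" for n
      unfolding coeffL using that by (auto intro!: sum.neutral)
    have "degree L \<le> ?N" by (rule degree_le) (use cL in auto)
    then have "degree (L - R) \<le> ?N" using degR by (intro degree_diff_le) auto
    moreover have "coeff (L - R) ?N = 0"
    proof -
      have "(\<Sum>i=0..2*g. if 2*g-i = ?N then lam (2*i+2) else 0) = 0" by (intro sum.neutral) auto
      then show ?thesis using lcR coeffL[of ?N] by simp
    qed
    then have "degree (L - R) \<noteq> ?N" using d0 leading_coeff_0_iff by metis
    ultimately have lt: "degree (L - R) < ?N" by simp
    have "complex_of_real ` ?E \<subseteq> {z. poly (L - R) z = 0}"
    proof
      fix z assume z: "z \<in> complex_of_real ` ?E"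
      then have "poly L z = 0" unfolding polyL using roots by blast
      moreover have "poly R z = 0" using z by (auto simp: R_def poly_prod)
      ultimately show "z \<in> {z. poly (L - R) z = 0}" by simp
    qed
    then have "card (complex_of_real ` ?E) \<le> card {z. poly (L - R) z = 0}"
      by (intro card_mono poly_roots_finite[OF d0])
    also have "\<dots> \<le> degree (L - R)" by (rule card_poly_roots_bound[OF d0])
    finally show False using lt cardE by (simp add: card_image inj_on_def)
  qed
  show "Lambda g lam z = (\<Prod>a\<in>?E. z - of_real a)"
    unfolding polyL[symmetric] LR R_def by (simp add: poly_prod)
  have real: "coeff (\<Prod>a\<in>S. [:- complex_of_real a, 1:]) n \<in> \<real>" if "finite S" for S n
    using that
  proof (induction S arbitrary: n rule: finite_induct)
    case empty
    then show ?case by (simp add: coeff_1)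
  next
    case (insert a S)
    have "coeff [:- complex_of_real a, 1:] k \<in> \<real>" for k
      by (auto simp: coeff_pCons split: nat.split)
    then show ?case
      using insert unfolding prod.insert[OF insert.hyps] coeff_mult by (intro sum_in_Reals Reals_mult) auto
  qed
  assume i: "i \<le> 2 * g"
  have "(\<Sum>j=0..2*g. if 2*g-j = 2*g-i then lam (2*j+2) else 0) = (\<Sum>j=0..2*g. if j = i then lam (2*i+2) else 0)"
    by (intro sum.cong refl) (use i in auto)
  then have "coeff L (2*g-i) = (\<Sum>j=0..2*g. if j = i then lam (2*i+2) else 0)"
    unfolding coeffL using i by auto
  also have "\<dots> = lam (2*i+2)" using i by simp
  finally have "lam (2*i+2) = coeff R (2*g-i)" using LR by simp
  then show "lam (2*i+2) \<in> \<real>" unfolding R_def using real[of ?E] by simp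
qed

text \<open>Two analytic roots of L on the connected upper half plane differ by a constant sign; the
  product of roots extends continuously to the real line and so determines the boundary
  values.\<close>

lemma sqrt_branch_eq_sqrt_prod:
  assumes A: "finite A" and L: "\<And>z. L z = (\<Prod>a\<in>A. z - of_real a)" and Y: "sqrt_branch L Y"
  obtains s :: real where "s * s = 1" "\<And>x. boundary_value Y x = of_real s * sqrt_prod A (of_real x)"
proof -
  let ?S = "{z. 0 < Im z}"
  have rt2: "(sqrt_prod A z)\<^sup>2 = L z" for z
    unfolding sqrt_prod_def L by (simp add: prod_power_distrib)
  have nz: "sqrt_prod A z \<noteq> 0" if "z \<in> ?S" for z
    using that A by (auto simp: sqrt_prod_eq_0_iff)
  have Y2: "(Y z)\<^sup>2 = L z" if "z \<in> ?S" for z using Y that by (simp add: sqrt_branch_def)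
  have hol: "Y holomorphic_on ?S" using Y by (simp add: sqrt_branch_def)
  let ?f = "\<lambda>z. Y z / sqrt_prod A z"
  have f2: "?f z \<in> {1, -1}" if "z \<in> ?S" for z
  proof -
    have "(?f z)\<^sup>2 = 1"
      unfolding power_divide Y2[OF that] rt2[symmetric] using nz[OF that] by simp
    then show ?thesis by (simp add: power2_eq_1_iff)
  qed
  have "?f constant_on ?S"
  proof (rule continuous_finite_range_constant)
    show "connected ?S" by (intro convex_connected convex_halfspace_Im_gt)
    show "continuous_on ?S ?f"
      using nz by (intro continuous_intros holomorphic_on_imp_continuous_on[OF hol] holomorphic_on_imp_continuous_on[OF holomorphic_on_sqrt_prod]) auto
    show "finite (?f ` ?S)" by (rule finite_subset[OF image_subsetI[OF f2]]) auto
  qed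
  then obtain c where c: "\<And>z. z \<in> ?S \<Longrightarrow> ?f z = c" unfolding constant_on_def by blast
  have "c \<in> {1,-1}" using c[of \<i>] f2[of \<i>] by auto
  then obtain s :: real where s: "s * s = 1" "c = of_real s" by (metis insertE empty_iff mult_1 mult_minus1 minus_minus of_real_1 of_real_minus)
  have Yeq: "Y z = of_real s * sqrt_prod A z" if "z \<in> ?S" for z
    using c[OF that] nz[OF that] s(2) by (simp add: field_simps)
  have "boundary_value Y x = of_real s * sqrt_prod A (of_real x)" for x
    unfolding boundary_value_def
  proof (rule tendsto_Lim)
    have "of_real x islimpt ?S"
      unfolding islimpt_approachable
    proof (intro allI impI)
      fix \<epsilon> :: real assume "0 < \<epsilon>"
      then show "\<exists>x'\<in>?S. x' \<noteq> complex_of_real x \<and> dist x' (of_real x) < \<epsilon>"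
        by (intro bexI[of _ "of_real x + \<i> * of_real (\<epsilon> / 2)"]) (auto simp: dist_norm norm_mult complex_eq_iff)
    qed
    then show "\<not> trivial_limit (at (complex_of_real x) within ?S)" by (simp add: trivial_limit_within)
    have "(sqrt_prod A \<longlongrightarrow> sqrt_prod A (of_real x)) (at (of_real x) within {z. 0 \<le> Im z})"
      using continuous_on_sqrt_prod[of A] by (simp add: continuous_on)
    then have "(sqrt_prod A \<longlongrightarrow> sqrt_prod A (of_real x)) (at (of_real x) within ?S)"
      by (rule tendsto_within_subset) auto
    then have "((\<lambda>z. of_real s * sqrt_prod A z) \<longlongrightarrow> of_real s * sqrt_prod A (of_real x)) (at (of_real x) within ?S)"
      by (intro tendsto_intros)
    moreover have "\<forall>\<^sub>F z in at (of_real x) within ?S. of_real s * sqrt_prod A z = Y z"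
      unfolding eventually_at_filter by (intro always_eventually) (auto simp: Yeq)
    ultimately show "(Y \<longlongrightarrow> of_real s * sqrt_prod A (of_real x)) (at (of_real x) within ?S)"
      by (rule Lim_transform_eventually)
  qed
  with s(1) show thesis by (rule that)
qed

context real_hyperelliptic
begin

text \<open>The closed interval and \<open>I j\<close> differ only by branch points, where h is
  0.\<close>

lemma integral_h:
  assumes j: "1 \<le> j" "j < N" and p: "low_deg p"
  shows "integral {e j..e (j + 1)} (h p) = H j p"
proof -
  have ind: "indicator {e j..e (j + 1)} x *\<^sub>R h p x = indicator (I j) x *\<^sub>R h p x" for x
  proof (cases "x \<in> E")
    case False
    then obtain i where i: "i \<le> N" "x \<in> I i" using ex_I by blast
    show ?thesis
    proof (cases i j rule: linorder_cases)
      case less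
      then have "x < e j" using i j by (auto simp: I_def)
      then show ?thesis using I_less[OF less _ i(2), of x] j by (auto simp: indicator_def)
    next
      case greater
      then have "e (j + 1) < x" using i j by (auto simp: I_def)
      then show ?thesis using I_less[OF greater i(1) _ i(2), of x] by (auto simp: indicator_def)
    next
      case equal
      then have "e j < x" "x < e (j + 1)" using i j by (auto simp: I_def)
      then show ?thesis using i equal by (simp add: indicator_def)
    qed
  qed (simp add: h_on_E)
  have "set_integrable lborel {e j..e (j + 1)} (h p)"
    unfolding set_integrable_def ind by (rule indicator_h_integrable[OF p])
  then have "(LINT x:{e j..e (j + 1)}|lborel. h p x) = integral {e j..e (j + 1)} (h p)"
    by (rule set_borel_integral_eq_integral)
  then show ?thesis unfolding set_lebesgue_integral_def ind H_def by simp
qed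

text \<open>s is its own inverse, so the sign of the branch moves from the denominator to the
  numerator.\<close>

lemma du_eq:
  assumes s: "s * s = 1" and y: "\<And>x. y x = of_real s * sqrt_prod E (of_real x)"
  shows "du g y n = (\<lambda>x. of_real (- s / 2) * h (monom 1 (g - n)) x)"
proof
  fix x
  have c: "1 / complex_of_real s = of_real s"
    using arg_cong[OF s, of complex_of_real] by (cases "s = 0") (auto simp: field_simps)
  have "h (monom 1 (g - n)) x = of_real x ^ (g - n) / sqrt_prod E (of_real x)"
    unfolding h_def sqrt_quot_def poly_cpoly by (simp add: poly_monom)
  then have "of_real (- s / 2) * h (monom 1 (g - n)) x = - (1/2) * (1 / complex_of_real s) * (of_real x ^ (g - n) / sqrt_prod E (of_real x))"
    unfolding c by simp
  then show "du g y n x = of_real (- s / 2) * h (monom 1 (g - n)) x"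
    by (simp add: du_def y)
qed

lemma omega_eq:
  assumes g: "g = CARD('n)" and s: "s * s = 1" and y: "\<And>x. y x = of_real s * sqrt_prod E (of_real x)"
  shows "(omega e y :: ('n::{finite,linorder}) cmat) = cmat (\<chi> i k. s * X (pos k) (monom 1 (g - pos i)))"
    and "(omega' e y :: 'n cmat) = imat (\<chi> i k. s * V (pos k) (monom 1 (g - pos i)))"
proof -
  have int: "integral {e j..e (j + 1)} (du CARD('n) y (pos i)) = of_real (- s / 2) * H j (monom 1 (g - pos i))"
    if "1 \<le> j" "j < N" for j and i :: 'n
    unfolding g[symmetric] du_eq[OF s y]
    by (simp only: integral_mult_right integral_h[OF that low_deg_monom[OF g]])
  show "(omega e y :: 'n cmat) = cmat (\<chi> i k. s * X (pos k) (monom 1 (g - pos i)))"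
  proof -
    have "2 * integral {e (2 * pos k - 1)..e (2 * pos k)} (du CARD('n) y (pos i)) = of_real (s * X (pos k) (monom 1 (g - pos i)))" for i k :: 'n
    proof -
      have k: "pos k \<in> {1..g}" using pos_range[of k] g by simp
      then have "integral {e (2 * pos k - 1)..e (2 * pos k - 1 + 1)} (du CARD('n) y (pos i)) = of_real (- s / 2) * H (2 * pos k - 1) (monom 1 (g - pos i))"
        by (intro int) (auto simp: N_eq)
      moreover have "2 * pos k - 1 + 1 = 2 * pos k" using k by auto
      moreover have "H (2 * pos k - 1) (monom 1 (g - pos i)) = of_real (- X (pos k) (monom 1 (g - pos i)))"
        by (rule H_odd(1)) (use k in auto)
      ultimately show ?thesis by (simp add: mult.commute del: One_nat_def)
    qed
    then show ?thesis by (simp add: omega_def vec_eq_iff del: One_nat_def)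
  qed
  show "(omega' e y :: 'n cmat) = imat (\<chi> i k. s * V (pos k) (monom 1 (g - pos i)))"
  proof -
    have "2 * (\<Sum>l=pos k..CARD('n). integral {e (2*l)..e (2*l+1)} (du CARD('n) y (pos i))) = \<i> * of_real (s * V (pos k) (monom 1 (g - pos i)))" for i k :: 'n
    proof -
      have "(\<Sum>l=pos k..CARD('n). integral {e (2*l)..e (2*l+1)} (du CARD('n) y (pos i))) =
          (\<Sum>l=pos k..g. \<i> * of_real (s / 2) * of_real (Z l (monom 1 (g - pos i))))"
        unfolding g
      proof (rule sum.cong[OF refl])
        fix l assume l: "l \<in> {pos k..CARD('n)}"
        then have "integral {e (2*l)..e (2*l+1)} (du CARD('n) y (pos i)) = of_real (- s / 2) * H (2*l) (monom 1 (g - pos i))"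
          using pos_range[of k] g by (intro int) (auto simp: N_eq)
        also have "H (2*l) (monom 1 (g - pos i)) = - \<i> * of_real (Z l (monom 1 (g - pos i)))"
          by (rule H_even(1)) (use l g in auto)
        finally show "integral {e (2*l)..e (2*l+1)} (du CARD('n) y (pos i)) = \<i> * of_real (s / 2) * of_real (Z l (monom 1 (CARD('n) - pos i)))"
          by (simp add: g)
      qed
      then show ?thesis by (simp add: V_def sum_distrib_left mult_ac)
    qed
    then show ?thesis by (simp add: omega'_def vec_eq_iff)
  qed
qed

text \<open>To the right of a point inside a cut lies an even number of branch points, so the power
  of i is real and y is real on the cut; at its ends y is 0.\<close>

lemma eta_in_Reals:
  assumes g: "g = CARD('n)" and y: "\<And>x. y x = of_real s * sqrt_prod E (of_real x)"
    and lam: "\<And>j. j \<le> 2 * g + 1 \<Longrightarrow> lam (2 * j) \<in> \<real>"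
  shows "(eta lam e y :: ('n::{finite,linorder}) cmat) $ i $ k \<in> \<real>"
proof -
  have k: "pos k \<in> {1..g}" and i: "pos i \<in> {1..g}" using pos_range[of k] pos_range[of i] g by simp_all
  have y_real: "y x \<in> \<real>" if x: "x \<in> {e (2 * pos k - 1)..e (2 * pos k)}" for x
  proof (cases "x \<in> E")
    case True
    then have "sqrt_prod E (of_real x) = 0" using finite_E by (auto simp: sqrt_prod_eq_0_iff)
    then show ?thesis by (simp add: y)
  next
    case False
    then obtain j where j: "j \<le> N" "x \<in> I j" using ex_I by blast
    have "j = 2 * pos k - 1"
    proof (cases j "2 * pos k - 1" rule: linorder_cases)
      case less
      then have "2 * pos k - 1 \<in> {j+1..N}" using k by (auto simp: N_eq)
      then have "x < e (2 * pos k - 1)" using j(2) unfolding I_def by blast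
      then show ?thesis using x by simp
    next
      case greater
      then have "2 * pos k \<in> {1..j}" using k by auto
      then have "e (2 * pos k) < x" using j(2) unfolding I_def by blast
      then show ?thesis using x by simp
    qed
    then have "N - j = 2 * (g + 1 - pos k)" using k by (auto simp: N_eq)
    then have "\<i> ^ (N - j) = of_real ((- 1) ^ (g + 1 - pos k))" by (simp add: power_mult)
    then show ?thesis unfolding y sqrt_prod_on_I[OF j] by (metis Reals_mult Reals_of_real)
  qed
  have "dr CARD('n) lam y (pos i) x \<in> \<real>" if "x \<in> {e (2 * pos k - 1)..e (2 * pos k)}" for x
  proof -
    have "lam (2 * j) \<in> \<real>" if "j \<in> {0..2 * pos i - 2}" for j
      by (rule lam) (use that i in auto)
    moreover have "y x \<in> \<real>" using y_real[OF that] .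
    ultimately show ?thesis
      unfolding dr_def by (intro Reals_divide sum_in_Reals Reals_mult Reals_power) auto
  qed
  then have "integral {e (2 * pos k - 1)..e (2 * pos k)} (dr CARD('n) lam y (pos i)) \<in> \<real>"
    by (rule integral_in_Reals)
  then show ?thesis unfolding eta_def by (simp add: Reals_mult del: One_nat_def)
qed

end

theorem mainTheorem6:
  fixes lam :: "nat \<Rightarrow> complex" and e :: "nat \<Rightarrow> real"
    and Y :: "complex \<Rightarrow> complex" and y :: "real \<Rightarrow> complex"
    and \<epsilon>' \<epsilon> :: "('n::{finite,linorder}) ivec" and C :: complex
    and \<sigma> :: "'n cvec \<Rightarrow> complex"
  assumes "lam 0 = 1"
    and "strict_mono_on {1..2*CARD('n)+1} e"
    and "{x. Lambda CARD('n) lam x = 0} = complex_of_real ` e ` {1..2*CARD('n)+1}"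
    and "sqrt_branch (Lambda CARD('n) lam) Y"
    and "y = boundary_value Y"
    and "is_riemann_char \<epsilon>' \<epsilon>"
    and "C \<noteq> 0"
    and "\<sigma> = sigma C \<epsilon>' \<epsilon> lam e y"
  shows "(\<forall>u \<in> half_period_subspace e y. \<sigma> u \<noteq> 0 \<and> wp11 \<sigma> u \<in> \<real>)
       \<and> bounded (wp11 \<sigma> ` half_period_subspace e y)"
proof -
  define g where "g = CARD('n)"
  define N where "N = 2 * g + 1"
  have g1: "1 \<le> g" unfolding g_def by (simp add: Suc_le_eq)
  interpret P: real_hyperelliptic e N g
    by unfold_locales (use assms(2) g1 in \<open>simp_all add: N_def g_def\<close>)
  have E: "P.E = e ` {1..2 * g + 1}" by (simp only: P.E_def flip: N_def)
  note L = Lambda_eq_prod[OF assms(2,3), folded g_def]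
  have L': "Lambda CARD('n) lam z = (\<Prod>a\<in>P.E. z - of_real a)" for z
    using L(1) unfolding E g_def .
  obtain s :: real where s: "s * s = 1" and "\<And>x. boundary_value Y x = of_real s * sqrt_prod P.E (of_real x)"
    using sqrt_branch_eq_sqrt_prod[OF P.finite_E L' assms(4)] by blast
  then have y: "y x = of_real s * sqrt_prod P.E (of_real x)" for x by (simp add: assms(5))
  define Om :: "'n rmat" where "Om = (\<chi> i k. s * P.X (pos k) (monom 1 (g - pos i)))"
  define Om' :: "'n rmat" where "Om' = (\<chi> i k. s * P.V (pos k) (monom 1 (g - pos i)))"
  have Om_nth: "Om $ i $ k = s * P.X (pos k) (monom 1 (g - pos i))"
    and Om'_nth: "Om' $ i $ k = s * P.V (pos k) (monom 1 (g - pos i))" for i k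
    by (simp_all add: Om_def Om'_def)
  obtain Oi :: "'n rmat" and d b and H :: "(nat \<times> nat) set" where *: "Om ** Oi = mat 1 \<and>
      transpose (Oi ** Om') = Oi ** Om' \<and> (\<forall>k. 0 < d k) \<and> finite H \<and>
      (\<forall>m. pi * quad_form (Oi ** Om') m = (\<Sum>k\<in>UNIV. d k * (of_int (m $ k))\<^sup>2) + (\<Sum>h\<in>H. (int_inner m (b h))\<^sup>2 / 2))"
    using P.period_matrices[OF g_def s Om_nth Om'_nth] by (elim exE)
  have Oi: "Om ** Oi = mat 1" and B: "transpose (Oi ** Om') = Oi ** Om'"
    and d: "\<And>k. 0 < d k" and H: "finite H"
    and quad_form: "\<And>m. pi * quad_form (Oi ** Om') m = (\<Sum>k\<in>UNIV. d k * (of_int (m $ k))\<^sup>2) + (\<Sum>h\<in>H. (int_inner m (b h))\<^sup>2 / 2)"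
    using * by simp_all
  have om: "omega e y = cmat Om" and om': "omega' e y = imat Om'"
    unfolding Om_def Om'_def by (rule P.omega_eq[OF g_def s y])+
  have inv: "matrix_inv (omega e y) = cmat Oi"
    unfolding om by (rule matrix_inv_eq) (simp only: cmat_mult Oi cmat_mat_1)
  \<comment> \<open>The coefficients of Lambda start at \<lambda>_2; j = 0 is covered by \<lambda>_0
    = 1, which also occurs in dr.\<close>
  have lam: "lam (2 * j) \<in> \<real>" if "j \<le> 2 * g + 1" for j
    using assms(1) L(2)[of "j - 1"] that by (cases j) auto
  have eta: "eta lam e y $ i $ j \<in> \<real>" for i j :: 'n
  proof (rule P.eta_in_Reals[OF g_def])
    show "y x = of_real s * sqrt_prod P.E (of_real x)" for x by (rule y)
    show "lam (2 * j) \<in> \<real>" if "j \<le> 2 * g + 1" for j using that by (rule lam)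
  qed
  \<comment> \<open>A diagonal entry is all that the exponential factor of sigma contributes to
    \<open>wp11\<close>.\<close>
  have kappa: "varkappa lam e y $ i $ i \<in> \<real>" for i :: 'n
  proof -
    have "varkappa lam e y $ i $ i = (\<Sum>k\<in>UNIV. eta lam e y $ i $ k * of_real (Oi $ k $ i))"
      by (simp add: varkappa_def inv matrix_matrix_mult_def)
    then show ?thesis by (simp only:) (intro sum_in_Reals Reals_mult eta Reals_of_real)
  qed
  have eps: "\<epsilon>' $ k = 1" for k using assms(6) by (simp add: is_riemann_char_def)
  define hp :: "'n cvec" where "hp = (\<Sum>k\<in>UNIV. (1/2) *s column k (omega' e y))"
  \<comment> \<open>Since \<epsilon>' = (1,...,1), the sum of the columns is a matrix-vector
    product, and the inverse of \<omega> maps the base point to the half period \<tau>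
    \<epsilon>'/2.\<close>
  have hp: "cmat Oi *v hp = (1/2) *s (imat (Oi ** Om') *v vec_of_int \<epsilon>')"
  proof -
    have "hp = (1/2) *s (omega' e y *v vec_of_int \<epsilon>')"
      by (simp add: hp_def vec_eq_iff matrix_vector_mult_def column_def vec_of_int_def eps sum_distrib_left)
    then show ?thesis
      by (simp add: matrix_vector_smult om' matrix_vector_mul_assoc cmat_mult_imat)
  qed
  have sig: "\<sigma> u = C * exp (- (1/2) * dotp u (varkappa lam e y *v u)) * theta_char \<epsilon>' \<epsilon> (cmat Oi *v u) (imat (Oi ** Om'))" for u
    unfolding assms(8) sigma_def inv om' cmat_mult_imat ..
  have sub: "half_period_subspace e y = range (\<lambda>s. hp + cvec s)"
    by (auto simp: half_period_subspace_def hp_def)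
  show ?thesis
    using wp11_real_bounded_half_period[OF sig assms(7) kappa eps B hp d H quad_form]
    unfolding sub by (simp add: image_image)
qed

end
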